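(* Let $p$ be a prime and let $N$ be a finite $p$-group such that $N \in \mathcal{CD}(N)$ and $\Phi(N) \leq \mathrm{Z}(N)$. For any integers $m \geq 1$ and $n \geq 2$ there exist a finite $p$-group $P$ (denoted $\mathcal{LE}(m,n)$) and a normal embedding of $N$ into $P$ such that $\mathcal{CD}(P)$ is a $3$-string whose center component is lattice isomorphic to $\mathcal{CD}(N)$ and whose two remaining components (the bottom one and the top one) are $m$-diamonds.
   Context: All groups are finite. For a finite group $G$ and $H \leq G$, the Chermak-Delgado measure of $H$ in $G$ is $m_G(H) = |H|\,|C_G(H)|$; $m^*(G)$ is the maximum of $m_G(H)$ over all $H \leq G$; and $\mathcal{CD}(G)$ (the Chermak-Delgado lattice) is the set of all $H \leq G$ with $m_G(H) = m^*(G)$, a sublattice of the subgroup lattice of $G$. $\Phi$ denotes the Frattini subgroup and $\mathrm{Z}$ the center. A normal embedding of $N$ into $P$ is an injective homomorphism $N \to P$ whose image is a normal subgroup of $P$. An $m$-diamond is a lattice isomorphic to the $m$-dimensional cube, i.e. the lattice of all subsets of an $m$-element set. A $3$-string with components $L_1$ (bottom), $L_2$ (center), $L_3$ (top) is the lattice obtained by adjoining these lattices end-to-end: the maximum of $L_1$ is identified with the minimum of $L_2$ and the maximum of $L_2$ is identified with the minimum of $L_3$. The components are not required to be mutually isomorphic, and a component may consist of a single element. *)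

theory Defs
  imports "HOL-Algebra.Coset" "HOL-Computational_Algebra.Primes"
begin

definition p_group :: "nat \<Rightarrow> ('a, 'b) monoid_scheme \<Rightarrow> bool" where
  "p_group p G \<longleftrightarrow> group G \<and> finite (carrier G) \<and> (\<exists>k. order G = p ^ k)"

definition centralizer :: "('a, 'b) monoid_scheme \<Rightarrow> 'a set \<Rightarrow> 'a set" where
  "centralizer G H = {g \<in> carrier G. \<forall>h\<in>H. g \<otimes>\<^bsub>G\<^esub> h = h \<otimes>\<^bsub>G\<^esub> g}"

definition center :: "('a, 'b) monoid_scheme \<Rightarrow> 'a set" where
  "center G = centralizer G (carrier G)"

definition maximal_subgroup :: "'a set \<Rightarrow> ('a, 'b) monoid_scheme \<Rightarrow> bool" where
  "maximal_subgroup M G \<longleftrightarrow> subgroup M G \<and> M \<noteq> carrier G \<and>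
     (\<forall>K. subgroup K G \<and> M \<subseteq> K \<longrightarrow> K = M \<or> K = carrier G)"

text \<open>Intersecting with the carrier makes the Frattini subgroup of a group without
  maximal subgroups (among finite groups: the trivial group) the whole group.\<close>

definition frattini :: "('a, 'b) monoid_scheme \<Rightarrow> 'a set" where
  "frattini G = carrier G \<inter> \<Inter>{M. maximal_subgroup M G}"

definition cd_measure :: "('a, 'b) monoid_scheme \<Rightarrow> 'a set \<Rightarrow> nat" where
  "cd_measure G H = card H * card (centralizer G H)"

definition cd_max :: "('a, 'b) monoid_scheme \<Rightarrow> nat" where
  "cd_max G = Max (cd_measure G ` {H. subgroup H G})"

definition CD :: "('a, 'b) monoid_scheme \<Rightarrow> 'a set gorder" where
  "CD G = \<lparr>carrier = {H. subgroup H G \<and> cd_measure G H = cd_max G},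
           eq = (=), le = (\<subseteq>)\<rparr>"

definition normal_embedding ::
    "('a \<Rightarrow> 'c) \<Rightarrow> ('a, 'b) monoid_scheme \<Rightarrow> ('c, 'd) monoid_scheme \<Rightarrow> bool" where
  "normal_embedding f N P \<longleftrightarrow> f \<in> mon N P \<and> f ` carrier N \<lhd> P"

text \<open>Both \<^const>\<open>join_pres\<close> and \<^const>\<open>meet_pres\<close> include that the two orders are lattices.\<close>

definition lattice_isomorphic :: "'a gorder \<Rightarrow> 'b gorder \<Rightarrow> bool" where
  "lattice_isomorphic L M \<longleftrightarrow>
     (\<exists>f. bij_betw f (carrier L) (carrier M) \<and> join_pres L M f \<and> meet_pres L M f)"

definition cube :: "nat \<Rightarrow> nat set gorder" where
  "cube m = \<lparr>carrier = Pow {..<m}, eq = (=), le = (\<subseteq>)\<rparr>"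

definition diamond :: "nat \<Rightarrow> 'a gorder \<Rightarrow> bool" where
  "diamond m L \<longleftrightarrow> lattice_isomorphic L (cube m)"

text \<open>Here \<open>L\<close> lies below \<open>M\<close>. The maximum of \<open>L\<close> also serves as the minimum of \<open>M\<close>, whose own
  copy is dropped. This is the intended gluing when \<open>L\<close> has a maximum and \<open>M\<close> a minimum.\<close>

definition adjoin :: "'a gorder \<Rightarrow> 'b gorder \<Rightarrow> ('a + 'b) gorder" where
  "adjoin L M =
     \<lparr>carrier = Inl ` carrier L \<union> Inr ` (carrier M - {\<bottom>\<^bsub>M\<^esub>}),
      eq = (=),
      le = (\<lambda>x y. case (x, y) of
              (Inl a, Inl b) \<Rightarrow> a \<sqsubseteq>\<^bsub>L\<^esub> b
            | (Inl a, Inr b) \<Rightarrow> True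
            | (Inr a, Inl b) \<Rightarrow> False
            | (Inr a, Inr b) \<Rightarrow> a \<sqsubseteq>\<^bsub>M\<^esub> b)\<rparr>"

definition three_string ::
    "'a gorder \<Rightarrow> 'b gorder \<Rightarrow> 'c gorder \<Rightarrow> (('a + 'b) + 'c) gorder" where
  "three_string L1 L2 L3 = adjoin (adjoin L1 L2) L3"

end

theory Submission
  imports Defs "HOL-Algebra.Product_Groups" "HOL-Algebra.Zassenhaus" "HOL-Algebra.Group_Action"
    "HOL-Algebra.Multiplicative_Group"
begin

text \<open>The group \<open>P\<close> is a direct product \<open>T \<times> Q\<close>. The factor \<open>T\<close> is a class 2 extension of \<open>N \<times> X \<times> Y\<close>,
  with \<open>X\<close> and \<open>Y\<close> consisting of \<open>m\<close> blocks \<open>Z\<^sub>p\<^sup>n\<close>, by a central elementary abelian group in which all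
  the commutators that should not vanish are as independent as possible; its lattice is the desired
  3-string, but \<open>N\<close> is not normal in \<open>T\<close>. The factor \<open>Q\<close> contains \<open>N\<close> as a normal subgroup and has a
  one-element lattice, so it does not change the lattice of the product.

  To find \<open>Q\<close>, let an abelian group of automorphisms of \<open>N\<close> act that centralizes both an abelian
  subgroup \<open>B \<supseteq> center N\<close> and \<open>N / B\<close>. If every element outside \<open>B\<close> is moved by sufficiently many of
  them, the abelian normal subgroup generated by \<open>B\<close> and the automorphisms is the only subgroup of
  maximal measure. Central automorphisms suffice when the center has two subgroups of order \<open>p\<close>;
  otherwise \<open>N / center N\<close> is a symplectic space and lifts of transvections are used as well.\<close>

section \<open>The lattice of subgroups of maximal measure\<close>

text \<open>The hypothesis that \<open>N\<close> itself has maximal measure makes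
  \<open>center N\<close> and \<open>carrier N\<close> the least and the greatest element of
  \<open>CD N\<close>; these are the points where the two diamonds are attached. The cubes come from
  an exact trade: enlarging the X-part of a subgroup of \<open>T\<close> by one block gains a factor
  p^n, and the centralizer then loses precisely the corresponding block of its Y-part, so the
  measure does not change. The obstacle is a subgroup and a commuting partner that both have nonzero
  X-part. Pairing \<open>X\<close> freely with itself confines both X-parts to a common line and
  costs each side a Y-block. The product of the orders then carries at most p^2 where p^(2n) was
  available, and \<open>n \<ge> 2\<close> makes this a strict loss. The Frattini hypothesis makes
  \<open>N / center N\<close> elementary abelian, so homomorphisms from \<open>N\<close> to Z_p
  detect membership in the center. Since the lattice of a direct product is the product of the
  lattices of the factors, \<open>N\<close> need not meet \<open>T\<close> at all: it is embedded as
  a subgroup of the factor \<open>Q\<close> alone.\<close>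

lemma card_fibres_const:
  assumes "finite X" "f ` X = Y" "\<And>y. y \<in> Y \<Longrightarrow> card {x \<in> X. f x = y} = c"
  shows "card X = card Y * c"
proof -
  have "card X = (\<Sum>y\<in>Y. card {x \<in> X. f x = y})"
    using sum.image_gen[OF assms(1), of "\<lambda>_. 1::nat" f] assms(2) by simp
  then show ?thesis using assms(3) by simp
qed

context group
begin

text \<open>The fibre of multiplication over \<open>h \<otimes> k\<close> consists of the pairs
  \<open>(h \<otimes> d, inv d \<otimes> k)\<close> with \<open>d \<in> H \<inter> K\<close>, so all
  fibres have the same size. The complex \<open>H <#> K\<close> is only a set here and need not be a
  subgroup.\<close>

lemma card_set_mult_times_Int:
  assumes "subgroup H G" "subgroup K G" "finite (carrier G)"
  shows "card (H <#> K) * card (H \<inter> K) = card H * card K"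
proof -
  interpret H: subgroup H G by fact
  interpret K: subgroup K G by fact
  have fin: "finite H" "finite K" using assms(3) H.subset K.subset finite_subset by auto
  let ?f = "\<lambda>(h, k). h \<otimes> k"
  have im: "?f ` (H \<times> K) = H <#> K" by (auto simp: set_mult_def)
  have "card {x \<in> H \<times> K. ?f x = y} = card (H \<inter> K)" if "y \<in> H <#> K" for y
  proof -
    from that obtain h k where hk: "h \<in> H" "k \<in> K" "y = h \<otimes> k" by (auto simp: set_mult_def)
    have "bij_betw (\<lambda>d. (h \<otimes> d, inv d \<otimes> k)) (H \<inter> K) {x \<in> H \<times> K. ?f x = y}"
    proof (rule bij_betw_byWitness[where f' = "\<lambda>(a, b). inv h \<otimes> a"])
      show "\<forall>a\<in>H \<inter> K. (case (h \<otimes> a, inv a \<otimes> k) of (a, b) \<Rightarrow> inv h \<otimes> a) = a"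
        using hk by (auto simp: m_assoc[symmetric])
      show "\<forall>a'\<in>{x \<in> H \<times> K. ?f x = y}.
          (h \<otimes> (case a' of (a, b) \<Rightarrow> inv h \<otimes> a), inv (case a' of (a, b) \<Rightarrow> inv h \<otimes> a) \<otimes> k) = a'"
      proof
        fix q assume "q \<in> {x \<in> H \<times> K. ?f x = y}"
        then obtain a b where ab: "a \<in> H" "b \<in> K" "a \<otimes> b = y" and q: "q = (a, b)" by auto
        have "inv a \<otimes> (h \<otimes> k) = b" using ab hk by (metis H.mem_carrier K.mem_carrier inv_solve_left m_closed)
        then show "(h \<otimes> (case q of (a, b) \<Rightarrow> inv h \<otimes> a),
            inv (case q of (a, b) \<Rightarrow> inv h \<otimes> a) \<otimes> k) = q"
          using ab hk q by (auto simp: m_assoc[symmetric] inv_mult_group)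
      qed
      show "(\<lambda>d. (h \<otimes> d, inv d \<otimes> k)) ` (H \<inter> K) \<subseteq> {x \<in> H \<times> K. ?f x = y}"
      proof
        fix q assume "q \<in> (\<lambda>d. (h \<otimes> d, inv d \<otimes> k)) ` (H \<inter> K)"
        then obtain d where d: "d \<in> H" "d \<in> K" and q: "q = (h \<otimes> d, inv d \<otimes> k)" by auto
        have "h \<otimes> d \<otimes> (inv d \<otimes> k) = h \<otimes> (d \<otimes> inv d) \<otimes> k"
          using d hk by (simp only: m_assoc H.mem_carrier K.mem_carrier inv_closed m_closed)
        then show "q \<in> {x \<in> H \<times> K. ?f x = y}"
          using d hk q by simp
      qed
      show "(\<lambda>(a, b). inv h \<otimes> a) ` {x \<in> H \<times> K. ?f x = y} \<subseteq> H \<inter> K"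
      proof
        fix q assume "q \<in> (\<lambda>(a, b). inv h \<otimes> a) ` {x \<in> H \<times> K. ?f x = y}"
        then obtain a b where ab: "a \<in> H" "b \<in> K" "a \<otimes> b = y" and q: "q = inv h \<otimes> a" by auto
        have "inv h \<otimes> a = k \<otimes> inv b"
          using ab hk by (metis H.mem_carrier K.mem_carrier inv_closed inv_solve_left inv_solve_right m_assoc m_closed)
        moreover have "inv h \<otimes> a \<in> H" "k \<otimes> inv b \<in> K" using ab hk by auto
        ultimately show "q \<in> H \<inter> K" using q by auto
      qed
    qed
    then show ?thesis by (simp add: bij_betw_same_card)
  qed
  from card_fibres_const[OF _ im this] show ?thesis using fin by (simp add: card_cartesian_product)
qed

lemma subgroup_centralizer:
  assumes "H \<subseteq> carrier G" shows "subgroup (centralizer G H) G"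
proof (rule subgroupI)
  show "centralizer G H \<subseteq> carrier G" "centralizer G H \<noteq> {}"
    using assms by (auto simp: centralizer_def intro!: exI[of _ \<one>])
next
  fix a assume a: "a \<in> centralizer G H"
  have "inv a \<otimes> h = h \<otimes> inv a" if h: "h \<in> H" for h
  proof -
    have "a \<in> carrier G" "h \<in> carrier G" "a \<otimes> h = h \<otimes> a" using a h assms by (auto simp: centralizer_def)
    then show ?thesis by (metis inv_closed inv_solve_left inv_solve_right m_assoc m_closed)
  qed
  then show "inv a \<in> centralizer G H" using a by (auto simp: centralizer_def)
next
  fix a b assume a: "a \<in> centralizer G H" and b: "b \<in> centralizer G H"
  have "a \<otimes> b \<otimes> h = h \<otimes> (a \<otimes> b)" if h: "h \<in> H" for h
  proof -
    have "a \<in> carrier G" "b \<in> carrier G" "h \<in> carrier G" "a \<otimes> h = h \<otimes> a" "b \<otimes> h = h \<otimes> b"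
      using a b h assms by (auto simp: centralizer_def)
    then show ?thesis by (metis m_assoc)
  qed
  then show "a \<otimes> b \<in> centralizer G H" using a b by (auto simp: centralizer_def)
qed

lemma centralizer_antimono: "H \<subseteq> K \<Longrightarrow> centralizer G K \<subseteq> centralizer G H"
  by (auto simp: centralizer_def)

lemma subset_centralizer_iff:
  assumes "H \<subseteq> carrier G" "K \<subseteq> carrier G"
  shows "H \<subseteq> centralizer G K \<longleftrightarrow> K \<subseteq> centralizer G H"
proof -
  have "H \<subseteq> centralizer G K \<longleftrightarrow> (\<forall>h\<in>H. \<forall>k\<in>K. h \<otimes> k = k \<otimes> h)"
    using assms by (auto simp: centralizer_def)
  also have "\<dots> \<longleftrightarrow> K \<subseteq> centralizer G H"
    using assms unfolding centralizer_def subset_iff mem_Collect_eq by (metis subsetD)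
  finally show ?thesis .
qed

lemma subset_double_centralizer: "H \<subseteq> carrier G \<Longrightarrow> H \<subseteq> centralizer G (centralizer G H)"
  using subset_centralizer_iff[of H "centralizer G H"] by (auto simp: centralizer_def)

lemma finite_subgroups: "finite (carrier G) \<Longrightarrow> finite {H. subgroup H G}"
  by (rule finite_subset[of _ "Pow (carrier G)"]) (auto dest: subgroup.subset)

lemma cd_measure_le_max:
  assumes "finite (carrier G)" "subgroup H G" shows "cd_measure G H \<le> cd_max G"
  unfolding cd_max_def using assms finite_subgroups by (intro Max_ge) auto

lemma cd_max_eqI:
  assumes "finite (carrier G)" "\<And>H. subgroup H G \<Longrightarrow> cd_measure G H \<le> c"
    and "subgroup K G" "cd_measure G K = c"
  shows "cd_max G = c"
  unfolding cd_max_def using assms finite_subgroups by (intro Max_eqI) auto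

lemma cd_max_attained:
  assumes "finite (carrier G)" obtains H where "subgroup H G" "cd_measure G H = cd_max G"
proof -
  have "{H. subgroup H G} \<noteq> {}" using subgroup_self by auto
  then have "cd_max G \<in> cd_measure G ` {H. subgroup H G}"
    unfolding cd_max_def using assms finite_subgroups by (intro Max_in) auto
  then show ?thesis using that by auto
qed

lemma cd_measure_pos:
  assumes "finite (carrier G)" "subgroup H G" shows "cd_measure G H > 0"
proof -
  have sg: "subgroup (centralizer G H) G" using assms subgroup_centralizer subgroup.subset by blast
  have "card K > 0" if "subgroup K G" for K
    using that assms(1) by (metis card_gt_0_iff empty_iff finite_subset subgroup.one_closed subgroup.subset)
  then show ?thesis using assms(2) sg by (simp add: cd_measure_def)
qed

lemma carrier_CD: "carrier (CD G) = {H. subgroup H G \<and> cd_measure G H = cd_max G}"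
  by (simp add: CD_def)

lemma subgroup_Int: "subgroup H G \<Longrightarrow> subgroup K G \<Longrightarrow> subgroup (H \<inter> K) G"
  by (metis subgroups_Inter_pair)

text \<open>The product formula is applied to \<open>H\<close> and \<open>K\<close> and also to
  their centralizers. The complex \<open>H <#> K\<close> lies in the join, and the intersection of
  the centralizers centralizes the join; dually, the complex of the centralizers centralizes
  \<open>H \<inter> K\<close>. Multiplying the two formulas gives the inequality.\<close>

lemma cd_measure_join_meet:
  assumes fin: "finite (carrier G)" and H: "subgroup H G" and K: "subgroup K G"
  shows "cd_measure G H * cd_measure G K
    \<le> cd_measure G (generate G (H \<union> K)) * cd_measure G (H \<inter> K)"
proof -
  let ?C = "centralizer G" and ?J = "generate G (H \<union> K)"
  have sub: "H \<subseteq> carrier G" "K \<subseteq> carrier G" using H K subgroup.subset by auto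
  have CH: "subgroup (?C H) G" and CK: "subgroup (?C K) G" using sub subgroup_centralizer by auto
  have J: "subgroup ?J G" using sub by (intro generate_is_subgroup) auto
  have fins: "finite ?J" "finite (?C (H \<inter> K))"
    using J fin finite_subset subgroup.subset by (blast, auto simp: centralizer_def)
  have HJ: "H \<subseteq> ?J" "K \<subseteq> ?J" using generate.incl[of _ "H \<union> K" G] by auto
  have "H <#> K \<subseteq> ?J"
    using HJ subgroup.m_closed[OF J] by (auto simp: set_mult_def)
  then have a: "card (H <#> K) \<le> card ?J" using fins card_mono by blast
  have CI: "subgroup (?C (H \<inter> K)) G" using sub by (intro subgroup_centralizer) auto
  have "?C H <#> ?C K \<subseteq> ?C (H \<inter> K)"
    using centralizer_antimono[of "H \<inter> K" H] centralizer_antimono[of "H \<inter> K" K]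
      subgroup.m_closed[OF CI] by (auto simp: set_mult_def)
  then have b: "card (?C H <#> ?C K) \<le> card (?C (H \<inter> K))" using fins card_mono by blast
  have "H \<subseteq> ?C (?C H \<inter> ?C K)" "K \<subseteq> ?C (?C H \<inter> ?C K)"
    using sub subset_double_centralizer centralizer_antimono[of "?C H \<inter> ?C K"] by blast+
  then have "?J \<subseteq> ?C (?C H \<inter> ?C K)"
    using generate_subgroup_incl[of "H \<union> K" "?C (?C H \<inter> ?C K)"]
      subgroup_centralizer[of "?C H \<inter> ?C K"] by (auto simp: centralizer_def)
  then have "?C H \<inter> ?C K \<subseteq> ?C ?J"
    using subset_centralizer_iff[of ?J "?C H \<inter> ?C K"] J subgroup.subset
    by (metis (no_types, lifting) CH le_infI1)
  then have c: "card (?C H \<inter> ?C K) \<le> card (?C ?J)"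
    using fin by (intro card_mono) (auto simp: centralizer_def)
  have "cd_measure G H * cd_measure G K = (card H * card K) * (card (?C H) * card (?C K))"
    by (simp add: cd_measure_def)
  also have "\<dots> = (card (H <#> K) * card (H \<inter> K)) * (card (?C H <#> ?C K) * card (?C H \<inter> ?C K))"
    using card_set_mult_times_Int[OF H K fin] card_set_mult_times_Int[OF CH CK fin] by simp
  also have "\<dots> \<le> (card ?J * card (H \<inter> K)) * (card (?C (H \<inter> K)) * card (?C ?J))"
    using a b c by (intro mult_mono) auto
  also have "\<dots> = cd_measure G ?J * cd_measure G (H \<inter> K)" by (simp add: cd_measure_def)
  finally show ?thesis .
qed

text \<open>The measures of join and meet are each at most the maximum, while their product is at
  least its square.\<close>

lemma CD_join_meet:
  assumes fin: "finite (carrier G)" and H: "H \<in> carrier (CD G)" and K: "K \<in> carrier (CD G)"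
  shows "generate G (H \<union> K) \<in> carrier (CD G)" "H \<inter> K \<in> carrier (CD G)"
proof -
  have sg: "subgroup H G" "subgroup K G" and m: "cd_measure G H = cd_max G" "cd_measure G K = cd_max G"
    using H K by (auto simp: carrier_CD)
  have J: "subgroup (generate G (H \<union> K)) G" using sg subgroup.subset by (intro generate_is_subgroup) auto
  have I: "subgroup (H \<inter> K) G" using sg subgroup_Int by auto
  have pos: "cd_max G > 0" using m cd_measure_pos[OF fin sg(1)] by simp
  have le: "cd_measure G (generate G (H \<union> K)) \<le> cd_max G" "cd_measure G (H \<inter> K) \<le> cd_max G"
    using J I fin cd_measure_le_max by auto
  have ge: "cd_max G * cd_max G \<le> cd_measure G (generate G (H \<union> K)) * cd_measure G (H \<inter> K)"
    using cd_measure_join_meet[OF fin sg] m by simp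
  have *: "x = c \<and> y = c" if "c * c \<le> x * y" "x \<le> c" "y \<le> c" "c > 0" for x y c :: nat
  proof -
    have "c * c \<le> x * c" "c * c \<le> c * y"
      using that mult_le_mono[of x x y c] mult_le_mono[of x c y y] by linarith+
    then show ?thesis using that by auto
  qed
  show "generate G (H \<union> K) \<in> carrier (CD G)" "H \<inter> K \<in> carrier (CD G)"
    using *[OF ge le pos] J I by (auto simp: carrier_CD)
qed

end

lemma partial_order_subset: "partial_order \<lparr>carrier = S, eq = (=), le = (\<subseteq>)\<rparr>"
  by unfold_locales auto

lemma (in group) lattice_CD:
  assumes fin: "finite (carrier G)" shows "lattice (CD G)"
proof -
  have po: "partial_order (CD G)" unfolding CD_def by (rule partial_order_subset)
  interpret partial_order "CD G" by fact
  show ?thesis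
  proof unfold_locales
    fix x y assume xy: "x \<in> carrier (CD G)" "y \<in> carrier (CD G)"
    let ?J = "generate G (x \<union> y)"
    have "?J \<subseteq> z" if "z \<in> carrier (CD G)" "x \<subseteq> z" "y \<subseteq> z" for z
      using that generate_subgroup_incl[of "x \<union> y" z] by (auto simp: carrier_CD)
    moreover have "x \<subseteq> ?J" "y \<subseteq> ?J" using generate.incl[of _ "x \<union> y" G] by auto
    ultimately have "least (CD G) ?J (Upper (CD G) {x, y})"
      using CD_join_meet[OF fin xy] xy unfolding least_def Upper_def by (auto simp: CD_def)
    then show "\<exists>s. least (CD G) s (Upper (CD G) {x, y})" by blast
    have "greatest (CD G) (x \<inter> y) (Lower (CD G) {x, y})"
      using CD_join_meet[OF fin xy] xy unfolding greatest_def Lower_def by (auto simp: CD_def)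
    then show "\<exists>s. greatest (CD G) s (Lower (CD G) {x, y})" by blast
  qed
qed

lemma lattice_cube: "lattice (cube m)"
proof -
  interpret partial_order "cube m" unfolding cube_def by (rule partial_order_subset)
  show ?thesis
  proof unfold_locales
    fix x y assume xy: "x \<in> carrier (cube m)" "y \<in> carrier (cube m)"
    then have "least (cube m) (x \<union> y) (Upper (cube m) {x, y})"
      unfolding least_def Upper_def by (auto simp: cube_def)
    then show "\<exists>s. least (cube m) s (Upper (cube m) {x, y})" by blast
    have "greatest (cube m) (x \<inter> y) (Lower (cube m) {x, y})"
      using xy unfolding greatest_def Lower_def by (auto simp: cube_def)
    then show "\<exists>s. greatest (cube m) s (Lower (cube m) {x, y})" by blast
  qed
qed

section \<open>Order isomorphisms and lattice isomorphisms\<close>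

definition order_iso :: "'a gorder \<Rightarrow> 'b gorder \<Rightarrow> ('a \<Rightarrow> 'b) \<Rightarrow> bool" where
  "order_iso L M f \<longleftrightarrow> bij_betw f (carrier L) (carrier M) \<and>
     (\<forall>x\<in>carrier L. \<forall>y\<in>carrier L. x \<sqsubseteq>\<^bsub>L\<^esub> y \<longleftrightarrow> f x \<sqsubseteq>\<^bsub>M\<^esub> f y)"

lemma order_iso_inv:
  assumes "order_iso L M f" shows "order_iso M L (inv_into (carrier L) f)"
proof -
  have bij: "bij_betw f (carrier L) (carrier M)" using assms by (simp add: order_iso_def)
  have im: "f ` carrier L = carrier M" using bij by (simp add: bij_betw_def)
  have "inv_into (carrier L) f x \<in> carrier L \<and> f (inv_into (carrier L) f x) = x" if "x \<in> carrier M" for x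
    using that im inv_into_into[of x f "carrier L"] f_inv_into_f[of x f "carrier L"] by simp
  then show ?thesis using assms bij_betw_inv_into[OF bij] unfolding order_iso_def by metis
qed

lemma order_iso_trans:
  assumes "order_iso K L f" "order_iso L M g" shows "order_iso K M (g \<circ> f)"
proof -
  have "bij_betw (g \<circ> f) (carrier K) (carrier M)"
    using assms bij_betw_trans unfolding order_iso_def by blast
  moreover have "f x \<in> carrier L" if "x \<in> carrier K" for x
    using that assms(1) unfolding order_iso_def bij_betw_def by auto
  ultimately show ?thesis using assms unfolding order_iso_def by simp
qed

lemma order_iso_least:
  assumes f: "order_iso L M f" and A: "A \<subseteq> carrier L" and l: "least L x (Upper L A)"
  shows "least M (f x) (Upper M (f ` A))"
proof -
  have bij: "f ` carrier L = carrier M" and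
    le: "\<And>x y. x \<in> carrier L \<Longrightarrow> y \<in> carrier L \<Longrightarrow> x \<sqsubseteq>\<^bsub>L\<^esub> y \<longleftrightarrow> f x \<sqsubseteq>\<^bsub>M\<^esub> f y"
    using f by (auto simp: order_iso_def bij_betw_def)
  have x: "x \<in> carrier L" and up: "\<And>a. a \<in> A \<Longrightarrow> a \<sqsubseteq>\<^bsub>L\<^esub> x"
    and lst: "\<And>y. y \<in> carrier L \<Longrightarrow> (\<And>a. a \<in> A \<Longrightarrow> a \<sqsubseteq>\<^bsub>L\<^esub> y) \<Longrightarrow> x \<sqsubseteq>\<^bsub>L\<^esub> y"
    using l A unfolding least_def Upper_def by auto
  have "f x \<sqsubseteq>\<^bsub>M\<^esub> z" if z: "z \<in> Upper M (f ` A)" for z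
  proof -
    have "z \<in> carrier M" using z by (simp add: Upper_def)
    then obtain y where y: "y \<in> carrier L" "z = f y" using bij by auto
    have "a \<sqsubseteq>\<^bsub>L\<^esub> y" if "a \<in> A" for a
    proof -
      have "f a \<in> carrier M" using that A bij by auto
      then have "f a \<sqsubseteq>\<^bsub>M\<^esub> f y" using that z y by (simp add: Upper_def)
      then show ?thesis using that A y le by auto
    qed
    then show ?thesis using lst y x le by auto
  qed
  moreover have "f x \<in> Upper M (f ` A)" using x up A le bij by (auto simp: Upper_def)
  moreover have "Upper M (f ` A) \<subseteq> carrier M" by (auto simp: Upper_def)
  ultimately show ?thesis unfolding least_def by auto
qed

lemma order_iso_greatest:
  assumes f: "order_iso L M f" and A: "A \<subseteq> carrier L" and l: "greatest L x (Lower L A)"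
  shows "greatest M (f x) (Lower M (f ` A))"
proof -
  have "order_iso (inv_gorder L) (inv_gorder M) f" using f by (auto simp: order_iso_def)
  from order_iso_least[OF this, of A x] A l show ?thesis by simp
qed

text \<open>Order isomorphisms are easy to compose and invert, so preservation of joins and meets is
  recovered only here. Being a lattice is assumed of the source and transported to the target;
  \<open>eq M = (=)\<close> is asked for because a \<open>gorder\<close> carries its own
  equality.\<close>

lemma order_iso_lattice_isomorphic:
  assumes f: "order_iso L M f" and L: "lattice L" and eq: "eq M = (=)"
  shows "lattice_isomorphic L M"
proof -
  interpret L: lattice L by fact
  have bij: "f ` carrier L = carrier M" and inj: "inj_on f (carrier L)" and
    le: "\<And>x y. x \<in> carrier L \<Longrightarrow> y \<in> carrier L \<Longrightarrow> x \<sqsubseteq>\<^bsub>L\<^esub> y \<longleftrightarrow> f x \<sqsubseteq>\<^bsub>M\<^esub> f y"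
    using f by (auto simp: order_iso_def bij_betw_def)
  have M: "partial_order M"
  proof
    show "(.=\<^bsub>M\<^esub>) = (=)" by fact
    show "x \<sqsubseteq>\<^bsub>M\<^esub> x" if "x \<in> carrier M" for x
      using that le L.le_refl by (metis bij imageE)
    fix x y z assume "x \<in> carrier M" "y \<in> carrier M"
    then obtain a b where ab: "a \<in> carrier L" "b \<in> carrier L" "x = f a" "y = f b" by (metis bij imageE)
    show "x \<sqsubseteq>\<^bsub>M\<^esub> y \<Longrightarrow> y \<sqsubseteq>\<^bsub>M\<^esub> x \<Longrightarrow> x .=\<^bsub>M\<^esub> y"
      using ab le eq L.le_antisym by metis
    assume "z \<in> carrier M"
    then obtain c where c: "c \<in> carrier L" "z = f c" by (metis bij imageE)
    show "x \<sqsubseteq>\<^bsub>M\<^esub> y \<Longrightarrow> y \<sqsubseteq>\<^bsub>M\<^esub> z \<Longrightarrow> x \<sqsubseteq>\<^bsub>M\<^esub> z" using ab c le L.le_trans by metis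
  qed (simp_all add: eq)
  interpret M: partial_order M by fact
  have lub: "least M (f (x \<squnion>\<^bsub>L\<^esub> y)) (Upper M {f x, f y})" if "x \<in> carrier L" "y \<in> carrier L" for x y
    using order_iso_least[OF f _ L.sup_of_two_least[OF that]] that by (simp add: join_def)
  have glb: "greatest M (f (x \<sqinter>\<^bsub>L\<^esub> y)) (Lower M {f x, f y})" if "x \<in> carrier L" "y \<in> carrier L" for x y
    using order_iso_greatest[OF f _ L.inf_of_two_greatest[OF that]] that by (simp add: meet_def)
  have "lattice M"
  proof
    fix x y assume "x \<in> carrier M" "y \<in> carrier M"
    then obtain a b where ab: "a \<in> carrier L" "b \<in> carrier L" "x = f a" "y = f b" by (metis bij imageE)
    show "\<exists>s. least M s (Upper M {x, y})" using lub ab by blast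
    show "\<exists>s. greatest M s (Lower M {x, y})" using glb ab by blast
  qed
  then interpret M: lattice M .
  have "f (x \<squnion>\<^bsub>L\<^esub> y) = f x \<squnion>\<^bsub>M\<^esub> f y" "f (x \<sqinter>\<^bsub>L\<^esub> y) = f x \<sqinter>\<^bsub>M\<^esub> f y"
    if xy: "x \<in> carrier L" "y \<in> carrier L" for x y
  proof -
    have fxy: "f x \<in> carrier M" "f y \<in> carrier M" using xy bij by auto
    show "f (x \<squnion>\<^bsub>L\<^esub> y) = f x \<squnion>\<^bsub>M\<^esub> f y"
      using M.least_unique[OF lub[OF xy]] M.sup_of_two_least[OF fxy] by (simp add: join_def)
    show "f (x \<sqinter>\<^bsub>L\<^esub> y) = f x \<sqinter>\<^bsub>M\<^esub> f y"
      using M.greatest_unique[OF glb[OF xy]] M.inf_of_two_greatest[OF fxy] by (simp add: meet_def)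
  qed
  then show ?thesis
    using f L \<open>lattice M\<close> unfolding lattice_isomorphic_def join_pres_def meet_pres_def order_iso_def
    by blast
qed

section \<open>Isomorphic copies and direct products\<close>

text \<open>Let \<open>D\<close> be the centralizer of \<open>H\<close>. The product formula turns
  m(H) |A|^2 into (|AH| |D \<inter> A|) (|AD| |H \<inter> A|). As \<open>A\<close> is abelian,
  \<open>D \<inter> A\<close> centralizes AH and \<open>H \<inter> A\<close> centralizes AD, so
  \<open>less\<close> bounds each factor by |A|^2, with equality only for AH = A and AD = A. Then
  \<open>H\<close> and \<open>D\<close> lie in \<open>A\<close>, and |H| |D| = |A|^2 forces
  \<open>H = A\<close>.\<close>

lemma (in group) CD_eq_singletonI:
  assumes fin: "finite (carrier G)" and A: "A \<lhd> G" and ab: "A \<subseteq> centralizer G A"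
    and less: "\<And>K. subgroup K G \<Longrightarrow> A \<subset> K \<Longrightarrow> card K * card (A \<inter> centralizer G K) < card A * card A"
  shows "carrier (CD G) = {A}"
proof -
  let ?C = "centralizer G"
  have sA: "subgroup A G" using A normal_imp_subgroup by auto
  have Asub: "A \<subseteq> carrier G" using sA subgroup.subset by auto
  have finA: "finite A" using Asub fin finite_subset by auto
  have sAK: "subgroup (A <#> K) G" "A \<subseteq> A <#> K" "K \<subseteq> A <#> K" if K: "subgroup K G" for K
  proof -
    show "subgroup (A <#> K) G" using K A by (rule mult_norm_subgroup[rotated])
    have "x \<in> A <#> K" if "x \<in> A" for x
    proof -
      have "x \<otimes> \<one> \<in> A <#> K" using that subgroup.one_closed[OF K] by (auto simp only: set_mult_def)
      then show ?thesis using that Asub by auto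
    qed
    moreover have "x \<in> A <#> K" if "x \<in> K" for x
    proof -
      have "\<one> \<otimes> x \<in> A <#> K" using that subgroup.one_closed[OF sA] by (auto simp only: set_mult_def)
      then show ?thesis using that subgroup.mem_carrier[OF K] by auto
    qed
    ultimately show "A \<subseteq> A <#> K" "K \<subseteq> A <#> K" by auto
  qed
  \<comment> \<open>\<open>D\<close> is any subset of the centralizer, so that the bound applies to
    \<open>H\<close> with its centralizer and, with the roles exchanged, to the centralizer with
    \<open>H\<close>.\<close>
  have bound: "card (A <#> H) * card (D \<inter> A) \<le> card A * card A"
       "card (A <#> H) * card (D \<inter> A) = card A * card A \<Longrightarrow> A <#> H = A"
    if H: "subgroup H G" and D: "D \<subseteq> ?C H" for H D
  proof -
    have sH: "H \<subseteq> carrier G" using H subgroup.subset by auto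
    have "D \<inter> A \<subseteq> A \<inter> ?C (A <#> H)"
    proof
      fix x assume x: "x \<in> D \<inter> A"
      have "A \<subseteq> ?C {x}" "H \<subseteq> ?C {x}"
        using x Asub D ab sH by (auto simp: centralizer_def)
      then have "A <#> H \<subseteq> ?C {x}"
        using subgroup.m_closed[OF subgroup_centralizer[of "{x}"]] x Asub
        unfolding set_mult_def by blast
      then show "x \<in> A \<inter> ?C (A <#> H)" using x Asub by (auto simp: centralizer_def)
    qed
    then have le: "card (D \<inter> A) \<le> card (A \<inter> ?C (A <#> H))" using finA by (intro card_mono) auto
    show "card (A <#> H) * card (D \<inter> A) \<le> card A * card A"
         "card (A <#> H) * card (D \<inter> A) = card A * card A \<Longrightarrow> A <#> H = A"
    proof (atomize (full), cases "A <#> H = A")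
      case True
      then show "card (A <#> H) * card (D \<inter> A) \<le> card A * card A \<and>
        (card (A <#> H) * card (D \<inter> A) = card A * card A \<longrightarrow> A <#> H = A)"
        using finA by (auto intro!: card_mono)
    next
      case False
      then have "A \<subset> A <#> H" using sAK[OF H] by auto
      from less[OF sAK(1)[OF H] this] mult_le_mono2[OF le, of "card (A <#> H)"]
      show "card (A <#> H) * card (D \<inter> A) \<le> card A * card A \<and>
        (card (A <#> H) * card (D \<inter> A) = card A * card A \<longrightarrow> A <#> H = A)" by linarith
    qed
  qed
  have pos: "card A > 0" using finA subgroup.one_closed[OF sA] by (auto simp: card_gt_0_iff)
  have main: "cd_measure G H \<le> card A * card A \<and> (cd_measure G H = card A * card A \<longrightarrow> H = A)"
    if H: "subgroup H G" for H
  proof -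
    let ?D = "?C H"
    have sH: "H \<subseteq> carrier G" using H subgroup.subset by auto
    have D: "subgroup ?D G" using subgroup_centralizer[OF sH] .
    let ?x = "card (A <#> H) * card (?D \<inter> A)" and ?y = "card (A <#> ?D) * card (H \<inter> A)"
      and ?a = "card A * card A"
    have x: "?x \<le> ?a" "?x = ?a \<Longrightarrow> A <#> H = A" using bound[OF H] by auto
    have y: "?y \<le> ?a" "?y = ?a \<Longrightarrow> A <#> ?D = A" using bound[OF D subset_double_centralizer[OF sH]] by auto
    have "cd_measure G H * ?a = (card A * card H) * (card A * card ?D)"
      by (simp add: cd_measure_def)
    also have "\<dots> = ?x * ?y"
      using card_set_mult_times_Int[OF sA H fin] card_set_mult_times_Int[OF sA D fin]
      by (simp add: Int_commute ac_simps)
    finally have eq: "cd_measure G H * ?a = ?x * ?y" .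
    also have "\<dots> \<le> ?a * ?a" using mult_le_mono[OF x(1) y(1)] .
    finally have le: "cd_measure G H \<le> ?a" using pos by simp
    moreover have "H = A" if "cd_measure G H = ?a"
    proof -
      have "?x * ?y = ?a * ?a" using eq that by simp
      moreover have "?x * ?y \<le> ?x * ?a" "?x * ?y \<le> ?a * ?y"
        using mult_le_mono2[OF y(1), of ?x] mult_le_mono1[OF x(1), of ?y] .
      ultimately have "?a * ?a \<le> ?x * ?a" "?a * ?a \<le> ?a * ?y" by linarith+
      then have "?a \<le> ?x" "?a \<le> ?y" using pos by simp_all
      then have "A <#> H = A" "A <#> ?D = A" using x y by simp_all
      then have sub: "H \<subseteq> A" "?D \<subseteq> A" using sAK(3)[OF H] sAK(3)[OF D] by auto
      have "card H \<le> card A" "card ?D \<le> card A" using sub finA card_mono by auto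
      moreover have "card H * card ?D = ?a" using that by (simp add: cd_measure_def)
      ultimately have "card H = card A"
        using pos mult_le_mono2[of "card ?D" "card A" "card H"] by (intro le_antisym) auto
      then show ?thesis using sub(1) finA card_subset_eq by blast
    qed
    ultimately show ?thesis by blast
  qed
  have "card A \<le> card (?C A)" using ab fin by (intro card_mono) (auto simp: centralizer_def)
  then have "cd_measure G A = card A * card A"
    using main[OF sA] unfolding cd_measure_def by (metis le_antisym mult_le_mono2)
  moreover from this have "cd_max G = card A * card A" using cd_max_eqI[OF fin _ sA] main by blast
  ultimately show ?thesis using sA main by (auto simp: carrier_CD)
qed

lemma centralizer_iso:
  assumes "group G" "group P" and h: "h \<in> iso G P" and H: "H \<subseteq> carrier G"
  shows "centralizer P (h ` H) = h ` centralizer G H"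
proof -
  interpret G: group G by fact
  have bij: "bij_betw h (carrier G) (carrier P)" using h by (simp add: iso_def)
  then have im: "h ` carrier G = carrier P" and inj: "inj_on h (carrier G)" by (auto simp: bij_betw_def)
  have hm: "h (x \<otimes>\<^bsub>G\<^esub> y) = h x \<otimes>\<^bsub>P\<^esub> h y" if "x \<in> carrier G" "y \<in> carrier G" for x y
    using h that by (simp add: iso_def hom_def)
  have "h x \<otimes>\<^bsub>P\<^esub> h y = h y \<otimes>\<^bsub>P\<^esub> h x \<longleftrightarrow> x \<otimes>\<^bsub>G\<^esub> y = y \<otimes>\<^bsub>G\<^esub> x"
    if "x \<in> carrier G" "y \<in> carrier G" for x y
    using that hm inj_on_eq_iff[OF inj] by (metis G.m_closed)
  then have "(\<forall>k\<in>h ` H. h g \<otimes>\<^bsub>P\<^esub> k = k \<otimes>\<^bsub>P\<^esub> h g) \<longleftrightarrow> (\<forall>k\<in>H. g \<otimes>\<^bsub>G\<^esub> k = k \<otimes>\<^bsub>G\<^esub> g)" if "g \<in> carrier G" for g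
    using H that by (auto simp: subset_iff)
  then have "{g \<in> carrier G. \<forall>k\<in>h ` H. h g \<otimes>\<^bsub>P\<^esub> k = k \<otimes>\<^bsub>P\<^esub> h g} = centralizer G H"
    unfolding centralizer_def by blast
  moreover have "centralizer P (h ` H) = h ` {g \<in> carrier G. \<forall>k\<in>h ` H. h g \<otimes>\<^bsub>P\<^esub> k = k \<otimes>\<^bsub>P\<^esub> h g}"
    unfolding centralizer_def im[symmetric] by blast
  ultimately show ?thesis by simp
qed

lemma order_iso_CD_iso:
  assumes G: "group G" and P: "group P" and h: "h \<in> iso G P" and fin: "finite (carrier G)"
  shows "order_iso (CD G) (CD P) (image h)"
proof -
  interpret G: group G by fact
  interpret P: group P by fact
  have bij: "bij_betw h (carrier G) (carrier P)" using h by (simp add: iso_def)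
  then have im: "h ` carrier G = carrier P" and inj: "inj_on h (carrier G)" by (auto simp: bij_betw_def)
  interpret hh: group_hom G P h using h by unfold_locales (simp add: iso_def)
  let ?g = "inv_into (carrier G) h"
  have g: "?g \<in> iso P G" using G.iso_set_sym[OF h] .
  interpret gg: group_hom P G ?g using g by unfold_locales (simp add: iso_def)
  have sub: "subgroup (h ` H) P" if "subgroup H G" for H using that hh.subgroup_img_is_subgroup by auto
  have sur: "\<exists>H. subgroup H G \<and> K = h ` H" if K: "subgroup K P" for K
  proof (intro exI conjI)
    show "subgroup (?g ` K) G" using K gg.subgroup_img_is_subgroup by auto
    show "K = h ` ?g ` K"
      using subgroup.subset[OF K] im by (force simp: image_image f_inv_into_f)
  qed
  have meas: "cd_measure P (h ` H) = cd_measure G H" if H: "subgroup H G" for H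
  proof -
    have Hs: "H \<subseteq> carrier G" using H subgroup.subset by auto
    then have "inj_on h H" "inj_on h (centralizer G H)"
      using inj by (auto simp: centralizer_def intro: inj_on_subset)
    then show ?thesis
      by (simp add: cd_measure_def centralizer_iso[OF G P h Hs] card_image)
  qed
  have finP: "finite (carrier P)" using fin im by (metis finite_imageI)
  obtain H0 where H0: "subgroup H0 G" "cd_measure G H0 = cd_max G" using G.cd_max_attained[OF fin] .
  have max: "cd_max P = cd_max G"
  proof (rule P.cd_max_eqI[OF finP])
    show "subgroup (h ` H0) P" using sub H0 by auto
    show "cd_measure P (h ` H0) = cd_max G" using meas H0 by auto
    fix K assume "subgroup K P"
    then show "cd_measure P K \<le> cd_max G" using sur meas G.cd_measure_le_max[OF fin] by metis
  qed
  have car: "carrier (CD P) = image h ` carrier (CD G)"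
  proof (intro equalityI subsetI)
    fix K assume K: "K \<in> carrier (CD P)"
    then obtain H where H: "subgroup H G" "K = h ` H" using sur unfolding P.carrier_CD by blast
    then have "H \<in> carrier (CD G)" using K meas max by (simp add: G.carrier_CD P.carrier_CD)
    then show "K \<in> image h ` carrier (CD G)" using H by blast
  qed (auto simp: G.carrier_CD P.carrier_CD sub meas max)
  have subs: "H \<subseteq> carrier G" if "H \<in> carrier (CD G)" for H
    using that by (auto simp: G.carrier_CD dest: subgroup.subset)
  have "inj_on (image h) (carrier (CD G))"
    using subs inj by (meson inj_onI inj_on_image_eq_iff)
  moreover have "h ` H \<subseteq> h ` K \<longleftrightarrow> H \<subseteq> K" if "H \<subseteq> carrier G" "K \<subseteq> carrier G" for H K
    using that inj by (metis image_mono inv_into_image_cancel)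
  ultimately show ?thesis
    unfolding order_iso_def bij_betw_def using car subs by (simp add: CD_def)
qed

text \<open>The final statement asks for a group whose elements are natural numbers; a finite
  carrier is moved there along an injection.\<close>

lemma ex_iso_nat_monoid:
  assumes G: "group G" and fin: "finite (carrier G)"
  obtains P :: "nat monoid" and h where "group P" "h \<in> iso G P"
proof -
  interpret G: group G by fact
  obtain h :: "'a \<Rightarrow> nat" where inj: "inj_on h (carrier G)" using finite_imp_inj_to_nat_seg[OF fin] by metis
  let ?g = "inv_into (carrier G) h"
  define P :: "nat monoid" where
    "P = \<lparr>carrier = h ` carrier G, monoid.mult = (\<lambda>x y. h (?g x \<otimes>\<^bsub>G\<^esub> ?g y)), one = h \<one>\<^bsub>G\<^esub>\<rparr>"
  have g: "?g (h x) = x" if "x \<in> carrier G" for x using that inj by simp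
  have P: "group P"
  proof (rule groupI)
    show "\<exists>y\<in>carrier P. y \<otimes>\<^bsub>P\<^esub> x = \<one>\<^bsub>P\<^esub>" if x: "x \<in> carrier P" for x
    proof -
      obtain a where a: "a \<in> carrier G" "x = h a" using x by (auto simp: P_def)
      then have "h (inv\<^bsub>G\<^esub> a) \<otimes>\<^bsub>P\<^esub> x = \<one>\<^bsub>P\<^esub>" "h (inv\<^bsub>G\<^esub> a) \<in> carrier P" by (auto simp: P_def g)
      then show ?thesis by blast
    qed
  qed (auto simp: P_def g G.m_assoc)
  moreover have "h \<in> iso G P"
    using inj by (auto simp: iso_def hom_def bij_betw_def P_def g)
  ultimately show ?thesis using that by blast
qed

text \<open>The centralizer of \<open>H\<close> in the product depends only on the projections K and
  B of \<open>H\<close>, so m(H) is at most m(K) m(B), with equality only if \<open>H\<close> is all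
  of K \<times> B. Hence subgroups of maximal measure are products of such subgroups, and the second
  factor can only be \<open>A\<close>.\<close>

lemma order_iso_CD_DirProd:
  fixes T :: "('a, 'b) monoid_scheme" and Q :: "('c, 'd) monoid_scheme"
  assumes T: "group T" "finite (carrier T)" and Q: "group Q" "finite (carrier Q)"
    and A: "carrier (CD Q) = {A}"
  shows "order_iso (CD T) (CD (T \<times>\<times> Q)) (\<lambda>H. H \<times> A)"
proof -
  interpret T: group T by fact
  interpret Q: group Q by fact
  interpret G: group "T \<times>\<times> Q" using DirProd_group[OF T(1) Q(1)] .
  have fin: "finite (carrier (T \<times>\<times> Q))" using T Q by simp
  have A1: "subgroup A Q" "cd_measure Q A = cd_max Q" and A2: "\<And>B. subgroup B Q \<Longrightarrow> cd_measure Q B = cd_max Q \<Longrightarrow> B = A"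
    using A by (auto simp: Q.carrier_CD)
  have hfst: "group_hom (T \<times>\<times> Q) T fst" and hsnd: "group_hom (T \<times>\<times> Q) Q snd"
    by unfold_locales (auto simp: hom_def)
  have cent: "centralizer (T \<times>\<times> Q) H = centralizer T (fst ` H) \<times> centralizer Q (snd ` H)" for H
    unfolding centralizer_def by (auto simp: mult_DirProd')
  have posT: "cd_measure T K > 0" if "subgroup K T" for K using that T.cd_measure_pos[OF T(2)] by auto
  have posQ: "cd_measure Q K > 0" if "subgroup K Q" for K using that Q.cd_measure_pos[OF Q(2)] by auto
  have main: "cd_measure (T \<times>\<times> Q) H \<le> cd_max T * cd_max Q \<and>
      (cd_measure (T \<times>\<times> Q) H = cd_max T * cd_max Q \<longrightarrow>
        (\<exists>K\<in>carrier (CD T). H = K \<times> A))" if H: "subgroup H (T \<times>\<times> Q)" for H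
  proof -
    let ?K = "fst ` H" and ?B = "snd ` H"
    have K: "subgroup ?K T" and B: "subgroup ?B Q"
      using H group_hom.subgroup_img_is_subgroup[OF hfst] group_hom.subgroup_img_is_subgroup[OF hsnd] by auto
    have fins: "finite ?K" "finite ?B"
      using K B T Q by (meson finite_subset subgroup.subset)+
    have sub: "H \<subseteq> ?K \<times> ?B" by force
    have cH: "card H \<le> card ?K * card ?B"
      using card_mono[OF _ sub] fins by (simp add: card_cartesian_product)
    have m: "cd_measure (T \<times>\<times> Q) H = card H * (card (centralizer T ?K) * card (centralizer Q ?B))"
      by (simp add: cd_measure_def cent card_cartesian_product)
    have m1: "cd_measure (T \<times>\<times> Q) H \<le> cd_measure T ?K * cd_measure Q ?B"
      unfolding m using mult_le_mono1[OF cH, of "card (centralizer T ?K) * card (centralizer Q ?B)"]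
      by (simp add: cd_measure_def ac_simps)
    have lT: "cd_measure T ?K \<le> cd_max T" and lQ: "cd_measure Q ?B \<le> cd_max Q"
      using T.cd_measure_le_max[OF T(2) K] Q.cd_measure_le_max[OF Q(2) B] by auto
    have le: "cd_measure T ?K * cd_measure Q ?B \<le> cd_max T * cd_max Q" using lT lQ by (rule mult_le_mono)
    moreover have "\<exists>K\<in>carrier (CD T). H = K \<times> A" if e: "cd_measure (T \<times>\<times> Q) H = cd_max T * cd_max Q"
    proof -
      have e2: "cd_measure T ?K * cd_measure Q ?B = cd_max T * cd_max Q" using e m1 le by simp
      have "cd_max T > 0" "cd_max Q > 0" using lT lQ posT[OF K] posQ[OF B] by auto
      have "cd_max T * cd_max Q \<le> cd_max T * cd_measure Q ?B" "cd_max T * cd_max Q \<le> cd_measure T ?K * cd_max Q"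
        using e2 mult_le_mono1[OF lT, of "cd_measure Q ?B"] mult_le_mono2[OF lQ, of "cd_measure T ?K"] by auto
      then have "cd_measure T ?K = cd_max T" "cd_measure Q ?B = cd_max Q"
        using \<open>cd_max T > 0\<close> \<open>cd_max Q > 0\<close> lT lQ by (auto intro: le_antisym)
      then have KB: "?K \<in> carrier (CD T)" "?B = A" using K B A2 by (auto simp: T.carrier_CD)
      have "card H * (card (centralizer T ?K) * card (centralizer Q ?B))
          = (card ?K * card ?B) * (card (centralizer T ?K) * card (centralizer Q ?B))"
      proof -
        have "card H * (card (centralizer T ?K) * card (centralizer Q ?B)) = cd_measure T ?K * cd_measure Q ?B"
          using e e2 m by linarith
        then show ?thesis unfolding cd_measure_def by (simp only: ac_simps)
      qed
      moreover have "card (centralizer T ?K) * card (centralizer Q ?B) > 0"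
        using posT[OF K] posQ[OF B] by (simp add: cd_measure_def)
      ultimately have "card H = card (?K \<times> ?B)"
        unfolding card_cartesian_product by (metis less_irrefl mult_right_cancel)
      then have "H = ?K \<times> ?B" using sub fins by (intro card_subset_eq) auto
      then show ?thesis using KB by blast
    qed
    ultimately show ?thesis using m1 by auto
  qed
  have prod: "subgroup (K \<times> A) (T \<times>\<times> Q) \<and> cd_measure (T \<times>\<times> Q) (K \<times> A) = cd_max T * cd_max Q"
    if K: "K \<in> carrier (CD T)" for K
  proof -
    have K': "subgroup K T" "cd_measure T K = cd_max T" using K by (auto simp: T.carrier_CD)
    have "K \<noteq> {}" "A \<noteq> {}" using K' A1 subgroup.one_closed by fastforce+
    then have "cd_measure (T \<times>\<times> Q) (K \<times> A) = cd_measure T K * cd_measure Q A"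
      by (simp add: cd_measure_def cent card_cartesian_product ac_simps)
    then show ?thesis using DirProd_subgroups[OF T(1) K'(1) Q(1) A1(1)] K' A1 by simp
  qed
  obtain K0 where K0: "K0 \<in> carrier (CD T)" using T.cd_max_attained[OF T(2)] by (auto simp: T.carrier_CD)
  have max: "cd_max (T \<times>\<times> Q) = cd_max T * cd_max Q"
    using G.cd_max_eqI[OF fin] main prod[OF K0] by blast
  have car: "carrier (CD (T \<times>\<times> Q)) = (\<lambda>H. H \<times> A) ` carrier (CD T)"
    unfolding G.carrier_CD using main prod max by auto
  have "A \<noteq> {}" using A1 subgroup.one_closed by fastforce
  then have "inj_on (\<lambda>H. H \<times> A) (carrier (CD T))" and "\<And>H K :: 'a set. H \<times> A \<subseteq> K \<times> A \<longleftrightarrow> H \<subseteq> K"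
    by (auto intro!: inj_onI)
  then show ?thesis unfolding order_iso_def bij_betw_def using car by (simp add: CD_def)
qed

section \<open>The Frattini subgroup of a \<open>p\<close>-group\<close>

text \<open>Orbit lengths are powers of \<open>p\<close>, so every orbit with more than one point
  has length divisible by \<open>p\<close>. If \<open>x\<close> were the only fixed point,
  \<open>card E\<close> would be 1 modulo \<open>p\<close>.\<close>

lemma (in group_action) p_group_other_fixed_point:
  assumes "prime p" "order G = p ^ k" "finite E" "p dvd card E" "x \<in> E"
    and fix_x: "\<And>g. g \<in> carrier G \<Longrightarrow> \<phi> g x = x"
  obtains y where "y \<in> E" "y \<noteq> x" "\<And>g. g \<in> carrier G \<Longrightarrow> \<phi> g y = y"
proof (rule ccontr)
  assume no: "\<not> thesis"
  note witness = that
  have one: "\<one> \<in> carrier G" using group_hom group_hom.axioms(1) group.is_monoid monoid.one_closed by blast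
  let ?O = "orbits G E \<phi>"
  have sub: "A \<subseteq> E" "A \<noteq> {}" if "A \<in> ?O" for A
    using that orbits_coverture orbit_refl by (auto simp: orbits_def)
  have finO: "finite ?O" using assms(3) by (simp add: orbits_def)
  have cov: "\<Union> ?O = E" by (rule orbits_coverture)
  have ox: "orbit G \<phi> x = {x}" unfolding orbit_def using fix_x[OF one] by (auto simp: fix_x) (metis one)
  then have xO: "{x} \<in> ?O" using assms(5) by (auto simp: orbits_def)
  have "p dvd card A" if A: "A \<in> ?O - {{x}}" for A
  proof -
    obtain y where y: "y \<in> E" "A = orbit G \<phi> y" using A by (auto simp: orbits_def)
    have "card A dvd p ^ k" using orbit_stabilizer_theorem[OF y(1)] y(2) assms(2) by (metis dvd_triv_left)
    then obtain j where j: "card A = p ^ j" using assms(1) divides_primepow_nat by blast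
    have "j \<noteq> 0"
    proof
      assume "j = 0"
      then have "card A = 1" using j by simp
      moreover have "y \<in> A" using y orbit_refl by auto
      ultimately have "A = {y}" by (metis card_1_singletonE singletonD)
      then have "\<phi> g y = y" if "g \<in> carrier G" for g using y that by (auto simp: orbit_def)
      moreover have "y \<noteq> x" using A \<open>A = {y}\<close> by auto
      ultimately show False using no witness[of y] y by blast
    qed
    then show ?thesis using j by simp
  qed
  then have "p dvd (\<Sum>A\<in>?O - {{x}}. card A)" by (rule dvd_sum)
  moreover have "card E = (\<Sum>A\<in>?O. card A)"
    using disjoint_sum[OF assms(3), of "\<lambda>_. 1::nat"] by simp
  moreover have "(\<Sum>A\<in>?O. card A) = card {x} + (\<Sum>A\<in>?O - {{x}}. card A)"
    using sum.remove[OF finO xO, of card] by simp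
  ultimately have "p dvd card {x}" using assms(4) by (metis dvd_add_left_iff)
  then show False using assms(1) by simp
qed

context group
begin

text \<open>The inverse in \<open>C #> inv m\<close> turns right multiplication into a left action,
  as a homomorphism into \<open>BijGroup\<close> requires.\<close>

lemma coset_action:
  assumes M: "subgroup M G"
  shows "group_action (G\<lparr>carrier := M\<rparr>) (rcosets M) (\<lambda>m. \<lambda>C\<in>rcosets M. C #> inv m)"
proof -
  interpret M: subgroup M G by fact
  have cl: "C #> m \<in> rcosets M" if Cm: "C \<in> rcosets M" "m \<in> M" for C m
  proof -
    obtain g where "g \<in> carrier G" "C = M #> g" using Cm by (auto simp: RCOSETS_def)
    then show ?thesis using Cm M.subset by (auto simp: coset_mult_assoc intro: rcosetsI)
  qed
  have sub: "C \<subseteq> carrier G" if "C \<in> rcosets M" for C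
    using that rcosets_part_G[OF M] by auto
  have inv1: "C #> inv m #> m = C" "C #> m #> inv m = C" if "C \<in> rcosets M" "m \<in> M" for C m
    using that sub by (auto simp: coset_mult_assoc)
  have bij: "(\<lambda>C\<in>rcosets M. C #> inv m) \<in> Bij (rcosets M)" if m: "m \<in> M" for m
  proof -
    have "bij_betw (\<lambda>C. C #> inv m) (rcosets M) (rcosets M)"
      by (rule bij_betw_byWitness[where f' = "\<lambda>C. C #> m"]) (use inv1 cl m in auto)
    then show ?thesis by (auto simp: Bij_def cong: bij_betw_cong)
  qed
  have "(\<lambda>C\<in>rcosets M. C #> inv (m \<otimes> n)) =
      compose (rcosets M) (\<lambda>C\<in>rcosets M. C #> inv m) (\<lambda>C\<in>rcosets M. C #> inv n)"
    if "m \<in> M" "n \<in> M" for m n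
    using that cl sub by (auto simp: compose_def inv_mult_group coset_mult_assoc fun_eq_iff)
  then have "(\<lambda>m. \<lambda>C\<in>rcosets M. C #> inv m) \<in> hom (G\<lparr>carrier := M\<rparr>) (BijGroup (rcosets M))"
    using bij by (auto simp: hom_def BijGroup_def)
  then show ?thesis
    using M subgroup_imp_group group_BijGroup
    by (simp add: group_action_def group_hom_def group_hom_axioms_def)
qed

text \<open>Under right multiplication by \<open>M\<close> the coset \<open>M\<close> is fixed, and
  the number of cosets is divisible by \<open>p\<close>, so another coset \<open>M #> g\<close> is
  fixed too. Being fixed means that \<open>g\<close> conjugates \<open>M\<close> into
  itself.\<close>

lemma p_group_normalizer_grows:
  assumes "prime p" "order G = p ^ k" and M: "subgroup M G" and ne: "M \<noteq> carrier G"
  obtains g where "g \<in> carrier G" "g \<notin> M" "\<And>m. m \<in> M \<Longrightarrow> g \<otimes> m \<otimes> inv g \<in> M"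
proof -
  interpret M: subgroup M G by fact
  interpret A: group_action "G\<lparr>carrier := M\<rparr>" "rcosets M" "\<lambda>m. \<lambda>C\<in>rcosets M. C #> inv m"
    using coset_action[OF M] .
  have pos: "order G > 0" using assms by (simp add: prime_gt_0_nat)
  then have fin: "finite (carrier G)" using order_gt_0_iff_finite by blast
  have lag: "card (rcosets M) * card M = p ^ k" using lagrange[OF M] assms by simp
  then obtain j where j: "card M = p ^ j" using assms(1) divides_primepow_nat by (metis dvd_triv_right)
  obtain i where i: "card (rcosets M) = p ^ i" using assms(1) lag divides_primepow_nat by (metis dvd_triv_left)
  have "i \<noteq> 0"
  proof
    assume "i = 0"
    then have "card M = card (carrier G)" using lag i assms(2) by (simp add: order_def)
    then show False using ne fin M.subset card_subset_eq by blast
  qed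
  then have dvd: "p dvd card (rcosets M)" using i by simp
  have MM: "M \<in> rcosets M" using M subgroup.subgroup_in_rcosets is_group by blast
  have finR: "finite (rcosets M)" using fin finite_subset[OF rcosets_subset_PowG[OF M]] by simp
  have fixM: "(\<lambda>C\<in>rcosets M. C #> inv m) M = M" if "m \<in> carrier (G\<lparr>carrier := M\<rparr>)" for m
    using that MM coset_join2[of "inv m" M] M by auto
  obtain C where C: "C \<in> rcosets M" "C \<noteq> M"
    and fixC: "\<And>m. m \<in> carrier (G\<lparr>carrier := M\<rparr>) \<Longrightarrow> (\<lambda>C\<in>rcosets M. C #> inv m) C = C"
    using A.p_group_other_fixed_point[OF assms(1) _ finR dvd MM fixM] j by (auto simp: order_def)
  obtain g where g: "g \<in> carrier G" "C = M #> g" using C by (auto simp: RCOSETS_def)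
  have "g \<notin> M" using C g M coset_join2 by auto
  moreover have "g \<otimes> m \<otimes> inv g \<in> M" if m: "m \<in> M" for m
  proof -
    have "M #> (g \<otimes> m) = M #> g"
      using fixC[of "inv m"] m C g M.subset by (simp add: coset_mult_assoc)
    then have "g \<otimes> m \<in> M #> g" using rcos_self[of "g \<otimes> m" M] M m g by auto
    then obtain m' where m': "m' \<in> M" "g \<otimes> m = m' \<otimes> g" by (auto simp: r_coset_def)
    have "g \<otimes> m \<otimes> inv g = m'" using m' g M.mem_carrier by (simp add: m_assoc)
    then show ?thesis using m' by simp
  qed
  ultimately show ?thesis using that g by blast
qed

lemma maximal_subgroup_normal:
  assumes "prime p" "order G = p ^ k" and max: "maximal_subgroup M G"
  shows "M \<lhd> G"
proof -
  have M: "subgroup M G" and ne: "M \<noteq> carrier G"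
    and mx: "\<And>K. subgroup K G \<Longrightarrow> M \<subseteq> K \<Longrightarrow> K = M \<or> K = carrier G"
    using max by (auto simp: maximal_subgroup_def)
  interpret M: subgroup M G by fact
  have "order G > 0" using assms by (simp add: prime_gt_0_nat)
  then have fin: "finite M" using order_gt_0_iff_finite M.subset finite_subset by blast
  obtain g where g: "g \<in> carrier G" "g \<notin> M" "\<And>m. m \<in> M \<Longrightarrow> g \<otimes> m \<otimes> inv g \<in> M"
    using p_group_normalizer_grows[OF assms(1,2) M ne] by blast
  define L where "L = {x \<in> carrier G. \<forall>m\<in>M. x \<otimes> m \<otimes> inv x \<in> M}"
  \<comment> \<open>\<open>L\<close> demands only that conjugation maps \<open>M\<close> into
    itself. As \<open>M\<close> is finite, such a conjugation is onto, which gives closure of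
    \<open>L\<close> under inverses.\<close>
  have Linv: "inv x \<in> L" if x: "x \<in> L" for x
  proof -
    have xc: "x \<in> carrier G" using x by (simp add: L_def)
    have "inj_on (\<lambda>m. x \<otimes> m \<otimes> inv x) M" using xc by (auto intro!: inj_onI)
    moreover have "(\<lambda>m. x \<otimes> m \<otimes> inv x) ` M \<subseteq> M" using x by (auto simp: L_def)
    ultimately have im: "(\<lambda>m. x \<otimes> m \<otimes> inv x) ` M = M" using fin endo_inj_surj by blast
    have "inv x \<otimes> m \<otimes> x \<in> M" if "m \<in> M" for m
    proof -
      obtain n where n: "n \<in> M" "m = x \<otimes> n \<otimes> inv x" using im \<open>m \<in> M\<close> by blast
      have "inv x \<otimes> m \<otimes> x = n" using n xc by (simp add: m_assoc inv_solve_left')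
      then show ?thesis using n by simp
    qed
    then show ?thesis using xc by (simp add: L_def)
  qed
  have L: "subgroup L G"
  proof (rule subgroupI)
    show "L \<noteq> {}" unfolding L_def by (auto intro!: exI[of _ \<one>])
    fix a b assume ab: "a \<in> L" "b \<in> L"
    have "a \<otimes> b \<otimes> m \<otimes> inv (a \<otimes> b) \<in> M" if m: "m \<in> M" for m
    proof -
      have c: "a \<in> carrier G" "b \<in> carrier G" using ab by (auto simp: L_def)
      have "a \<otimes> (b \<otimes> m \<otimes> inv b) \<otimes> inv a \<in> M" using ab m by (auto simp: L_def)
      then show ?thesis using c m by (simp add: m_assoc inv_mult_group)
    qed
    then show "a \<otimes> b \<in> L" using ab by (auto simp: L_def)
  qed (use Linv in \<open>auto simp: L_def\<close>)
  have "M \<subseteq> L" by (auto simp: L_def)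
  moreover have "g \<in> L" using g by (auto simp: L_def)
  ultimately have "L = carrier G" using mx[OF L] g by auto
  then show ?thesis using M normal_inv_iff by (auto simp: L_def)
qed

lemma maximal_subgroup_powers_generate:
  assumes max: "maximal_subgroup M G" and N: "M \<lhd> G" and x: "x \<in> carrier G" "x \<notin> M"
    and g: "g \<in> carrier G"
  obtains m and j :: int where "m \<in> M" "g = m \<otimes> x [^] j"
proof -
  have M: "subgroup M G" using N normal_imp_subgroup by auto
  interpret M: subgroup M G by fact
  have C: "subgroup (range (\<lambda>j::int. x [^] j)) G" using subgroup_of_powers[OF x(1)] by simp
  have K: "subgroup (M <#> range (\<lambda>j::int. x [^] j)) G" using mult_norm_subgroup[OF N C] .
  have "m \<otimes> x [^] (0::int) \<in> M <#> range (\<lambda>j::int. x [^] j)" if "m \<in> M" for m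
    using that unfolding set_mult_def by blast
  then have "M \<subseteq> M <#> range (\<lambda>j::int. x [^] j)" using M.mem_carrier by auto
  moreover have "\<one> \<otimes> x [^] (1::int) \<in> M <#> range (\<lambda>j::int. x [^] j)"
    using M.one_closed unfolding set_mult_def by blast
  then have "x \<in> M <#> range (\<lambda>j::int. x [^] j)" using x by simp
  ultimately have "M <#> range (\<lambda>j::int. x [^] j) = carrier G"
    using max K x unfolding maximal_subgroup_def by blast
  then show ?thesis using g that unfolding set_mult_def by blast
qed

text \<open>If \<open>g [^] p\<close> were outside \<open>M\<close>, then
  \<open>g = m \<otimes> (g [^] p) [^] j\<close> for some \<open>m \<in> M\<close>, so
  \<open>m\<close> is the power of \<open>g\<close> with exponent 1 - p j. This exponent is coprime
  to the group order, hence \<open>g\<close> is a power of \<open>m\<close> and lies in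
  \<open>M\<close>, and so does \<open>g [^] p\<close>.\<close>

lemma maximal_subgroup_contains_pow:
  assumes "prime p" "order G = p ^ k" and max: "maximal_subgroup M G" and g: "g \<in> carrier G"
  shows "g [^] p \<in> M"
proof (rule ccontr)
  assume no: "g [^] p \<notin> M"
  have N: "M \<lhd> G" using maximal_subgroup_normal assms by blast
  have M: "subgroup M G" using N normal_imp_subgroup by auto
  interpret M: subgroup M G by fact
  obtain m and j :: int where m: "m \<in> M" "g = m \<otimes> (g [^] p) [^] j"
    using maximal_subgroup_powers_generate[OF max N _ no g] g by auto
  let ?r = "1 - int p * j"
  have "(g [^] p) [^] j = g [^] (int p * j)" using g by (metis int_pow_int int_pow_pow mult.commute)
  then have mr: "m = g [^] ?r"
    using m g by (metis M.mem_carrier int_pow_1 int_pow_closed int_pow_diff inv_solve_right)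
  have "coprime ?r (int (p ^ k))"
  proof -
    have "coprime (1 - int p * j) (int p)"
    proof (rule coprimeI)
      fix c assume "c dvd 1 - int p * j" "c dvd int p"
      then have "c dvd (1 - int p * j) + int p * j" by (intro dvd_add dvd_mult2)
      then show "is_unit c" by simp
    qed
    then show ?thesis by simp
  qed
  then obtain u v where uv: "u * ?r + v * int (p ^ k) = 1" using bezout_int coprime_iff_gcd_eq_1 by metis
  have ord1: "g [^] int (p ^ k) = \<one>" using pow_order_eq_1[OF g] assms(2) by (simp only: int_pow_int)
  have "g = g [^] (u * ?r + v * int (p ^ k))" using uv g by simp
  also have "\<dots> = (g [^] ?r) [^] u \<otimes> (g [^] int (p ^ k)) [^] v"
    using g by (simp add: int_pow_mult int_pow_pow mult.commute del: of_nat_power)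
  also have "\<dots> = (g [^] ?r) [^] u" using g ord1 by simp
  finally have "g = (g [^] ?r) [^] u" .
  then have "g \<in> M" using mr m subgroup_int_pow_closed[OF M] by metis
  then have "g [^] p \<in> M" using M by (metis int_pow_int subgroup_int_pow_closed)
  then show False using no by simp
qed

text \<open>Modulo \<open>M\<close> every element is a power of one fixed element outside
  \<open>M\<close>; the quotient is cyclic and therefore abelian.\<close>

lemma maximal_subgroup_contains_commutator:
  assumes "prime p" "order G = p ^ k" and max: "maximal_subgroup M G"
    and g: "g \<in> carrier G" and h: "h \<in> carrier G"
  shows "inv (g \<otimes> h) \<otimes> (h \<otimes> g) \<in> M"
proof -
  have N: "M \<lhd> G" using maximal_subgroup_normal assms by blast
  interpret N: normal M G by fact
  have "M \<noteq> carrier G" using max by (simp add: maximal_subgroup_def)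
  then obtain x where x: "x \<in> carrier G" "x \<notin> M" using N.subset by auto
  obtain m and i :: int where m: "m \<in> M" "g = m \<otimes> x [^] i"
    using maximal_subgroup_powers_generate[OF max N x g] .
  obtain n and j :: int where n: "n \<in> M" "h = n \<otimes> x [^] j"
    using maximal_subgroup_powers_generate[OF max N x h] .
  have cos: "M #> (m \<otimes> x [^] i) = M #> x [^] i" if "m \<in> M" for m and i :: int
    using that x N.subset coset_mult_assoc[of M m "x [^] i"] coset_join2[of m M] N.is_subgroup by auto
  have "M #> (g \<otimes> h) = (M #> g) <#> (M #> h)" "M #> (h \<otimes> g) = (M #> h) <#> (M #> g)"
    using g h N.rcos_sum by auto
  moreover have "(M #> g) <#> (M #> h) = (M #> h) <#> (M #> g)"
    using cos m n x N.rcos_sum by (simp add: int_pow_mult[symmetric] add.commute)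
  ultimately have "M #> (h \<otimes> g) = M #> (g \<otimes> h)" by simp
  then have "h \<otimes> g \<in> M #> (g \<otimes> h)" using g h rcos_self[OF _ N.is_subgroup, of "h \<otimes> g"] by simp
  then have "h \<otimes> g \<in> (g \<otimes> h) <# M" using N.coset_eq g h by simp
  then obtain y where y: "y \<in> M" "h \<otimes> g = g \<otimes> h \<otimes> y" by (auto simp: l_coset_def)
  then have "inv (g \<otimes> h) \<otimes> (h \<otimes> g) = y"
    using g h by (simp add: inv_solve_left')
  then show ?thesis using y by simp
qed

end

text \<open>The last two assumptions together say that \<open>G / center G\<close> is elementary
  abelian. This is the form in which the hypothesis on the Frattini subgroup enters.\<close>

locale frattini_central_group = group G for G (structure) +
  fixes p k :: nat
  assumes prime_p: "prime p" and order_G: "order G = p ^ k"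
    and pow_center: "g \<in> carrier G \<Longrightarrow> g [^] p \<in> center G"
    and comm_center: "g \<in> carrier G \<Longrightarrow> h \<in> carrier G \<Longrightarrow> \<exists>c\<in>center G. h \<otimes> g = g \<otimes> h \<otimes> c"

lemma frattini_central_groupI:
  fixes G (structure)
  assumes "prime p" "p_group p G" "frattini G \<subseteq> center G"
  obtains k where "frattini_central_group G p k"
proof -
  obtain k where k: "group G" "order G = p ^ k" using assms(2) by (auto simp: p_group_def)
  interpret group G by fact
  show ?thesis
  proof (rule that[of k], unfold_locales)
    show "prime p" "order G = p ^ k" by fact+
    fix g assume g: "g \<in> carrier G"
    have "g [^] p \<in> frattini G"
      unfolding frattini_def using g maximal_subgroup_contains_pow[OF assms(1) k(2)] by auto
    then show "g [^] p \<in> center G" using assms(3) by auto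
    fix h assume h: "h \<in> carrier G"
    let ?c = "inv (g \<otimes> h) \<otimes> (h \<otimes> g)"
    have "?c \<in> frattini G"
      unfolding frattini_def using g h maximal_subgroup_contains_commutator[OF assms(1) k(2)] by auto
    moreover have "h \<otimes> g = g \<otimes> h \<otimes> ?c" using g h by (simp add: m_assoc[symmetric])
    ultimately show "\<exists>c\<in>center G. h \<otimes> g = g \<otimes> h \<otimes> c" using assms(3) by blast
  qed
qed

section \<open>Extension by derivations\<close>

lemma (in group) int_pow_lin_comb:
  assumes "x \<in> carrier G"
  shows "(x [^] a) [^] u \<otimes> (x [^] b) [^] v = x [^] (u * a + v * b :: int)"
  using assms by (simp add: int_pow_pow int_pow_mult mult.commute)

context frattini_central_group
begin

lemma p_gt_1: "p > 1" using prime_p prime_gt_1_nat by blast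

lemma finite_carrier: "finite (carrier G)"
  using order_G p_gt_1 order_gt_0_iff_finite by simp

lemma subgroup_center: "subgroup (center G) G"
  unfolding center_def by (rule subgroup_centralizer) simp

lemma center_carrier: "z \<in> center G \<Longrightarrow> z \<in> carrier G"
  by (simp add: center_def centralizer_def)

lemma center_commutes: "z \<in> center G \<Longrightarrow> g \<in> carrier G \<Longrightarrow> z \<otimes> g = g \<otimes> z"
  by (simp add: center_def centralizer_def)

lemma normal_over_center:
  assumes B: "subgroup B G" and Z: "center G \<subseteq> B" shows "B \<lhd> G"
proof -
  have "x \<otimes> b \<otimes> inv x \<in> B" if x: "x \<in> carrier G" and b: "b \<in> B" for x b
  proof -
    have bc: "b \<in> carrier G" using subgroup.mem_carrier[OF B b] .
    obtain c where c: "c \<in> center G" "x \<otimes> b = b \<otimes> x \<otimes> c" using comm_center[OF bc x] by blast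
    have "x \<otimes> b \<otimes> inv x = b \<otimes> (c \<otimes> x) \<otimes> inv x"
      using c x bc center_commutes[OF c(1) x] center_carrier by (simp add: m_assoc)
    also have "\<dots> = b \<otimes> c" using c x bc center_carrier by (simp add: m_assoc)
    also have "\<dots> \<in> B" using c Z b subgroup.m_closed[OF B] by blast
    finally show ?thesis .
  qed
  then show ?thesis using B normal_inv_iff by blast
qed

text \<open>Bezout for \<open>p\<close> and \<open>j\<close> writes \<open>x\<close> as a product of
  powers of \<open>x [^] p\<close>, which is central, and of \<open>x [^] j\<close>.\<close>

lemma mem_of_pow_mem:
  assumes K: "subgroup K G" and Z: "center G \<subseteq> K" and x: "x \<in> carrier G"
    and xj: "x [^] (j::int) \<in> K" and j: "\<not> int p dvd j"
  shows "x \<in> K"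
proof -
  have "coprime (int p) j" using j prime_p by (intro prime_imp_coprime) auto
  then obtain u v where uv: "u * int p + v * j = 1" using bezout_int coprime_iff_gcd_eq_1 by metis
  have "x [^] int p \<in> K" using pow_center[OF x] Z by (auto simp only: int_pow_int)
  then have "(x [^] int p) [^] u \<otimes> (x [^] j) [^] v \<in> K"
    using xj K subgroup_int_pow_closed subgroup.m_closed by metis
  moreover have "(x [^] int p) [^] u \<otimes> (x [^] j) [^] v = x [^] (u * int p + v * j)"
    using int_pow_lin_comb[OF x] .
  ultimately show ?thesis using uv x by simp
qed

text \<open>A subgroup maximal among those containing \<open>B\<close> but not \<open>g\<close> has index \<open>p\<close>.\<close>

lemma ex_hom_separating:
  assumes B: "subgroup B G" and Z: "center G \<subseteq> B" and g: "g \<in> carrier G" "g \<notin> B"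
  obtains f where "f \<in> hom G (integer_mod_group p)" "\<And>b. b \<in> B \<Longrightarrow> f b = 0" "f g = 1"
proof -
  let ?F = "{K. subgroup K G \<and> B \<subseteq> K \<and> g \<notin> K}"
  have "\<exists>K\<in>?F. \<forall>L\<in>?F. K \<subseteq> L \<longrightarrow> K = L"
    using finite_subgroups[OF finite_carrier] B g by (intro finite_has_maximal) auto
  then obtain K where K: "K \<in> ?F" "\<forall>L\<in>?F. K \<subseteq> L \<longrightarrow> K = L" by (rule bexE)
  have mx: "K = L" if "subgroup L G" "B \<subseteq> L" "g \<notin> L" "K \<subseteq> L" for L
    using K(2)[rule_format, of L] that by simp
  have sK: "subgroup K G" and BK: "B \<subseteq> K" and gK: "g \<notin> K" using K by auto
  have ZK: "center G \<subseteq> K" using Z BK by auto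
  interpret K: normal K G using normal_over_center[OF sK ZK] .
  have coset_pow: "K #> x [^] (i::int) = K #> y [^] i" if "K #> x = K #> y" "x \<in> carrier G" "y \<in> carrier G" for x y i
    using that K.FactGroup_int_pow[of x i] K.FactGroup_int_pow[of y i] by simp
  have absorb: "K #> (k \<otimes> y) = K #> y" if "k \<in> K" "y \<in> carrier G" for k y
    using that coset_mult_assoc[of K k y] coset_join2[OF K.mem_carrier[OF that(1)] sK that(1)] K.subset by simp
  have red: "K #> g [^] (i mod int p) = K #> g [^] i" for i :: int
  proof -
    have "(g [^] int p) [^] (i div int p) \<in> K"
      using pow_center[OF g(1)] ZK sK subgroup_int_pow_closed by (auto simp: int_pow_int)
    moreover have "g [^] i = (g [^] int p) [^] (i div int p) \<otimes> g [^] (i mod int p)"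
      using int_pow_lin_comb[OF g(1), of "int p" "i div int p" "i mod int p" 1] g(1) by simp
    ultimately show ?thesis using g(1) absorb by simp
  qed
  \<comment> \<open>If \<open>x\<close> is outside \<open>K\<close>, maximality forces
    \<open>g\<close> into the product of \<open>K\<close> with the powers of \<open>x\<close>, say
    \<open>g = k \<otimes> x [^] j\<close>. Here \<open>p\<close> does not divide \<open>j\<close>,
    since otherwise \<open>g\<close> would lie in \<open>K\<close>; so the relation can be inverted
    and \<open>x\<close> is a power of \<open>g\<close> modulo \<open>K\<close>.\<close>
  have ex: "\<exists>i::int. i \<in> {0..<int p} \<and> K #> x = K #> g [^] i" if x: "x \<in> carrier G" for x
  proof (cases "x \<in> K")
    case True
    then show ?thesis using p_gt_1 coset_join2[OF x sK] K.subset by (intro exI[of _ 0]) auto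
  next
    case False
    let ?P = "range (\<lambda>j::int. x [^] j)"
    have P: "subgroup ?P G" using subgroup_of_powers[OF x] by simp
    have L: "subgroup (K <#> ?P) G" using mult_norm_subgroup[OF normal_over_center[OF sK ZK] P] .
    have "k \<otimes> x [^] (0::int) \<in> K <#> ?P" if "k \<in> K" for k
      using that unfolding set_mult_def by blast
    then have KL: "K \<subseteq> K <#> ?P" using K.mem_carrier by auto
    have "\<one> \<otimes> x [^] (1::int) \<in> K <#> ?P" using K.one_closed unfolding set_mult_def by blast
    then have xL: "x \<in> K <#> ?P" using x by simp
    have "g \<in> K <#> ?P"
    proof (rule ccontr)
      assume "g \<notin> K <#> ?P"
      then have "K = K <#> ?P" using mx[OF L subset_trans[OF BK KL] _ KL] by simp
      then show False using xL False by simp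
    qed
    then obtain k and j :: int where kj: "k \<in> K" "g = k \<otimes> x [^] j" unfolding set_mult_def by blast
    have cg: "K #> g = K #> x [^] j"
      using kj x absorb by simp
    have "\<not> int p dvd j"
    proof
      assume "int p dvd j"
      then obtain i where "j = int p * i" by (auto elim: dvdE)
      then have "x [^] j = (x [^] int p) [^] i" using x by (simp add: int_pow_pow mult.commute)
      moreover have "x [^] int p \<in> K" using pow_center[OF x] ZK by (auto simp only: int_pow_int)
      ultimately have "x [^] j \<in> K" using subgroup_int_pow_closed[OF sK] by auto
      then show False using kj gK K.m_closed by auto
    qed
    then have "coprime (int p) j" using prime_p by (intro prime_imp_coprime) auto
    then obtain u v where uv: "u * int p + v * j = 1" using bezout_int coprime_iff_gcd_eq_1 by metis
    have "(x [^] int p) [^] u \<in> K"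
      using pow_center[OF x] ZK sK subgroup_int_pow_closed by (auto simp: int_pow_int)
    moreover have "x = (x [^] int p) [^] u \<otimes> (x [^] j) [^] v"
    proof -
      have "x = x [^] (u * int p + v * j)" using uv x by simp
      then show ?thesis using int_pow_lin_comb[OF x] by simp
    qed
    ultimately have "K #> x = K #> (x [^] j) [^] v"
      using x absorb by (metis int_pow_closed)
    also have "\<dots> = K #> g [^] v" using coset_pow[OF cg g(1)] x by simp
    also have "\<dots> = K #> g [^] (v mod int p)" using red by simp
    finally show ?thesis using p_gt_1 by (intro exI[of _ "v mod int p"]) auto
  qed
  \<comment> \<open>The discrete logarithm modulo \<open>K\<close> to the base \<open>g\<close>,
    normalized to the representatives used by \<open>integer_mod_group\<close>.\<close>
  define f where "f x = (SOME i::int. i \<in> {0..<int p} \<and> K #> x = K #> g [^] i)" for x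
  have f: "f x \<in> {0..<int p}" "K #> x = K #> g [^] f x" if "x \<in> carrier G" for x
    using someI_ex[OF ex[OF that]] unfolding f_def by auto
  have uniq: "f x = i" if x: "x \<in> carrier G" and i: "i \<in> {0..<int p}" "K #> x = K #> g [^] i" for x i
  proof (rule ccontr)
    assume ne: "f x \<noteq> i"
    have "K #> g [^] f x = K #> g [^] i" using f(2)[OF x] i by simp
    then have "g [^] f x \<in> K #> g [^] i" using rcos_self[OF _ sK, of "g [^] f x"] g by simp
    then obtain k where k: "k \<in> K" "g [^] f x = k \<otimes> g [^] i" by (auto simp: r_coset_def)
    then have "g [^] (f x - i) = k"
      using g(1) by (simp add: int_pow_diff m_assoc)
    then have gd: "g [^] (f x - i) \<in> K" using k by simp
    have "\<bar>f x - i\<bar> < int p" "f x - i \<noteq> 0" using f(1)[OF x] i ne by auto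
    then have "\<not> int p dvd f x - i" by (meson zdvd_not_zless dvd_abs_iff zero_less_abs_iff)
    then show False using mem_of_pow_mem[OF sK ZK g(1) gd] gK by blast
  qed
  have "f \<in> hom G (integer_mod_group p)"
  proof (rule homI)
    fix x y assume xy: "x \<in> carrier G" "y \<in> carrier G"
    show "f x \<in> carrier (integer_mod_group p)" using f(1)[OF xy(1)] p_gt_1 by (simp add: carrier_integer_mod_group)
    have "K #> (x \<otimes> y) = (K #> x) <#> (K #> y)" using xy K.rcos_sum by simp
    also have "\<dots> = (K #> g [^] f x) <#> (K #> g [^] f y)" using f(2) xy by metis
    also have "\<dots> = K #> (g [^] f x \<otimes> g [^] f y)" using g(1) K.rcos_sum by simp
    also have "\<dots> = K #> g [^] ((f x + f y) mod int p)" using g(1) red by (simp add: int_pow_mult)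
    finally have "f (x \<otimes> y) = (f x + f y) mod int p" using uniq xy p_gt_1 by auto
    then show "f (x \<otimes> y) = f x \<otimes>\<^bsub>integer_mod_group p\<^esub> f y" by simp
  qed
  moreover have "f b = 0" if "b \<in> B" for b
  proof (rule uniq)
    show "b \<in> carrier G" using that B subgroup.mem_carrier by metis
    show "K #> b = K #> g [^] (0::int)" using that BK coset_join2[OF _ sK] K.subset by auto
  qed (use p_gt_1 in auto)
  moreover have "f g = 1" using g(1) p_gt_1 by (intro uniq) auto
  ultimately show ?thesis using that by blast
qed

end

text \<open>The functional equation says exactly that \<open>x \<mapsto> x \<otimes> d x\<close> is
  multiplicative: these are crossed homomorphisms. Values in \<open>B\<close> and triviality on
  \<open>B\<close> express that this map fixes \<open>G / B\<close> and \<open>B\<close> pointwise.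
  Extensionality makes equality of derivations equality on the carrier.\<close>

definition derivations :: "('a, 'b) monoid_scheme \<Rightarrow> 'a set \<Rightarrow> ('a \<Rightarrow> 'a) set" where
  "derivations G B = {d \<in> carrier G \<rightarrow>\<^sub>E B. (\<forall>b\<in>B. d b = \<one>\<^bsub>G\<^esub>) \<and>
     (\<forall>x\<in>carrier G. \<forall>y\<in>carrier G.
        d (x \<otimes>\<^bsub>G\<^esub> y) = inv\<^bsub>G\<^esub> y \<otimes>\<^bsub>G\<^esub> d x \<otimes>\<^bsub>G\<^esub> y \<otimes>\<^bsub>G\<^esub> d y)}"

text \<open>For abelian \<open>B\<close> this is the semidirect product of \<open>G\<close> by the abelian group of the automorphisms
  \<open>x \<mapsto> x \<otimes> d x\<close>, which fix \<open>B\<close> and \<open>G / B\<close> pointwise.\<close>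

definition derivation_extension :: "('a, 'b) monoid_scheme \<Rightarrow> 'a set \<Rightarrow> ('a \<times> ('a \<Rightarrow> 'a)) monoid" where
  "derivation_extension G B =
     \<lparr>carrier = carrier G \<times> derivations G B,
      monoid.mult = (\<lambda>(x, d) (y, e). (x \<otimes>\<^bsub>G\<^esub> y \<otimes>\<^bsub>G\<^esub> d y, \<lambda>a\<in>carrier G. d a \<otimes>\<^bsub>G\<^esub> e a)),
      one = (\<one>\<^bsub>G\<^esub>, \<lambda>a\<in>carrier G. \<one>\<^bsub>G\<^esub>)\<rparr>"

locale abelian_over_center = frattini_central_group +
  fixes B
  assumes subgroup_B: "subgroup B G" and center_B: "center G \<subseteq> B"
    and abelian_B: "a \<in> B \<Longrightarrow> b \<in> B \<Longrightarrow> a \<otimes> b = b \<otimes> a"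
begin

sublocale B: normal B G using normal_over_center[OF subgroup_B center_B] .

lemma abelian_B_left:
  assumes "a \<in> B" "b \<in> B" "c \<in> B" shows "a \<otimes> (b \<otimes> c) = b \<otimes> (a \<otimes> c)"
  using assms abelian_B[of a b] by (simp add: m_assoc[symmetric])

abbreviation Der where "Der \<equiv> derivations G B"

lemma DerD:
  assumes "d \<in> Der"
  shows "x \<in> carrier G \<Longrightarrow> d x \<in> B" "x \<in> carrier G \<Longrightarrow> d x \<in> carrier G"
    "b \<in> B \<Longrightarrow> d b = \<one>" "d \<in> extensional (carrier G)"
    "x \<in> carrier G \<Longrightarrow> y \<in> carrier G \<Longrightarrow> d (x \<otimes> y) = inv y \<otimes> d x \<otimes> y \<otimes> d y"
  using assms B.subset by (auto simp: derivations_def PiE_iff)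

lemma conj_B: "y \<in> carrier G \<Longrightarrow> b \<in> B \<Longrightarrow> inv y \<otimes> b \<otimes> y \<in> B"
  by (rule B.inv_op_closed1)

text \<open>Placing the derivations inside a direct product of copies of \<open>B\<close> supplies
  inverses and, by Lagrange, shows that their number is a power of \<open>p\<close>. The functional
  equation survives pointwise products because \<open>B\<close> is normal and abelian.\<close>

lemma subgroup_Der: "subgroup Der (product_group (carrier G) (\<lambda>_. G\<lparr>carrier := B\<rparr>))"
proof -
  have GB: "group (G\<lparr>carrier := B\<rparr>)" using subgroup_B subgroup_imp_group by auto
  interpret PB: group "product_group (carrier G) (\<lambda>_. G\<lparr>carrier := B\<rparr>)" using GB by simp
  have invB: "inv\<^bsub>G\<lparr>carrier := B\<rparr>\<^esub> b = inv b" if "b \<in> B" for b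
    using that subgroup_B by (simp add: m_inv_consistent)
  show ?thesis
  proof (rule PB.subgroupI)
    show "Der \<subseteq> carrier (product_group (carrier G) (\<lambda>_. G\<lparr>carrier := B\<rparr>))"
      by (auto simp: derivations_def)
    have "(\<lambda>x\<in>carrier G. \<one>) \<in> Der" using B.subset by (auto simp: derivations_def)
    then show "Der \<noteq> {}" by blast
  next
    fix d assume d: "d \<in> Der"
    then have dc: "d \<in> carrier (product_group (carrier G) (\<lambda>_. G\<lparr>carrier := B\<rparr>))"
      by (auto simp: derivations_def)
    have "inv\<^bsub>product_group (carrier G) (\<lambda>_. G\<lparr>carrier := B\<rparr>)\<^esub> d = (\<lambda>x\<in>carrier G. inv (d x))"
      using dc GB by (auto simp: invB fun_eq_iff PiE_iff)
    moreover have "(\<lambda>x\<in>carrier G. inv (d x)) \<in> Der"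
    proof -
      have "inv (d (x \<otimes> y)) = inv y \<otimes> inv (d x) \<otimes> y \<otimes> inv (d y)" if xy: "x \<in> carrier G" "y \<in> carrier G" for x y
      proof -
        have b: "inv y \<otimes> d x \<otimes> y \<in> B" "d y \<in> B" using xy d DerD conj_B by auto
        have "inv (d (x \<otimes> y)) = inv (inv y \<otimes> d x \<otimes> y) \<otimes> inv (d y)"
          using DerD(5)[OF d xy] b abelian_B[OF B.m_inv_closed[OF b(1)] B.m_inv_closed[OF b(2)]]
          by (simp add: inv_mult_group)
        also have "inv (inv y \<otimes> d x \<otimes> y) = inv y \<otimes> inv (d x) \<otimes> y"
          using xy d DerD(2) by (simp add: inv_mult_group m_assoc)
        finally show ?thesis .
      qed
      then show ?thesis using d DerD[OF d] B.subset by (auto simp: derivations_def)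
    qed
    ultimately show "inv\<^bsub>product_group (carrier G) (\<lambda>_. G\<lparr>carrier := B\<rparr>)\<^esub> d \<in> Der" by simp
  next
    fix d e assume d: "d \<in> Der" and e: "e \<in> Der"
    have "d (x \<otimes> y) \<otimes> e (x \<otimes> y) = inv y \<otimes> (d x \<otimes> e x) \<otimes> y \<otimes> (d y \<otimes> e y)"
      if xy: "x \<in> carrier G" "y \<in> carrier G" for x y
    proof -
      have b: "inv y \<otimes> d x \<otimes> y \<in> B" "d y \<in> B" "inv y \<otimes> e x \<otimes> y \<in> B" "e y \<in> B"
        using xy d e DerD conj_B by auto
      have "d (x \<otimes> y) \<otimes> e (x \<otimes> y) = (inv y \<otimes> d x \<otimes> y \<otimes> d y) \<otimes> (inv y \<otimes> e x \<otimes> y \<otimes> e y)"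
        using DerD(5)[OF d xy] DerD(5)[OF e xy] by simp
      also have "\<dots> = (inv y \<otimes> d x \<otimes> y) \<otimes> ((inv y \<otimes> e x \<otimes> y) \<otimes> (d y \<otimes> e y))"
        using b abelian_B_left[OF b(2,3,4)] by (simp only: m_assoc B.mem_carrier m_closed)
      also have "\<dots> = inv y \<otimes> d x \<otimes> (y \<otimes> inv y) \<otimes> e x \<otimes> y \<otimes> (d y \<otimes> e y)"
        using xy DerD(2)[OF d] DerD(2)[OF e] by (simp only: m_assoc inv_closed m_closed)
      also have "\<dots> = inv y \<otimes> (d x \<otimes> e x) \<otimes> y \<otimes> (d y \<otimes> e y)"
        using xy DerD(2)[OF d] DerD(2)[OF e] by (simp add: m_assoc)
      finally show ?thesis .
    qed
    then show "d \<otimes>\<^bsub>product_group (carrier G) (\<lambda>_. G\<lparr>carrier := B\<rparr>)\<^esub> e \<in> Der"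
      using DerD[OF d] DerD[OF e] B.subset by (auto simp: derivations_def)
  qed
qed

lemma Der_one: "(\<lambda>a\<in>carrier G. \<one>) \<in> Der"
  using subgroup.one_closed[OF subgroup_Der] by simp

lemma Der_mult: "d \<in> Der \<Longrightarrow> e \<in> Der \<Longrightarrow> (\<lambda>a\<in>carrier G. d a \<otimes> e a) \<in> Der"
  using subgroup.m_closed[OF subgroup_Der] by simp

lemma Der_inv:
  assumes d: "d \<in> Der"
  obtains e where "e \<in> Der" "\<And>x. x \<in> carrier G \<Longrightarrow> e x = inv (d x)"
proof -
  have GB: "group (G\<lparr>carrier := B\<rparr>)" using subgroup_B subgroup_imp_group by auto
  let ?e = "inv\<^bsub>product_group (carrier G) (\<lambda>_. G\<lparr>carrier := B\<rparr>)\<^esub> d"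
  have "?e \<in> Der" using subgroup.m_inv_closed[OF subgroup_Der d] .
  moreover have "d \<in> carrier (product_group (carrier G) (\<lambda>_. G\<lparr>carrier := B\<rparr>))"
    using d by (auto simp: derivations_def)
  then have "?e x = inv (d x)" if "x \<in> carrier G" for x
    using that GB DerD(1)[OF d that] subgroup_B by (simp add: m_inv_consistent)
  ultimately show ?thesis using that by blast
qed

lemma finite_B: "finite B" using finite_carrier B.subset finite_subset by blast

lemma card_power_of_p: "subgroup H G \<Longrightarrow> \<exists>j. card H = p ^ j"
  using lagrange[of H] order_G divides_primepow_nat[OF prime_p] by (metis dvd_triv_right)

lemma card_Der: obtains j where "card Der = p ^ j"
proof -
  have GB: "group (G\<lparr>carrier := B\<rparr>)" using subgroup_B subgroup_imp_group by auto
  interpret PB: group "product_group (carrier G) (\<lambda>_. G\<lparr>carrier := B\<rparr>)" using GB by simp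
  obtain i where i: "card B = p ^ i" using card_power_of_p[OF subgroup_B] by blast
  have "order (product_group (carrier G) (\<lambda>_. G\<lparr>carrier := B\<rparr>)) = p ^ (i * card (carrier G))"
    using finite_carrier i by (simp add: order_def card_PiE power_mult)
  then show ?thesis
    using PB.lagrange[OF subgroup_Der] that divides_primepow_nat[OF prime_p] by (metis dvd_triv_right)
qed

lemma finite_Der: "finite Der"
proof (rule finite_subset)
  show "Der \<subseteq> carrier G \<rightarrow>\<^sub>E B" unfolding derivations_def by blast
qed (use finite_carrier finite_B in \<open>simp add: finite_PiE\<close>)

abbreviation Q where "Q \<equiv> derivation_extension G B"

lemma carrier_Q: "carrier Q = carrier G \<times> Der" by (simp add: derivation_extension_def)

lemma mult_Q: "(x, d) \<otimes>\<^bsub>Q\<^esub> (y, e) = (x \<otimes> y \<otimes> d y, \<lambda>a\<in>carrier G. d a \<otimes> e a)"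
  by (simp add: derivation_extension_def)

lemma one_Q: "\<one>\<^bsub>Q\<^esub> = (\<one>, \<lambda>a\<in>carrier G. \<one>)" by (simp add: derivation_extension_def)

text \<open>This makes composing \<open>x \<mapsto> x \<otimes> d x\<close> with
  \<open>x \<mapsto> x \<otimes> e x\<close> the same as multiplying \<open>d\<close> and
  \<open>e\<close> pointwise: the factor \<open>e x\<close> lies in \<open>B\<close> and is ignored
  by \<open>d\<close>. Associativity in \<open>Q\<close> rests on it.\<close>

lemma Der_right_B:
  assumes d: "d \<in> Der" and x: "x \<in> carrier G" and b: "b \<in> B"
  shows "d (x \<otimes> b) = d x"
proof -
  have bc: "b \<in> carrier G" using b by simp
  have "d (x \<otimes> b) = inv b \<otimes> (d x \<otimes> b)" using DerD(5)[OF d x bc] DerD(3)[OF d b] DerD(2)[OF d x] bc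
    by (simp add: m_assoc)
  also have "\<dots> = inv b \<otimes> (b \<otimes> d x)" using abelian_B[OF DerD(1)[OF d x] b] by simp
  also have "\<dots> = d x" using bc DerD(2)[OF d x] by (simp add: m_assoc[symmetric])
  finally show ?thesis .
qed

lemma group_Q: "group Q"
proof (rule groupI)
  fix u v assume "u \<in> carrier Q" "v \<in> carrier Q"
  then show "u \<otimes>\<^bsub>Q\<^esub> v \<in> carrier Q" by (auto simp: carrier_Q mult_Q Der_mult DerD)
next
  show "\<one>\<^bsub>Q\<^esub> \<in> carrier Q" by (auto simp: carrier_Q one_Q Der_one)
next
  fix u v w assume "u \<in> carrier Q" "v \<in> carrier Q" "w \<in> carrier Q"
  then obtain x d y e z f where uvw: "u = (x, d)" "v = (y, e)" "w = (z, f)"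
    and m: "x \<in> carrier G" "y \<in> carrier G" "z \<in> carrier G" "d \<in> Der" "e \<in> Der" "f \<in> Der"
    by (auto simp: carrier_Q)
  note c = m(1-3) DerD(2)[OF m(4)] DerD(2)[OF m(5)] DerD(2)[OF m(6)]
  let ?q = "inv z \<otimes> d y \<otimes> z"
  have q: "?q \<in> B" using m DerD conj_B by auto
  have ez: "e z \<in> B" "d z \<in> B" using m DerD by auto
  have "d (y \<otimes> z \<otimes> e z) = ?q \<otimes> d z"
    using Der_right_B[OF m(4), of "y \<otimes> z" "e z"] DerD(5)[OF m(4,2,3)] m ez by simp
  then have "y \<otimes> z \<otimes> e z \<otimes> d (y \<otimes> z \<otimes> e z) = y \<otimes> z \<otimes> (?q \<otimes> (e z \<otimes> d z))"
    using abelian_B_left[OF ez(1) q ez(2)] c ez by (simp add: m_assoc)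
  also have "\<dots> = y \<otimes> (z \<otimes> inv z) \<otimes> d y \<otimes> z \<otimes> (d z \<otimes> e z)"
    using abelian_B[OF ez] c by (simp only: m_assoc inv_closed m_closed)
  also have "\<dots> = y \<otimes> d y \<otimes> z \<otimes> (d z \<otimes> e z)" using c by simp
  finally have "x \<otimes> y \<otimes> d y \<otimes> z \<otimes> (d z \<otimes> e z) = x \<otimes> (y \<otimes> z \<otimes> e z) \<otimes> d (y \<otimes> z \<otimes> e z)"
    using c by (simp add: m_assoc)
  moreover have "(\<lambda>a\<in>carrier G. (\<lambda>a\<in>carrier G. d a \<otimes> e a) a \<otimes> f a)
      = (\<lambda>a\<in>carrier G. d a \<otimes> (\<lambda>a\<in>carrier G. e a \<otimes> f a) a)"
    by (rule restrict_ext) (simp add: m_assoc c)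
  ultimately show "u \<otimes>\<^bsub>Q\<^esub> v \<otimes>\<^bsub>Q\<^esub> w = u \<otimes>\<^bsub>Q\<^esub> (v \<otimes>\<^bsub>Q\<^esub> w)"
    unfolding uvw mult_Q using m(3) by simp
next
  fix u assume "u \<in> carrier Q"
  then obtain x d where u: "u = (x, d)" "x \<in> carrier G" "d \<in> Der" by (auto simp: carrier_Q)
  have "(\<lambda>a\<in>carrier G. (\<lambda>a\<in>carrier G. \<one>) a \<otimes> d a) = d"
    using DerD(2,4)[OF u(3)] by (auto simp: fun_eq_iff extensional_def)
  then show "\<one>\<^bsub>Q\<^esub> \<otimes>\<^bsub>Q\<^esub> u = u" using u by (simp add: one_Q mult_Q)
  obtain e where e: "e \<in> Der" "\<And>x. x \<in> carrier G \<Longrightarrow> e x = inv (d x)" using Der_inv[OF u(3)] by blast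
  let ?y = "inv (x \<otimes> e x)"
  have ex: "e x \<in> carrier G" using DerD(2)[OF e(1) u(2)] .
  have "(?y, e) \<otimes>\<^bsub>Q\<^esub> u = \<one>\<^bsub>Q\<^esub>"
    using u ex e(2) DerD(2)[OF u(3)] by (auto simp: mult_Q one_Q m_assoc fun_eq_iff)
  moreover have "(?y, e) \<in> carrier Q" using u e ex by (simp add: carrier_Q)
  ultimately show "\<exists>v\<in>carrier Q. v \<otimes>\<^bsub>Q\<^esub> u = \<one>\<^bsub>Q\<^esub>" by blast
qed

lemma finite_Q: "finite (carrier Q)" using finite_carrier finite_Der by (simp add: carrier_Q)

lemma p_group_Q: "p_group p Q"
proof -
  obtain j where "card Der = p ^ j" using card_Der .
  then have "order Q = p ^ (k + j)"
    using order_G by (simp add: order_def carrier_Q card_cartesian_product power_add)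
  then show ?thesis using group_Q finite_Q by (auto simp: p_group_def)
qed

text \<open>The image consists of the elements with trivial derivation part, and derivation parts
  multiply independently of the first components; so the image is the kernel of the projection to
  \<open>Der\<close>.\<close>

lemma normal_embedding_Q: "normal_embedding (\<lambda>x. (x, \<lambda>a\<in>carrier G. \<one>)) G Q"
proof -
  let ?f = "\<lambda>x. (x, \<lambda>a\<in>carrier G. \<one>)"
  interpret Q: group Q by (rule group_Q)
  have f: "?f \<in> hom G Q" using Der_one by (auto simp: hom_def carrier_Q mult_Q)
  then interpret f: group_hom G Q ?f by unfold_locales
  have inj: "inj_on ?f (carrier G)" by (auto intro: inj_onI)
  have imgI: "w \<in> ?f ` carrier G" if "w \<in> carrier Q" "snd w = (\<lambda>a\<in>carrier G. \<one>)" for w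
    using that by (cases w) (simp add: carrier_Q)
  have "u \<otimes>\<^bsub>Q\<^esub> ?f x \<otimes>\<^bsub>Q\<^esub> inv\<^bsub>Q\<^esub> u \<in> ?f ` carrier G" if u: "u \<in> carrier Q" and x: "x \<in> carrier G" for u x
  proof -
    let ?v = "inv\<^bsub>Q\<^esub> u"
    have v: "?v \<in> carrier Q" using u by simp
    obtain y d z e where ud: "u = (y, d)" "?v = (z, e)" "y \<in> carrier G" "z \<in> carrier G" "d \<in> Der" "e \<in> Der"
      using u v by (cases u, cases ?v) (auto simp: carrier_Q)
    have uv: "u \<otimes>\<^bsub>Q\<^esub> ?v = \<one>\<^bsub>Q\<^esub>" using u by (rule Q.r_inv)
    have "(y, d) \<otimes>\<^bsub>Q\<^esub> (z, e) = (\<one>, \<lambda>a\<in>carrier G. \<one>)" using uv unfolding ud(2) unfolding ud(1) one_Q .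
    then have de: "(\<lambda>a\<in>carrier G. d a \<otimes> e a) = (\<lambda>a\<in>carrier G. \<one>)"
      unfolding mult_Q by (rule prod.inject[THEN iffD1, THEN conjunct2])
    have "(\<lambda>a\<in>carrier G. (\<lambda>a\<in>carrier G. d a \<otimes> (\<lambda>a\<in>carrier G. \<one>) a) a \<otimes> e a) = (\<lambda>a\<in>carrier G. d a \<otimes> e a)"
      by (rule restrict_ext) (simp add: DerD(2)[OF ud(5)])
    then have "snd (u \<otimes>\<^bsub>Q\<^esub> ?f x \<otimes>\<^bsub>Q\<^esub> ?v) = (\<lambda>a\<in>carrier G. \<one>)"
      unfolding ud(2) unfolding ud(1) mult_Q snd_conv de .
    moreover have "u \<otimes>\<^bsub>Q\<^esub> ?f x \<otimes>\<^bsub>Q\<^esub> ?v \<in> carrier Q" 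
      using u v f.hom_closed[OF x] by (intro Q.m_closed)
    ultimately show ?thesis using imgI by blast
  qed
  then have "?f ` carrier G \<lhd> Q" using f.img_is_subgroup Q.normal_inv_iff by blast
  then show ?thesis using f inj by (simp add: normal_embedding_def mon_def)
qed

end

section \<open>Counting pairs that commute with a subgroup\<close>

lemma (in group) card_le_hom_kernel:
  assumes f: "f \<in> hom G (integer_mod_group p)" and p: "p > 0" and M: "subgroup M G" and fin: "finite M"
  shows "card M \<le> p * card {x \<in> M. f x = 0}"
proof -
  interpret f: group_hom G "integer_mod_group p" f
    by (intro group_hom.intro group_hom_axioms.intro f is_group group_integer_mod_group)
  have sub: "f ` M \<subseteq> {0..<int p}"
    using f.hom_closed subgroup.mem_carrier[OF M] p by (force simp: carrier_integer_mod_group)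
  have "card {x \<in> M. f x = i} \<le> card {x \<in> M. f x = 0}" if i: "i \<in> f ` M" for i
  proof -
    obtain x0 where x0: "x0 \<in> M" "i = f x0" using i by blast
    note c = subgroup.mem_carrier[OF M]
    have "inv x0 \<otimes> x \<in> {x \<in> M. f x = 0}" if x: "x \<in> M" "f x = i" for x
    proof -
      have "f (inv x0 \<otimes> x) = inv\<^bsub>integer_mod_group p\<^esub> (f x0) \<otimes>\<^bsub>integer_mod_group p\<^esub> f x"
        using x x0 c by simp
      also have "\<dots> = \<one>\<^bsub>integer_mod_group p\<^esub>"
        unfolding x(2) x0(2) using f.hom_closed[OF c[OF x0(1)]] by (rule f.H.l_inv)
      finally show ?thesis
        using x x0 subgroup.m_closed[OF M] subgroup.m_inv_closed[OF M] by simp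
    qed
    moreover have "inj_on (\<lambda>x. inv x0 \<otimes> x) {x \<in> M. f x = i}"
      using c x0 by (auto intro!: inj_onI)
    ultimately show ?thesis
      using fin by (intro card_inj_on_le[where f = "\<lambda>x. inv x0 \<otimes> x"]) auto
  qed
  then have "(\<Sum>i\<in>f ` M. card {x \<in> M. f x = i}) \<le> of_nat (card (f ` M)) * card {x \<in> M. f x = 0}"
    by (rule sum_bounded_above)
  moreover have "card M = (\<Sum>i\<in>f ` M. card {x \<in> M. f x = i})"
    using sum.image_gen[OF fin, of "\<lambda>_. 1::nat" f] by simp
  moreover have "card (f ` M) * card {x \<in> M. f x = 0} \<le> p * card {x \<in> M. f x = 0}"
    using card_mono[OF _ sub] by (intro mult_le_mono1) simp
  ultimately show ?thesis unfolding of_nat_id by linarith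
qed

lemma (in group) pow_mod_int:
  assumes "x \<in> carrier G" "x [^] (p::nat) = \<one>" shows "x [^] (i mod int p) = x [^] (i::int)"
proof -
  have "x [^] i = (x [^] int p) [^] (i div int p) \<otimes> (x [^] (1::int)) [^] (i mod int p)"
    using int_pow_lin_comb[OF assms(1), of "int p" "i div int p" 1 "i mod int p"] by simp
  then show ?thesis using assms by (simp add: int_pow_int)
qed

context frattini_central_group
begin

lemma center_pow: "z \<in> center G \<Longrightarrow> z [^] (i::int) \<in> center G"
  using subgroup_int_pow_closed[OF subgroup_center] .

lemma pow_eq_one_cancel:
  assumes x: "x \<in> carrier G" "x [^] p = \<one>" "x \<noteq> \<one>" and i: "x [^] (i::int) = \<one>"
  shows "int p dvd i"
proof (rule ccontr)
  assume "\<not> int p dvd i"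
  then have "coprime (int p) i" using prime_p by (intro prime_imp_coprime) auto
  then obtain u v where uv: "u * int p + v * i = 1" using bezout_int coprime_iff_gcd_eq_1 by metis
  have "x = x [^] (u * int p + v * i)" using uv x by simp
  also have "\<dots> = (x [^] int p) [^] u \<otimes> (x [^] i) [^] v" using int_pow_lin_comb[OF x(1)] by simp
  also have "\<dots> = \<one>" using x i by (simp add: int_pow_int)
  finally show False using x by simp
qed

end

context abelian_over_center
begin

text \<open>Conjugation fixes central values, so the derivation law reduces to \<open>f\<close>
  being a homomorphism, and \<open>z [^] p = \<one>\<close> absorbs the reduction modulo
  \<open>p\<close>. These derivations give the central automorphisms.\<close>

lemma central_hom_Der:
  assumes f: "f \<in> hom G (integer_mod_group p)" and fB: "\<And>b. b \<in> B \<Longrightarrow> f b = 0"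
    and z: "z \<in> center G" "z [^] p = \<one>"
  shows "(\<lambda>x\<in>carrier G. z [^] f x) \<in> Der"
proof -
  have zc: "z \<in> carrier G" using center_carrier z by blast
  have mult: "z [^] f (x \<otimes> y) = inv y \<otimes> z [^] f x \<otimes> y \<otimes> z [^] f y"
    if xy: "x \<in> carrier G" "y \<in> carrier G" for x y
  proof -
    have "z [^] f (x \<otimes> y) = z [^] ((f x + f y) mod int p)" using hom_mult[OF f xy] by simp
    also have "\<dots> = z [^] f x \<otimes> z [^] f y" using pow_mod_int[OF zc z(2)] zc by (simp add: int_pow_mult)
    also have "z [^] f x = inv y \<otimes> (y \<otimes> z [^] f x)" using xy zc by (simp add: m_assoc[symmetric])
    also have "y \<otimes> z [^] f x = z [^] f x \<otimes> y" using center_commutes[OF center_pow[OF z(1)] xy(2)] by simp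
    finally show ?thesis using xy zc by (simp add: m_assoc)
  qed
  then show ?thesis
    using center_pow[OF z(1)] center_B zc B.subset by (auto simp: derivations_def fB subset_iff)
qed

text \<open>The elements of the abelian normal subgroup B \<times> Der of \<open>Q\<close> that
  centralize M \<times> Der. The equation compares the first components of
  \<open>(b, d) \<otimes> (x, e)\<close> and \<open>(x, e) \<otimes> (b, d)\<close>, the factor
  \<open>e b\<close> being trivial for \<open>b \<in> B\<close>.\<close>

definition commuting_pairs where
  "commuting_pairs M = {(b, d) \<in> B \<times> Der. \<forall>x\<in>M. b \<otimes> x \<otimes> d x = x \<otimes> b}"

lemma finite_commuting_pairs: "finite (commuting_pairs M)"
  by (rule finite_subset[of _ "B \<times> Der"]) (auto simp: commuting_pairs_def finite_B finite_Der)

lemma commuting_pairs_B: "commuting_pairs B = B \<times> Der"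
  using abelian_B by (auto simp: commuting_pairs_def DerD)

text \<open>Multiplying \<open>d\<close> by the powers of \<open>z\<^sup>f\<close> moves commuting pairs of \<open>M\<close> to pairs that still commute
  with \<open>M \<inter> ker f\<close>.\<close>

lemma twist_commuting_pairs:
  assumes f: "f \<in> hom G (integer_mod_group p)" and fB: "\<And>b. b \<in> B \<Longrightarrow> f b = 0"
    and g: "g \<in> M" "f g = 1" and M: "M \<subseteq> carrier G"
    and z: "z \<in> center G" "z [^] p = \<one>" "z \<noteq> \<one>"
  defines "t \<equiv> (\<lambda>(j::int, b::'a, d). (b, \<lambda>a\<in>carrier G. d a \<otimes> (z [^] j) [^] f a))"
  shows "inj_on t ({0..<int p} \<times> commuting_pairs M)"
    and "t ` ({0..<int p} \<times> commuting_pairs M) \<subseteq> commuting_pairs {x \<in> M. f x = 0}"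
    and "(b, d) \<in> t ` ({0..<int p} \<times> commuting_pairs M) \<Longrightarrow> b = \<one> \<Longrightarrow> d g \<in> range (\<lambda>j::int. z [^] j)"
proof -
  have zc: "z \<in> carrier G" using center_carrier z by blast
  have gc: "g \<in> carrier G" using g M by auto
  \<comment> \<open>As \<open>g\<close> lies in \<open>M\<close>, the first component of a commuting
    pair determines \<open>d g\<close>. Hence the exponent \<open>j\<close> can be read off the
    value of the twisted derivation at \<open>g\<close>.\<close>
  have cp: "d g = inv (b \<otimes> g) \<otimes> (g \<otimes> b)" "d \<in> Der" "b \<in> B" if "(b, d) \<in> commuting_pairs M" for b d
  proof -
    have bd: "b \<in> B" "d \<in> Der" "b \<otimes> g \<otimes> d g = g \<otimes> b" using that g by (auto simp: commuting_pairs_def)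
    then show "d g = inv (b \<otimes> g) \<otimes> (g \<otimes> b)" "d \<in> Der" "b \<in> B"
      using gc DerD(2)[OF bd(2) gc] B.mem_carrier[OF bd(1)] by (simp_all add: inv_solve_left)
  qed
  have tg: "(\<lambda>a\<in>carrier G. d a \<otimes> (z [^] j) [^] f a) g = d g \<otimes> z [^] j" for d and j :: int
    using gc g zc by simp
  show "inj_on t ({0..<int p} \<times> commuting_pairs M)"
  proof (rule inj_onI)
    fix u v assume u: "u \<in> {0..<int p} \<times> commuting_pairs M" and v: "v \<in> {0..<int p} \<times> commuting_pairs M"
      and uv: "t u = t v"
    obtain i b d where u': "u = (i, b, d)" "i \<in> {0..<int p}" "(b, d) \<in> commuting_pairs M" using u by (cases u) auto
    obtain j c e where v': "v = (j, c, e)" "j \<in> {0..<int p}" "(c, e) \<in> commuting_pairs M" using v by (cases v) auto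
    note u'' = cp[OF u'(3)] and v'' = cp[OF v'(3)]
    have bc: "b = c" and eq: "(\<lambda>a\<in>carrier G. d a \<otimes> (z [^] i) [^] f a) = (\<lambda>a\<in>carrier G. e a \<otimes> (z [^] j) [^] f a)"
      using uv by (simp_all add: t_def u'(1) v'(1))
    have "d g \<otimes> z [^] i = e g \<otimes> z [^] j" using arg_cong[OF eq, of "\<lambda>h. h g"] by (simp only: tg)
    moreover have "d g = e g" using u''(1) v''(1) bc by simp
    ultimately have "z [^] i = z [^] j" using DerD(2)[OF v''(2) gc] zc by simp
    then have "z [^] (i - j) = \<one>" using zc by (simp add: int_pow_diff)
    then have "int p dvd i - j" using pow_eq_one_cancel[OF zc z(2,3)] by blast
    then have ij: "i = j" using u'(2) v'(2)
      by (metis atLeastLessThan_iff mod_eq_dvd_iff mod_pos_pos_trivial)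
    have "d = e"
    proof (rule extensionalityI[OF DerD(4)[OF u''(2)] DerD(4)[OF v''(2)]])
      fix a assume a: "a \<in> carrier G"
      have "d a \<otimes> (z [^] i) [^] f a = e a \<otimes> (z [^] i) [^] f a"
        using arg_cong[OF eq, of "\<lambda>h. h a"] a ij by simp
      then show "d a = e a" using a DerD(2)[OF u''(2) a] DerD(2)[OF v''(2) a] zc by simp
    qed
    then show "u = v" using u'(1) v'(1) bc ij by simp
  qed
  show "t ` ({0..<int p} \<times> commuting_pairs M) \<subseteq> commuting_pairs {x \<in> M. f x = 0}"
  proof
    fix w assume "w \<in> t ` ({0..<int p} \<times> commuting_pairs M)"
    then obtain j b d where w: "w = t (j, b, d)" "(b, d) \<in> commuting_pairs M" by auto
    note bd = cp[OF w(2)]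
    have zj: "z [^] j \<in> center G" "(z [^] j) [^] p = \<one>"
    proof -
      show "z [^] j \<in> center G" using center_pow[OF z(1)] .
      have "(z [^] j) [^] int p = (z [^] int p) [^] j" using zc by (simp only: int_pow_pow mult.commute)
      then show "(z [^] j) [^] p = \<one>" using z(2) by (simp add: int_pow_int)
    qed
    have e: "(\<lambda>a\<in>carrier G. (z [^] j) [^] f a) \<in> Der" using central_hom_Der[OF f fB zj] .
    have "(\<lambda>a\<in>carrier G. d a \<otimes> (\<lambda>a\<in>carrier G. (z [^] j) [^] f a) a) \<in> Der" using Der_mult[OF bd(2) e] .
    also have "(\<lambda>a\<in>carrier G. d a \<otimes> (\<lambda>a\<in>carrier G. (z [^] j) [^] f a) a) = (\<lambda>a\<in>carrier G. d a \<otimes> (z [^] j) [^] f a)"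
      by (rule restrict_ext) simp
    finally have D: "(\<lambda>a\<in>carrier G. d a \<otimes> (z [^] j) [^] f a) \<in> Der" .
    have "b \<otimes> x \<otimes> (d x \<otimes> (z [^] j) [^] f x) = x \<otimes> b" if "x \<in> M" "f x = 0" for x
      using that w(2) M DerD(2)[OF bd(2)] by (auto simp: commuting_pairs_def subset_iff)
    then show "w \<in> commuting_pairs {x \<in> M. f x = 0}"
      using D bd(3) M by (auto simp: w(1) t_def commuting_pairs_def subset_iff)
  qed
  \<comment> \<open>For \<open>b = \<one>\<close> the derivation before twisting is trivial at
    \<open>g\<close>, so only the twisting power of \<open>z\<close> remains there.\<close>
  assume "(b, d) \<in> t ` ({0..<int p} \<times> commuting_pairs M)" and b1: "b = \<one>"
  then obtain j c e where jce: "(b, d) = t (j, c, e)" "(c, e) \<in> commuting_pairs M" by auto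
  then have je: "d = (\<lambda>a\<in>carrier G. e a \<otimes> (z [^] j) [^] f a)" "(\<one>, e) \<in> commuting_pairs M"
    using b1 by (simp_all add: t_def)
  have "e g = \<one>" using cp(1)[OF je(2)] gc by simp
  then have "d g = z [^] j" using tg[of e j] je(1) zc by simp
  then show "d g \<in> range (\<lambda>j::int. z [^] j)" by blast
qed

end

text \<open>For every \<open>g\<close> outside \<open>B\<close> the assumption supplies a pair
  \<open>(\<one>, d)\<close> that no twist by powers of \<open>z\<close> can produce; this missing
  pair makes the counting inequality strict. Both \<open>z\<close> and \<open>d\<close> may depend
  on \<open>g\<close>.\<close>

locale moving_extension = abelian_over_center +
  assumes moved: "g \<in> carrier G \<Longrightarrow> g \<notin> B \<Longrightarrow>
    \<exists>z\<in>center G. z \<noteq> \<one> \<and> z [^] p = \<one> \<and> (\<exists>d\<in>derivations G B. d g \<notin> range (\<lambda>j::int. z [^] j))"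
begin

text \<open>Passing from \<open>M\<close> to the kernel K in \<open>M\<close> of a homomorphism
  \<open>f\<close> that kills \<open>B\<close> divides the order by at most \<open>p\<close>, while
  twisting shows that the number of commuting pairs grows at least by the factor \<open>p\<close>.
  So the product does not decrease on the way down to \<open>B\<close>, and in the last step, where
  K is \<open>B\<close>, the pair \<open>(\<one>, e)\<close> is missed by the twists.\<close>

lemma card_commuting_pairs_less:
  assumes "subgroup M G" "B \<subset> M"
  shows "card M * card (commuting_pairs M) < card B * card (B \<times> Der)"
  using assms
proof (induction "card M" arbitrary: M rule: less_induct)
  case less
  have M: "M \<subseteq> carrier G" using less.prems subgroup.subset by blast
  have finM: "finite M" using M finite_carrier finite_subset by blast
  obtain g where g: "g \<in> M" "g \<notin> B" using less.prems by blast
  have gc: "g \<in> carrier G" using g M by blast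
  obtain z e where z: "z \<in> center G" "z \<noteq> \<one>" "z [^] p = \<one>"
    and e: "e \<in> Der" "e g \<notin> range (\<lambda>j::int. z [^] j)" using moved[OF gc g(2)] by blast
  obtain f where f: "f \<in> hom G (integer_mod_group p)" "\<And>b. b \<in> B \<Longrightarrow> f b = 0" "f g = 1"
    using ex_hom_separating[OF subgroup_B center_B gc g(2)] by blast
  define t where "t = (\<lambda>(j::int, b::'a, d). (b, \<lambda>a\<in>carrier G. d a \<otimes> (z [^] j) [^] f a))"
  note tw = twist_commuting_pairs[OF f(1,2) g(1) f(3) M z(1,3,2), folded t_def]
  let ?K = "{x \<in> M. f x = 0}" and ?S = "{0..<int p} \<times> commuting_pairs M"
  interpret f: group_hom G "integer_mod_group p" f
    by (intro group_hom.intro group_hom_axioms.intro f(1) is_group group_integer_mod_group)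
  have K: "subgroup ?K G"
  proof -
    have "?K = M \<inter> kernel G (integer_mod_group p) f" using M by (auto simp: kernel_def)
    then show ?thesis using subgroup_Int[OF less.prems(1) f.subgroup_kernel] by simp
  qed
  have BK: "B \<subseteq> ?K" using less.prems f(2) by auto
  have cM: "card M \<le> p * card ?K" using card_le_hom_kernel[OF f(1) _ less.prems(1) finM] p_gt_1 by simp
  have cS: "card (t ` ?S) = p * card (commuting_pairs M)"
    using card_image[OF tw(1)] by (simp add: card_cartesian_product)
  show ?case
  proof (cases "?K = B")
    case True
    have "t ` ?S \<subseteq> B \<times> Der" using tw(2) True commuting_pairs_B by simp
    moreover have "(\<one>, e) \<notin> t ` ?S" using tw(3)[of \<one> e] e(2) by blast
    moreover have "(\<one>, e) \<in> B \<times> Der" using e(1) by simp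
    ultimately have "t ` ?S \<subset> B \<times> Der" by blast
    then have "card (t ` ?S) < card (B \<times> Der)"
      using finite_B finite_Der by (intro psubset_card_mono) auto
    then have lt: "p * card (commuting_pairs M) < card (B \<times> Der)" using cS by simp
    have "card B > 0" by (metis B.one_closed card_gt_0_iff empty_iff finite_B)
    have "card M * card (commuting_pairs M) \<le> (p * card B) * card (commuting_pairs M)"
      using cM True by (intro mult_le_mono1) simp
    also have "\<dots> = card B * (p * card (commuting_pairs M))" by simp
    also have "\<dots> < card B * card (B \<times> Der)" using lt \<open>card B > 0\<close> by (rule mult_strict_left_mono)
    finally show ?thesis .
  next
    case False
    have "g \<notin> ?K" using f(3) by simp
    then have "?K \<subset> M" using g(1) by auto
    then have "card ?K < card M" using finM by (rule psubset_card_mono[rotated])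
    then have IH: "card ?K * card (commuting_pairs ?K) < card B * card (B \<times> Der)"
      using less.hyps[OF _ K] BK False by auto
    have "card (t ` ?S) \<le> card (commuting_pairs ?K)"
      using tw(2) finite_commuting_pairs by (intro card_mono) auto
    then have le: "p * card (commuting_pairs M) \<le> card (commuting_pairs ?K)" using cS by simp
    have "card M * card (commuting_pairs M) \<le> (p * card ?K) * card (commuting_pairs M)"
      using cM by (rule mult_le_mono1)
    also have "\<dots> = card ?K * (p * card (commuting_pairs M))" by simp
    also have "\<dots> \<le> card ?K * card (commuting_pairs ?K)" using le by (rule mult_le_mono2)
    finally show ?thesis using IH by simp
  qed
qed

text \<open>A subgroup K above A = B \<times> Der has the form M \<times> Der, and the elements of A
  that centralize it are \<open>commuting_pairs M\<close>. Up to a factor |Der|, the criterion for a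
  one-element lattice is therefore the inequality just counted.\<close>

lemma CD_Q: "carrier (CD Q) = {B \<times> Der}"
proof -
  interpret Q: group Q by (rule group_Q)
  have sA: "B \<times> Der \<subseteq> carrier Q" by (auto simp: carrier_Q)
  have iff: "(b, d) \<otimes>\<^bsub>Q\<^esub> (x, e) = (x, e) \<otimes>\<^bsub>Q\<^esub> (b, d) \<longleftrightarrow> b \<otimes> x \<otimes> d x = x \<otimes> b"
    if "b \<in> B" "d \<in> Der" "x \<in> carrier G" "e \<in> Der" for b d x e
  proof -
    have "(\<lambda>a\<in>carrier G. d a \<otimes> e a) = (\<lambda>a\<in>carrier G. e a \<otimes> d a)"
      by (rule restrict_ext) (use that DerD(1) abelian_B in blast)
    then show ?thesis using that DerD(3)[OF that(4,1)] by (simp add: mult_Q)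
  qed
  have ab: "B \<times> Der \<subseteq> centralizer Q (B \<times> Der)"
    using iff abelian_B by (auto simp: centralizer_def carrier_Q DerD)
  have S: "subgroup (B \<times> Der) Q"
  proof (rule Q.subgroupI)
    show "B \<times> Der \<subseteq> carrier Q" by fact
    show "B \<times> Der \<noteq> {}" by (metis B.one_closed Der_one SigmaI empty_iff)
  next
    fix u assume u: "u \<in> B \<times> Der"
    let ?v = "inv\<^bsub>Q\<^esub> u"
    have v: "?v \<in> carrier Q" using u sA by blast
    obtain b d x e where bd: "u = (b, d)" "?v = (x, e)" "b \<in> B" "d \<in> Der" "x \<in> carrier G" "e \<in> Der"
      using u v by (cases u, cases ?v) (auto simp: carrier_Q)
    have "?v \<otimes>\<^bsub>Q\<^esub> u = \<one>\<^bsub>Q\<^esub>" using u sA by (intro Q.l_inv) blast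
    then have "(x, e) \<otimes>\<^bsub>Q\<^esub> (b, d) = (\<one>, \<lambda>a\<in>carrier G. \<one>)" unfolding bd(2) unfolding bd(1) one_Q .
    then have "x \<otimes> b \<otimes> e b = \<one>" by (simp add: mult_Q)
    then have "x \<otimes> b = \<one>" using bd DerD(3)[OF bd(6,3)] by simp
    then have "x = inv b" using bd by (simp add: inv_equality)
    then show "?v \<in> B \<times> Der" unfolding bd(2) using bd by simp
  next
    fix u v assume "u \<in> B \<times> Der" "v \<in> B \<times> Der"
    then show "u \<otimes>\<^bsub>Q\<^esub> v \<in> B \<times> Der" by (auto simp: mult_Q Der_mult DerD)
  qed
  have N: "B \<times> Der \<lhd> Q"
  proof -
    have "u \<otimes>\<^bsub>Q\<^esub> w \<otimes>\<^bsub>Q\<^esub> inv\<^bsub>Q\<^esub> u \<in> B \<times> Der" if u: "u \<in> carrier Q" and w: "w \<in> B \<times> Der" for u w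
    proof -
      let ?v = "inv\<^bsub>Q\<^esub> u"
      have v: "?v \<in> carrier Q" using u by blast
      obtain y d z e where ud: "u = (y, d)" "?v = (z, e)" "y \<in> carrier G" "z \<in> carrier G" "d \<in> Der" "e \<in> Der"
        using u v by (cases u, cases ?v) (auto simp: carrier_Q)
      obtain b c where bc: "w = (b, c)" "b \<in> B" "c \<in> Der" using w by blast
      have "u \<otimes>\<^bsub>Q\<^esub> ?v = \<one>\<^bsub>Q\<^esub>" using u by (rule Q.r_inv)
      then have "(y, d) \<otimes>\<^bsub>Q\<^esub> (z, e) = (\<one>, \<lambda>a\<in>carrier G. \<one>)" unfolding ud(2) unfolding ud(1) one_Q .
      then have yz: "y \<otimes> z \<otimes> d z = \<one>" by (simp add: mult_Q)
      have dz: "d z \<in> carrier G" "c z \<in> B" using ud bc DerD by auto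
      have "y \<otimes> (z \<otimes> d z) = \<one>" using yz ud dz by (simp add: m_assoc)
      then have y: "y = inv (z \<otimes> d z)" using ud dz by (intro inv_equality[symmetric]) auto
      have "y \<otimes> b \<otimes> d b \<otimes> z \<otimes> (d z \<otimes> c z) = (y \<otimes> b \<otimes> (z \<otimes> d z)) \<otimes> c z"
        using ud bc dz DerD(3)[OF ud(5) bc(2)] by (simp add: m_assoc)
      moreover have "y \<otimes> b \<otimes> (z \<otimes> d z) \<in> B" unfolding y by (rule conj_B) (use ud dz bc in simp_all)
      ultimately have "fst ((y, d) \<otimes>\<^bsub>Q\<^esub> (b, c) \<otimes>\<^bsub>Q\<^esub> (z, e)) \<in> B" using dz ud by (simp add: mult_Q)
      then have "fst (u \<otimes>\<^bsub>Q\<^esub> w \<otimes>\<^bsub>Q\<^esub> ?v) \<in> B" unfolding ud(2) bc(1) unfolding ud(1) .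
      moreover have "u \<otimes>\<^bsub>Q\<^esub> w \<otimes>\<^bsub>Q\<^esub> ?v \<in> carrier Q" using u v w sA by (intro Q.m_closed) auto
      ultimately show ?thesis unfolding carrier_Q mem_Times_iff by blast
    qed
    then show ?thesis using S Q.normal_inv_iff by blast
  qed
  have "card K * card ((B \<times> Der) \<inter> centralizer Q K) < card (B \<times> Der) * card (B \<times> Der)"
    if K: "subgroup K Q" and AK: "B \<times> Der \<subset> K" for K
  proof -
    let ?f = "\<lambda>x. (x, \<lambda>a\<in>carrier G. \<one>)"
    define M where "M = {x \<in> carrier G. ?f x \<in> K}"
    have f: "?f \<in> hom G Q" using normal_embedding_Q by (simp add: normal_embedding_def mon_def)
    interpret f: group_hom G Q ?f using f by unfold_locales
    have oneK: "(\<one>, d) \<in> K" if "d \<in> Der" for d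
      using subsetD[OF psubset_imp_subset[OF AK], of "(\<one>, d)"] that by simp
    have inM: "x \<in> M" if xd: "(x, d) \<in> K" for x d
    proof -
      have c: "x \<in> carrier G" "d \<in> Der" using subgroup.subset[OF K] xd by (auto simp: carrier_Q)
      obtain e where e: "e \<in> Der" "\<And>x. x \<in> carrier G \<Longrightarrow> e x = inv (d x)" using Der_inv[OF c(2)] by blast
      have "(\<one>, e) \<in> K" using oneK e(1) .
      then have "(x, d) \<otimes>\<^bsub>Q\<^esub> (\<one>, e) \<in> K" using xd subgroup.m_closed[OF K] by blast
      moreover have "(\<lambda>a\<in>carrier G. d a \<otimes> e a) = (\<lambda>a\<in>carrier G. \<one>)"
        by (rule restrict_ext) (simp add: e(2) DerD(2)[OF c(2)])
      then have "(x, d) \<otimes>\<^bsub>Q\<^esub> (\<one>, e) = ?f x" using c DerD(3)[OF c(2) B.one_closed] by (simp add: mult_Q)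
      ultimately show ?thesis using c by (simp add: M_def)
    qed
    have inK: "(x, d) \<in> K" if x: "x \<in> M" and d: "d \<in> Der" for x d
    proof -
      have "(\<one>, d) \<in> K" using oneK d .
      then have "?f x \<otimes>\<^bsub>Q\<^esub> (\<one>, d) \<in> K" using x subgroup.m_closed[OF K] by (auto simp: M_def)
      moreover have "(\<lambda>a\<in>carrier G. (\<lambda>a\<in>carrier G. \<one>) a \<otimes> d a) = d"
        by (rule extensionalityI[OF _ DerD(4)[OF d]]) (simp_all add: DerD(2)[OF d])
      then have "?f x \<otimes>\<^bsub>Q\<^esub> (\<one>, d) = (x, d)" using x by (simp add: mult_Q M_def)
      ultimately show ?thesis by simp
    qed
    have KM: "K = M \<times> Der" using inM inK subgroup.subset[OF K] by (auto simp: carrier_Q)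
    have M: "subgroup M G"
    proof (rule subgroupI)
      show "M \<noteq> {}" using inM[OF oneK[OF Der_one]] by blast
    next
      fix a assume "a \<in> M"
      then show "inv a \<in> M" using subgroup.m_inv_closed[OF K, of "?f a"] f.hom_inv[of a] by (simp add: M_def)
    next
      fix a b assume "a \<in> M" "b \<in> M"
      then show "a \<otimes> b \<in> M" using subgroup.m_closed[OF K, of "?f a" "?f b"] f.hom_mult[of a b] by (simp add: M_def)
    qed (auto simp: M_def)
    have "B \<subset> M" using AK KM by auto
    then have lt: "card M * card (commuting_pairs M) < card B * card (B \<times> Der)"
      using card_commuting_pairs_less[OF M] by blast
    have Mc: "M \<subseteq> carrier G" by (auto simp: M_def)
    have "(B \<times> Der) \<inter> centralizer Q K = commuting_pairs M"
    proof -
      have "w \<in> (B \<times> Der) \<inter> centralizer Q K \<longleftrightarrow> w \<in> commuting_pairs M" for w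
      proof (cases "w \<in> B \<times> Der")
        case True
        then obtain b d where w: "w = (b, d)" "b \<in> B" "d \<in> Der" by blast
        have "w \<in> centralizer Q K \<longleftrightarrow> (\<forall>x\<in>M. \<forall>e\<in>Der. (b, d) \<otimes>\<^bsub>Q\<^esub> (x, e) = (x, e) \<otimes>\<^bsub>Q\<^esub> (b, d))"
          using w by (auto simp: centralizer_def KM carrier_Q)
        also have "\<dots> \<longleftrightarrow> (\<forall>x\<in>M. \<forall>e\<in>Der. b \<otimes> x \<otimes> d x = x \<otimes> b)"
          using iff[OF w(2,3)] Mc by blast
        also have "\<dots> \<longleftrightarrow> (\<forall>x\<in>M. b \<otimes> x \<otimes> d x = x \<otimes> b)" using Der_one by blast
        finally show ?thesis using w by (simp add: commuting_pairs_def)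
      qed (auto simp: commuting_pairs_def)
      then show ?thesis by blast
    qed
    then have "card K * card ((B \<times> Der) \<inter> centralizer Q K) = card Der * (card M * card (commuting_pairs M))"
      by (simp add: KM card_cartesian_product)
    also have "\<dots> < card Der * (card B * card (B \<times> Der))"
    proof (rule mult_strict_left_mono[OF lt])
      show "0 < card Der" by (metis Der_one card_gt_0_iff empty_iff finite_Der)
    qed
    also have "\<dots> = card (B \<times> Der) * card (B \<times> Der)" by (simp add: card_cartesian_product)
    finally show ?thesis .
  qed
  then show ?thesis using Q.CD_eq_singletonI[OF finite_Q N ab] by blast
qed

end

section \<open>Lifting transvections\<close>

lemma (in group) mult_pow_comm:
  assumes a: "a \<in> carrier G" and b: "b \<in> carrier G" and c: "c \<in> carrier G"
    and ca: "c \<otimes> a = a \<otimes> c" and cb: "c \<otimes> b = b \<otimes> c" and ba: "b \<otimes> a = a \<otimes> b \<otimes> c"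
  shows "b [^] (n::nat) \<otimes> a = a \<otimes> b [^] n \<otimes> c [^] n"
proof (induction n)
  case (Suc n)
  have bc: "c [^] n \<otimes> b = b \<otimes> c [^] n" using group_commutes_pow[OF cb c b] .
  have "b [^] Suc n \<otimes> a = b [^] n \<otimes> (b \<otimes> a)" using a b by (simp add: m_assoc)
  also have "\<dots> = (b [^] n \<otimes> a) \<otimes> b \<otimes> c" using a b c ba by (simp add: m_assoc)
  also have "\<dots> = a \<otimes> b [^] n \<otimes> (c [^] n \<otimes> b) \<otimes> c" using Suc a b c by (simp add: m_assoc)
  also have "\<dots> = a \<otimes> b [^] Suc n \<otimes> c [^] Suc n" using a b c by (simp add: bc m_assoc)
  finally show ?case .
qed (use a in simp)

text \<open>Collecting the \<open>n\<close> copies of \<open>a\<close> on the left takes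
  \<open>n choose 2\<close> swaps of a \<open>b\<close> past an \<open>a\<close>, each of which
  leaves one factor \<open>c\<close>.\<close>

lemma (in group) mult_pow_class2:
  assumes a: "a \<in> carrier G" and b: "b \<in> carrier G" and c: "c \<in> carrier G"
    and ca: "c \<otimes> a = a \<otimes> c" and cb: "c \<otimes> b = b \<otimes> c" and ba: "b \<otimes> a = a \<otimes> b \<otimes> c"
  shows "(a \<otimes> b) [^] (n::nat) = a [^] n \<otimes> b [^] n \<otimes> c [^] (n choose 2)"
proof (induction n)
  case (Suc n)
  let ?m = "n choose 2"
  have c1: "c [^] ?m \<otimes> a = a \<otimes> c [^] ?m" using group_commutes_pow[OF ca c a] .
  have c2: "c [^] ?m \<otimes> b = b \<otimes> c [^] ?m" using group_commutes_pow[OF cb c b] .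
  have c3: "c [^] n \<otimes> b = b \<otimes> c [^] n" using group_commutes_pow[OF cb c b] .
  have "(a \<otimes> b) [^] Suc n = a [^] n \<otimes> b [^] n \<otimes> (c [^] ?m \<otimes> a) \<otimes> b"
    using Suc a b c by (simp add: m_assoc)
  also have "\<dots> = a [^] n \<otimes> (b [^] n \<otimes> a) \<otimes> (c [^] ?m \<otimes> b)" using a b c by (simp only: c1 m_assoc nat_pow_closed m_closed)
  also have "\<dots> = a [^] n \<otimes> (a \<otimes> b [^] n \<otimes> c [^] n) \<otimes> (b \<otimes> c [^] ?m)"
    by (simp only: mult_pow_comm[OF a b c ca cb ba] c2)
  also have "\<dots> = a [^] n \<otimes> a \<otimes> b [^] n \<otimes> (c [^] n \<otimes> b) \<otimes> c [^] ?m"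
    using a b c by (simp only: m_assoc nat_pow_closed m_closed)
  also have "\<dots> = (a [^] n \<otimes> a) \<otimes> (b [^] n \<otimes> b) \<otimes> (c [^] n \<otimes> c [^] ?m)"
    using a b c by (simp only: c3 m_assoc nat_pow_closed m_closed)
  also have "c [^] n \<otimes> c [^] ?m = c [^] (Suc n choose 2)"
    using c by (simp add: nat_pow_mult numeral_2_eq_2)
  finally show ?case by simp
qed (simp add: numeral_2_eq_2)

lemma choose_2_add: "(i + j) choose 2 = (i choose 2) + (j choose 2) + i * j"
  by (induction j) (simp_all add: numeral_2_eq_2 algebra_simps)

context frattini_central_group
begin

text \<open>Moving \<open>p\<close> copies of \<open>y\<close> past \<open>x\<close> leaves
  \<open>c [^] p\<close>, but \<open>y [^] p\<close> is central and leaves nothing.\<close>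

lemma central_commutator_pow:
  assumes "x \<in> carrier G" "y \<in> carrier G" "c \<in> center G" "y \<otimes> x = x \<otimes> y \<otimes> c"
  shows "c [^] p = \<one>"
proof -
  note c = center_carrier[OF assms(3)]
  have yp: "y [^] p \<in> center G" using pow_center[OF assms(2)] .
  have "y [^] p \<otimes> x = x \<otimes> y [^] p \<otimes> c [^] p"
    using mult_pow_comm[OF assms(1,2) c] center_commutes[OF assms(3)] assms by blast
  then have "x \<otimes> y [^] p = x \<otimes> y [^] p \<otimes> c [^] p" using center_commutes[OF yp assms(1)] by simp
  moreover have xy: "x \<otimes> y [^] p \<in> carrier G" using assms by simp
  ultimately show ?thesis using l_cancel_one'[OF xy, of "c [^] p"] c by simp
qed

lemma pow_inverse_mod:
  assumes x: "x \<in> carrier G" "x [^] p = \<one>" and i: "\<not> int p dvd i"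
  obtains u :: int where "(x [^] i) [^] u = x"
proof -
  have "coprime (int p) i" using i prime_p by (intro prime_imp_coprime) auto
  then obtain v u where uv: "v * int p + u * i = 1" using bezout_int coprime_iff_gcd_eq_1 by metis
  have "x = x [^] (v * int p + u * i)" using uv x by simp
  also have "\<dots> = (x [^] int p) [^] v \<otimes> (x [^] i) [^] u" using int_pow_lin_comb[OF x(1)] by simp
  also have "\<dots> = (x [^] i) [^] u" using x by (simp add: int_pow_int)
  finally have "x = (x [^] i) [^] u" .
  then show ?thesis by (rule that[OF sym])
qed

text \<open>A finite abelian \<open>p\<close>-group with at most one subgroup of order
  \<open>p\<close> is cyclic, so its elements are comparable under being a power of each other. Only
  this comparability is proved, by induction on the exponent.\<close>

lemma center_power_chain:
  assumes w: "w \<in> center G"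
    and uniq: "\<And>z. z \<in> center G \<Longrightarrow> z [^] p = \<one> \<Longrightarrow> z \<in> range (\<lambda>j::int. w [^] j)"
    and wp: "w [^] p = \<one>"
    and x: "x \<in> center G" and y: "y \<in> center G"
  shows "x \<in> range (\<lambda>j::int. y [^] j) \<or> y \<in> range (\<lambda>j::int. x [^] j)"
proof -
  note cc = center_carrier
  have ppow: "z [^] (p ^ k) = \<one>" if "z \<in> carrier G" for z
    using pow_order_eq_1[OF that] order_G by simp
  have wgen: "w \<in> range (\<lambda>j::int. y [^] j)" if y: "y \<in> center G" "y \<noteq> \<one>" for y
  proof -
    have yc: "y \<in> carrier G" using cc y by blast
    define n where "n = (LEAST n. y [^] (p ^ n) = \<one>)"
    have n: "y [^] (p ^ n) = \<one>" unfolding n_def using ppow[OF yc] by (rule LeastI)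
    have "n \<noteq> 0" using n y yc by (metis nat_pow_eone power_0)
    then obtain m where m: "n = Suc m" using not0_implies_Suc by blast
    let ?v = "y [^] (p ^ m)"
    have v1: "?v \<noteq> \<one>" using not_less_Least[of m "\<lambda>n. y [^] (p ^ n) = \<one>"] m unfolding n_def by auto
    have vp: "?v [^] p = \<one>" using n m yc by (simp add: nat_pow_pow mult.commute)
    have vc: "?v \<in> center G" using center_pow[OF y(1), of "int (p ^ m)"] by (simp only: int_pow_int)
    obtain i :: int where i: "?v = w [^] i" using uniq[OF vc vp] by blast
    have ni: "\<not> int p dvd i"
    proof
      assume "int p dvd i"
      then obtain l where "i = int p * l" by (auto elim: dvdE)
      then have "?v = (w [^] int p) [^] l" using i cc[OF w] by (simp add: int_pow_pow)
      then show False using v1 wp by (simp add: int_pow_int)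
    qed
    obtain u :: int where "(w [^] i) [^] u = w" by (rule pow_inverse_mod[OF cc[OF w] wp ni])
    then have "w = (y [^] int (p ^ m)) [^] u" using i by (simp only: int_pow_int)
    also have "\<dots> = y [^] (int (p ^ m) * u)" using int_pow_pow[OF yc] .
    finally show ?thesis by blast
  qed
  \<comment> \<open>The condition on \<open>y\<close> says that its order is at least p^a, while the
    order of \<open>x\<close> divides p^a.\<close>
  have main: "x \<in> range (\<lambda>j::int. y [^] j)"
    if "x \<in> center G" "y \<in> center G" "x [^] (p ^ a) = \<one>" "a = 0 \<or> y [^] (p ^ (a - 1)) \<noteq> \<one>" for a x y
    using that
  proof (induction a arbitrary: x y)
    case 0
    then have "x = y [^] (0::int)" using cc by simp
    then show ?case by blast
  next
    case (Suc a)
    note xc = cc[OF Suc.prems(1)] and yc = cc[OF Suc.prems(2)]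
    have y1: "y \<noteq> \<one>" using Suc.prems(4) by auto
    have "(x [^] p) [^] (p ^ a) = \<one>" using Suc.prems(3) xc by (simp add: nat_pow_pow)
    moreover have "a = 0 \<or> (y [^] p) [^] (p ^ (a - 1)) \<noteq> \<one>"
      using Suc.prems(4) yc by (cases a) (simp_all add: nat_pow_pow)
    moreover have "x [^] p \<in> center G" "y [^] p \<in> center G" using pow_center xc yc by auto
    ultimately have "x [^] p \<in> range (\<lambda>j::int. (y [^] p) [^] j)" using Suc.IH by blast
    then obtain j :: int where j: "x [^] p = (y [^] p) [^] j" by blast
    \<comment> \<open>Dividing \<open>x\<close> by a power of \<open>y\<close> makes the
      \<open>p\<close>-th power trivial. The result is a power of \<open>w\<close>, and
      \<open>w\<close> is itself a power of \<open>y\<close>.\<close>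
    let ?t = "x \<otimes> y [^] (- j)"
    have yj: "y [^] (- j) \<in> center G" using center_pow[OF Suc.prems(2)] .
    have t: "?t \<in> center G" using subgroup.m_closed[OF subgroup_center Suc.prems(1) yj] .
    have "?t [^] int p = x [^] int p \<otimes> (y [^] (- j)) [^] int p"
      using int_pow_mult_distrib[OF center_commutes[OF Suc.prems(1)]] xc yc by simp
    also have "x [^] int p = (y [^] int p) [^] j" using j by (simp only: int_pow_int)
    also have "(y [^] int p) [^] j \<otimes> (y [^] (- j)) [^] int p = \<one>"
      using int_pow_lin_comb[OF yc, of "int p" j "- j" "int p"] by simp
    finally have "?t [^] p = \<one>" by (simp only: int_pow_int)
    then obtain i :: int where i: "?t = w [^] i" using uniq[OF t] by blast
    obtain l :: int where l: "w = y [^] l" using wgen[OF Suc.prems(2) y1] by blast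
    have "x = ?t \<otimes> y [^] j" using xc yc by (simp add: int_pow_neg m_assoc)
    also have "\<dots> = (y [^] l) [^] i \<otimes> (y [^] j) [^] (1::int)" using i l yc by simp
    also have "\<dots> = y [^] (i * l + 1 * j)" using int_pow_lin_comb[OF yc] .
    finally show ?case by blast
  qed
  define a where "a = (LEAST n. x [^] (p ^ n) = \<one>)"
  define b where "b = (LEAST n. y [^] (p ^ n) = \<one>)"
  have a: "x [^] (p ^ a) = \<one>" "\<And>n. n < a \<Longrightarrow> x [^] (p ^ n) \<noteq> \<one>"
    unfolding a_def using LeastI[of "\<lambda>n. x [^] (p ^ n) = \<one>", OF ppow[OF cc[OF x]]] not_less_Least by blast+
  have b: "y [^] (p ^ b) = \<one>" "\<And>n. n < b \<Longrightarrow> y [^] (p ^ n) \<noteq> \<one>"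
    unfolding b_def using LeastI[of "\<lambda>n. y [^] (p ^ n) = \<one>", OF ppow[OF cc[OF y]]] not_less_Least by blast+
  show ?thesis
  proof (cases "a \<le> b")
    case True
    then have "a = 0 \<or> y [^] (p ^ (a - 1)) \<noteq> \<one>" using b(2)[of "a - 1"] by linarith
    then show ?thesis using main[OF x y a(1)] by blast
  next
    case False
    then have "b = 0 \<or> x [^] (p ^ (b - 1)) \<noteq> \<one>" using a(2)[of "b - 1"] by linarith
    then show ?thesis using main[OF y x b(1)] by blast
  qed
qed

end

text \<open>The condition under which the transvection in direction \<open>e\<close> of the symplectic space
  \<open>G / center G\<close> lifts to an automorphism of \<open>G\<close>.\<close>

definition (in frattini_central_group) liftable :: "'a \<Rightarrow> 'a \<Rightarrow> bool" where
  "liftable w e \<longleftrightarrow> e \<in> carrier G \<and> e [^] p = w [^] (p choose 2)"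

section \<open>Transvections when the center has a unique subgroup of order p\<close>

locale unique_central_p = frattini_central_group +
  fixes w
  assumes w_center: "w \<in> center G" and w_pow: "w [^] p = \<one>" and w_ne: "w \<noteq> \<one>"
    and w_unique: "z \<in> center G \<Longrightarrow> z [^] p = \<one> \<Longrightarrow> z \<in> range (\<lambda>j::int. w [^] j)"
begin

lemma w_carrier: "w \<in> carrier G" using w_center center_carrier by blast

text \<open>Taking \<open>u = y \<otimes> x [^] (- r)\<close> cancels the \<open>p\<close>-th powers
  up to a commutator \<open>c\<close>, leaving \<open>u [^] p = c [^] (p choose 2)\<close>. For odd
  \<open>p\<close> the binomial coefficient is a multiple of \<open>p\<close>, so this power and
  that of \<open>w\<close> are both trivial. For \<open>p = 2\<close> liftable means having square
  \<open>w\<close>; if \<open>u\<close> fails, then either a product of \<open>u\<close> with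
  \<open>x\<close> or with a central element works, or \<open>x\<close> itself up to a central
  factor.\<close>

lemma ex_liftable:
  assumes H: "subgroup H G" "center G \<subseteq> H" and x: "x \<in> H" and y: "y \<in> H"
    and xy: "x \<otimes> y \<noteq> y \<otimes> x" and r: "y [^] p = (x [^] p) [^] (r::int)"
  obtains u where "u \<in> H" "liftable w u" "u \<otimes> x \<noteq> x \<otimes> u \<or> u \<otimes> y \<noteq> y \<otimes> u"
proof -
  note hc = subgroup.mem_carrier[OF H(1)] and cc = center_carrier
  have xc: "x \<in> carrier G" and yc: "y \<in> carrier G" using hc x y by auto
  let ?b = "x [^] (- r)"
  let ?u = "y \<otimes> ?b"
  have bH: "?b \<in> H" using subgroup_int_pow_closed[OF H(1) x] .
  have bc: "?b \<in> carrier G" using xc by simp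
  have uH: "?u \<in> H" using subgroup.m_closed[OF H(1) y bH] .
  have uc: "?u \<in> carrier G" using hc uH by blast
  have bx: "?b \<otimes> x = x \<otimes> ?b"
    using int_pow_mult[OF xc, of "- r" 1] int_pow_mult[OF xc, of 1 "- r"] xc by (simp add: add.commute)
  have ux: "?u \<otimes> x \<noteq> x \<otimes> ?u"
  proof
    assume "?u \<otimes> x = x \<otimes> ?u"
    then have "(y \<otimes> x) \<otimes> ?b = (x \<otimes> y) \<otimes> ?b" using xc yc bc bx by (simp add: m_assoc)
    then show False using xy xc yc bc by simp
  qed
  obtain c where c: "c \<in> center G" "?b \<otimes> y = y \<otimes> ?b \<otimes> c" using comm_center[OF yc bc] by blast
  have cp: "c [^] p = \<one>" using central_commutator_pow[OF yc bc c] .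
  obtain j :: int where j: "c = w [^] j" using w_unique[OF c(1) cp] by blast
  have "?b [^] p = (x [^] int p) [^] (- r)" using xc by (simp add: int_pow_int[symmetric] int_pow_pow mult.commute del: int_pow_int)
  then have bp: "?b [^] p = inv (y [^] p)" using r xc by (simp add: int_pow_int int_pow_neg)
  have "?u [^] p = y [^] p \<otimes> ?b [^] p \<otimes> c [^] (p choose 2)"
    using mult_pow_class2[OF yc bc cc[OF c(1)] center_commutes[OF c(1) yc] center_commutes[OF c(1) bc] c(2)] .
  then have up: "?u [^] p = c [^] (p choose 2)" using bp yc cc[OF c(1)] by simp
  show ?thesis
  proof (cases "p = 2")
    case False
    then have "odd p" using prime_p primes_dvd_imp_eq two_is_prime_nat by blast
    then obtain m where "p = 2 * m + 1" by (rule oddE)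
    then have "p * (p - 1) = 2 * (p * m)" by simp
    then have m: "p choose 2 = p * m" unfolding choose_two by (simp only:)
    have "z [^] (p choose 2) = \<one>" if "z \<in> carrier G" "z [^] p = \<one>" for z
      using that m nat_pow_pow[of z p m] by simp
    then have "liftable w ?u" using up cp w_pow w_carrier cc[OF c(1)] uc by (simp add: liftable_def)
    then show ?thesis using that uH ux by blast
  next
    case True
    have lift: "liftable w e \<longleftrightarrow> e \<in> carrier G \<and> e \<otimes> e = w" for e
      using w_carrier unfolding liftable_def by (auto simp: True numeral_2_eq_2)
    have ww: "w \<otimes> w = \<one>" using w_pow w_carrier by (simp add: True numeral_2_eq_2)
    have wpow: "z = \<one> \<or> z = w" if z: "z \<in> center G" "z \<otimes> z = \<one>" for z
    proof -
      have "z [^] p = \<one>" using z cc by (simp add: True numeral_2_eq_2)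
      then obtain i :: int where "z = w [^] i" using w_unique[OF z(1)] by blast
      then have "z = w [^] (i mod int p)" using pow_mod_int[OF w_carrier w_pow] by simp
      moreover have "i mod int p = 0 \<or> i mod int p = 1" using True by auto
      ultimately show ?thesis using w_carrier by auto
    qed
    have sq: "g \<otimes> g \<in> center G" if "g \<in> carrier G" for g
      using pow_center[OF that] that by (simp add: True numeral_2_eq_2)
    have cpow: "c \<otimes> c = \<one>" using cp cc[OF c(1)] by (simp add: True numeral_2_eq_2)
    have uu: "?u \<otimes> ?u = c" using up uc cc[OF c(1)] by (simp add: True numeral_2_eq_2)
    have pow2: "(a \<otimes> b) \<otimes> (a \<otimes> b) = (a \<otimes> a) \<otimes> (b \<otimes> b)" if "a \<in> carrier G" "b \<in> center G" for a b
    proof -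
      have "(a \<otimes> b) \<otimes> (a \<otimes> b) = a \<otimes> (b \<otimes> a) \<otimes> b" using that cc by (simp add: m_assoc)
      also have "\<dots> = a \<otimes> (a \<otimes> b) \<otimes> b" using center_commutes[OF that(2,1)] by simp
      also have "\<dots> = (a \<otimes> a) \<otimes> (b \<otimes> b)" using that cc by (simp add: m_assoc)
      finally show ?thesis .
    qed
    have commz: "a \<otimes> b \<otimes> d = d \<otimes> (a \<otimes> b) \<longleftrightarrow> a \<otimes> d = d \<otimes> a"
      if "a \<in> carrier G" "b \<in> center G" "d \<in> carrier G" for a b d
    proof -
      have "a \<otimes> b \<otimes> d = (a \<otimes> d) \<otimes> b" using that cc center_commutes[OF that(2,3)] by (simp add: m_assoc)
      moreover have "d \<otimes> (a \<otimes> b) = (d \<otimes> a) \<otimes> b" using that cc by (simp add: m_assoc)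
      ultimately show ?thesis using that cc by simp
    qed
    show ?thesis
    proof (cases "?u \<otimes> ?u = w")
      case True
      then have "liftable w ?u" using lift uc by blast
      then show ?thesis using that uH ux by blast
    next
      case False
      then have u1: "?u \<otimes> ?u = \<one>" using uu wpow[OF c(1) cpow] by simp
      show ?thesis
      proof (cases "\<exists>h\<in>center G. h \<otimes> h = w")
        case True
        then obtain h where h: "h \<in> center G" "h \<otimes> h = w" by blast
        let ?v = "?u \<otimes> h"
        have "?v \<otimes> ?v = w" using pow2[OF uc h(1)] u1 h w_carrier by simp
        then have "liftable w ?v" using lift uc cc[OF h(1)] by simp
        moreover have "?v \<in> H" using subgroup.m_closed[OF H(1) uH] H(2) h(1) by blast
        moreover have "?v \<otimes> x \<noteq> x \<otimes> ?v" using commz[OF uc h(1) xc] ux by blast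
        ultimately show ?thesis using that by blast
      next
        case nosq: False
        let ?s = "x \<otimes> x"
        have s: "?s \<in> center G" using sq[OF xc] .
        have sc: "?s \<in> carrier G" using xc by simp
        \<comment> \<open>Both \<open>x \<otimes> x\<close> and \<open>w\<close> lie in the center,
          where any two elements are comparable.\<close>
        consider (pow) i :: int where "?s = w [^] i" | (root) i :: int where "w = ?s [^] i"
          using center_power_chain[OF w_center w_unique w_pow s w_center] by blast
        then show ?thesis
        proof cases
          case pow
          have "?s \<otimes> ?s = \<one>"
          proof -
            have "?s \<otimes> ?s = (w \<otimes> w) [^] i"
              using pow w_carrier int_pow_mult_distrib[of w w i] by simp
            then show ?thesis using ww by simp
          qed
          then consider "?s = \<one>" | "?s = w" using wpow[OF s] by blast
          then show ?thesis
          proof cases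
            case 1
            \<comment> \<open>\<open>u\<close> and \<open>x\<close> are noncommuting involutions, so
              the square of their product is their commutator, a nontrivial central involution and
              therefore \<open>w\<close>.\<close>
            let ?v = "?u \<otimes> x"
            obtain d where d: "d \<in> center G" "x \<otimes> ?u = ?u \<otimes> x \<otimes> d" using comm_center[OF uc xc] by blast
            have dc: "d \<in> carrier G" using cc d by blast
            have "d [^] p = \<one>" using central_commutator_pow[OF uc xc d] .
            then have "d \<otimes> d = \<one>" using dc \<open>p = 2\<close> by (simp add: numeral_2_eq_2)
            moreover have "d \<noteq> \<one>" using d(2) ux uc xc by auto
            ultimately have "d = w" using wpow[OF d(1)] by blast
            have "?v \<otimes> ?v = ?u \<otimes> (x \<otimes> ?u) \<otimes> x" using uc xc by (simp only: m_assoc m_closed)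
            also have "\<dots> = ?u \<otimes> ?u \<otimes> (x \<otimes> d) \<otimes> x" unfolding d(2) using uc xc dc by (simp only: m_assoc m_closed)
            also have "x \<otimes> d = d \<otimes> x" using center_commutes[OF d(1) xc] by simp
            also have "?u \<otimes> ?u \<otimes> (d \<otimes> x) \<otimes> x = (?u \<otimes> ?u) \<otimes> d \<otimes> (x \<otimes> x)"
              using uc xc dc by (simp only: m_assoc m_closed)
            also have "\<dots> = w" using u1 1 \<open>d = w\<close> w_carrier by simp
            finally have "liftable w ?v" using lift uc xc by simp
            moreover have "?v \<in> H" using subgroup.m_closed[OF H(1) uH x] .
            moreover have "?v \<otimes> x \<noteq> x \<otimes> ?v"
            proof
              assume "?v \<otimes> x = x \<otimes> ?v"
              then have "(?u \<otimes> x) \<otimes> x = (x \<otimes> ?u) \<otimes> x" using uc xc by (simp only: m_assoc m_closed)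
              then have "?u \<otimes> x = x \<otimes> ?u" using uc xc by (metis m_closed right_cancel)
              then show False using ux by blast
            qed
            ultimately show ?thesis using that by blast
          next
            case 2
            then have "liftable w x" using lift xc by blast
            then show ?thesis using that x xy by metis
          qed
        next
          case root
          show ?thesis
          proof (cases "even i")
            case True
            then obtain l where l: "i = l + l" by (metis evenE mult_2)
            have "w = ?s [^] l \<otimes> ?s [^] l" using root int_pow_mult[OF sc, of l l] unfolding l by (rule trans)
            then show ?thesis using nosq center_pow[OF s] by metis
          next
            case False
            \<comment> \<open>An odd exponent lets the central factor \<open>?s [^] l\<close>
              correct the square of \<open>x\<close> from \<open>?s\<close> to \<open>w\<close>; an
              even one would have made \<open>w\<close> the square of a central element.\<close>
            then obtain l where l: "i = 1 + (l + l)" by (metis oddE mult_2 add.commute)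
            let ?h = "?s [^] l"
            let ?v = "x \<otimes> ?h"
            have h: "?h \<in> center G" using center_pow[OF s] .
            have "?s [^] (1 + (l + l)) = ?s \<otimes> (?h \<otimes> ?h)"
              by (simp only: int_pow_mult[OF sc] int_pow_1[OF sc])
            then have "w = ?s \<otimes> (?h \<otimes> ?h)" using root unfolding l by (simp only:)
            then have "liftable w ?v" using lift xc pow2[OF xc h] cc[OF h] by simp
            moreover have "?v \<in> H" using subgroup.m_closed[OF H(1) x] H(2) h by blast
            moreover have "?v \<otimes> y \<noteq> y \<otimes> ?v" using commz[OF xc h yc] xy by blast
            ultimately show ?thesis using that by blast
          qed
        qed
      qed
    qed
  qed
qed

text \<open>Modulo the center the automorphism is \<open>x \<mapsto> x \<otimes> e [^] i x\<close>,
  where \<open>i x\<close> is the exponent of \<open>w\<close> in the commutator of \<open>x\<close>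
  with \<open>e\<close>. The lift replaces \<open>e [^] i x\<close> by \<open>f (i x)\<close>, whose
  binomial correction makes the derivation law hold exactly.\<close>

lemma transvection:
  assumes e: "liftable w e" "e \<in> B" and B: "abelian_over_center G p k B"
    and Be: "\<And>b. b \<in> B \<Longrightarrow> b \<otimes> e = e \<otimes> b"
  obtains d where "d \<in> derivations G B"
    "\<And>g. g \<in> carrier G \<Longrightarrow> g \<otimes> e \<noteq> e \<otimes> g \<Longrightarrow> d g \<notin> range (\<lambda>j::int. w [^] j)"
proof -
  interpret B: abelian_over_center G p k B by fact
  note wc = w_carrier and cc = center_carrier
  have ec: "e \<in> carrier G" and ep: "e [^] p = w [^] (p choose 2)" using e by (auto simp: liftable_def)
  let ?v = "inv w"
  have vZ: "?v \<in> center G" using subgroup.m_inv_closed[OF subgroup_center w_center] .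
  have vc: "?v \<in> carrier G" using wc by simp
  have ex: "\<exists>i<p. x \<otimes> e = e \<otimes> x \<otimes> w [^] i" if x: "x \<in> carrier G" for x
  proof -
    obtain c where c: "c \<in> center G" "x \<otimes> e = e \<otimes> x \<otimes> c" using comm_center[OF ec x] by blast
    have "c [^] p = \<one>" using central_commutator_pow[OF ec x c] .
    then obtain j :: int where "c = w [^] j" using w_unique[OF c(1)] by blast
    then have "c = w [^] (j mod int p)" using pow_mod_int[OF wc w_pow] by simp
    also have "\<dots> = w [^] nat (j mod int p)"
      using p_gt_1 by (metis int_nat_eq int_pow_int pos_mod_sign of_nat_0_less_iff less_trans zero_less_one)
    finally have "c = w [^] nat (j mod int p)" .
    moreover have "nat (j mod int p) < p" using p_gt_1 by (simp add: nat_less_iff)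
    ultimately show ?thesis using c by blast
  qed
  define i where "i x = (SOME i. i < p \<and> x \<otimes> e = e \<otimes> x \<otimes> w [^] i)" for x
  have i: "i x < p" "x \<otimes> e = e \<otimes> x \<otimes> w [^] i x" if "x \<in> carrier G" for x
    using someI_ex[OF ex[OF that]] unfolding i_def by auto
  have uniq: "i x = j" if x: "x \<in> carrier G" and j: "j < p" "x \<otimes> e = e \<otimes> x \<otimes> w [^] j" for x j
  proof -
    have "e \<otimes> x \<otimes> w [^] i x = e \<otimes> x \<otimes> w [^] j" using i(2)[OF x] j by simp
    then have "w [^] i x = w [^] j" using ec x wc by simp
    then have "w [^] (int (i x) - int j) = \<one>" using wc by (simp add: int_pow_diff int_pow_int)
    then have "int p dvd int (i x) - int j" using pow_eq_one_cancel[OF wc w_pow w_ne] by blast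
    then have "int (i x) mod int p = int j mod int p" by (simp add: mod_eq_dvd_iff)
    then show ?thesis using i(1)[OF x] j by simp
  qed
  \<comment> \<open>Conjugating \<open>e [^] m\<close> by \<open>y\<close> yields a factor
    \<open>?v [^] (m * i y)\<close>. The exponent \<open>m choose 2\<close> produces the same cross
    term \<open>m * n\<close> in \<open>f (m + n)\<close>, because it is the difference between
    \<open>m + n\<close> and its parts under \<open>choose 2\<close>.\<close>
  define f where "f m = e [^] m \<otimes> ?v [^] (m choose 2)" for m :: nat
  have vcomm: "?v [^] (n::nat) \<otimes> y = y \<otimes> ?v [^] n" if "y \<in> carrier G" for y n
    using center_commutes[OF center_pow[OF vZ, of "int n"] that] by (simp only: int_pow_int)
  have fadd: "f (m + n) = f m \<otimes> f n \<otimes> ?v [^] (m * n)" for m n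
  proof -
    have "f (m + n) = e [^] m \<otimes> (e [^] n \<otimes> ?v [^] (m choose 2)) \<otimes> ?v [^] (n choose 2) \<otimes> ?v [^] (m * n)"
      unfolding f_def choose_2_add using ec vc by (simp add: nat_pow_mult[symmetric] m_assoc)
    also have "e [^] n \<otimes> ?v [^] (m choose 2) = ?v [^] (m choose 2) \<otimes> e [^] n" using vcomm[of "e [^] n"] ec by simp
    finally show ?thesis unfolding f_def using ec vc by (simp add: m_assoc)
  qed
  \<comment> \<open>Liftability of \<open>e\<close> is used here: \<open>f\<close> has period
    \<open>p\<close>, so it is compatible with \<open>i\<close> being additive only modulo
    \<open>p\<close>.\<close>
  have fp: "f p = \<one>"
    unfolding f_def ep using wc by (simp add: nat_pow_inv)
  have vp: "?v [^] p = \<one>" using w_pow wc by (simp add: nat_pow_inv)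
  have fmult: "f (p * n) = \<one>" for n
  proof (induction n)
    case 0
    then show ?case by (simp add: f_def numeral_2_eq_2)
  next
    case (Suc n)
    have "?v [^] (p * (p * n)) = \<one>" using vp vc nat_pow_pow[of ?v p "p * n"] by simp
    then show ?case using fadd[of p "p * n"] Suc fp by simp
  qed
  have fmod: "f (n mod p) = f n" for n
  proof -
    have "?v [^] (p * (n div p) * (n mod p)) = \<one>"
      using vp vc nat_pow_pow[of ?v p "(n div p) * (n mod p)"] by (simp add: mult.assoc)
    then have "f (p * (n div p) + n mod p) = f (n mod p)"
      using fadd[of "p * (n div p)" "n mod p"] fmult ec vc by (simp add: f_def)
    then show ?thesis by simp
  qed
  have iadd: "i (x \<otimes> y) = (i x + i y) mod p" if xy: "x \<in> carrier G" "y \<in> carrier G" for x y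
  proof (rule uniq)
    have wy: "w [^] i x \<otimes> y = y \<otimes> w [^] i x"
      using center_commutes[OF center_pow[OF w_center, of "int (i x)"] xy(2)] by (simp only: int_pow_int)
    have "x \<otimes> y \<otimes> e = x \<otimes> (y \<otimes> e)" using xy ec by (simp add: m_assoc)
    also have "\<dots> = (x \<otimes> e) \<otimes> y \<otimes> w [^] i y" using i(2)[OF xy(2)] xy ec wc by (simp add: m_assoc)
    also have "\<dots> = e \<otimes> x \<otimes> (w [^] i x \<otimes> y) \<otimes> w [^] i y" unfolding i(2)[OF xy(1)] using xy ec wc by (simp add: m_assoc)
    also have "\<dots> = e \<otimes> (x \<otimes> y) \<otimes> w [^] (i x + i y)"
      unfolding wy using xy ec wc by (simp add: m_assoc nat_pow_mult[symmetric])
    also have "w [^] (i x + i y) = w [^] ((i x + i y) mod p)"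
      using pow_mod_int[OF wc w_pow, of "int (i x + i y)"] by (simp only: int_pow_int of_nat_mod[symmetric])
    finally show "x \<otimes> y \<otimes> e = e \<otimes> (x \<otimes> y) \<otimes> w [^] ((i x + i y) mod p)" .
  qed (use xy p_gt_1 in auto)
  define d where "d = (\<lambda>x\<in>carrier G. f (i x))"
  have vB: "?v [^] (n::nat) \<in> B" for n
    using center_pow[OF vZ, of "int n"] B.center_B by (auto simp only: int_pow_int)
  have fB: "f n \<in> B" for n
  proof -
    have "e [^] int n \<in> B" using subgroup_int_pow_closed[OF B.subgroup_B e(2)] .
    then show ?thesis unfolding f_def using vB subgroup.m_closed[OF B.subgroup_B] by (simp only: int_pow_int)
  qed
  have fconj: "inv y \<otimes> f n \<otimes> y = f n \<otimes> ?v [^] (n * i y)" if y: "y \<in> carrier G" for y n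
  proof -
    have wy: "w [^] i y \<in> center G" using center_pow[OF w_center, of "int (i y)"] by (simp only: int_pow_int)
    have vy: "?v [^] i y \<in> center G" using center_pow[OF vZ, of "int (i y)"] by (simp only: int_pow_int)
    have ey: "e \<otimes> y = y \<otimes> e \<otimes> ?v [^] i y"
    proof -
      have "y \<otimes> e \<otimes> ?v [^] i y = e \<otimes> y \<otimes> (w [^] i y \<otimes> ?v [^] i y)"
        unfolding i(2)[OF y] using y ec wc by (simp add: m_assoc)
      also have "w [^] i y \<otimes> ?v [^] i y = \<one>" using wc by (simp add: nat_pow_inv)
      finally show ?thesis using ec y by simp
    qed
    have "e [^] n \<otimes> y = y \<otimes> e [^] n \<otimes> (?v [^] i y) [^] n"
      using mult_pow_comm[OF y ec _ center_commutes[OF vy y] center_commutes[OF vy ec] ey] vc by simp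
    then have eny: "e [^] n \<otimes> y = y \<otimes> (e [^] n \<otimes> ?v [^] (n * i y))"
      using y ec vc by (simp add: nat_pow_pow m_assoc mult.commute)
    have "inv y \<otimes> f n \<otimes> y = inv y \<otimes> (e [^] n \<otimes> (?v [^] (n choose 2) \<otimes> y))"
      unfolding f_def using y ec vc by (simp add: m_assoc)
    also have "\<dots> = inv y \<otimes> (e [^] n \<otimes> y) \<otimes> ?v [^] (n choose 2)"
      unfolding vcomm[OF y] using y ec vc by (simp add: m_assoc)
    also have "\<dots> = e [^] n \<otimes> (?v [^] (n * i y) \<otimes> ?v [^] (n choose 2))"
      unfolding eny using y ec vc by (simp add: m_assoc[symmetric])
    also have "?v [^] (n * i y) \<otimes> ?v [^] (n choose 2) = ?v [^] (n choose 2) \<otimes> ?v [^] (n * i y)"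
      using vcomm[of "?v [^] (n choose 2)"] vc by simp
    finally show ?thesis unfolding f_def using ec vc by (simp add: m_assoc)
  qed
  have "d \<in> derivations G B"
  proof -
    have "d b = \<one>" if b: "b \<in> B" for b
    proof -
      have bc: "b \<in> carrier G" using b by simp
      have "i b = 0" using uniq[OF bc, of 0] Be[OF b] p_gt_1 ec bc by simp
      then show ?thesis using bc ec by (simp add: d_def f_def numeral_2_eq_2)
    qed
    moreover have "d (x \<otimes> y) = inv y \<otimes> d x \<otimes> y \<otimes> d y" if xy: "x \<in> carrier G" "y \<in> carrier G" for x y
    proof -
      have c: "f (i x) \<in> carrier G" "f (i y) \<in> carrier G" using ec vc by (simp_all add: f_def)
      have "d (x \<otimes> y) = f (i x + i y)" using xy by (simp add: d_def iadd fmod)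
      also have "\<dots> = f (i x) \<otimes> (f (i y) \<otimes> ?v [^] (i x * i y))" unfolding fadd using c vc by (simp add: m_assoc)
      also have "f (i y) \<otimes> ?v [^] (i x * i y) = ?v [^] (i x * i y) \<otimes> f (i y)" using vcomm[OF c(2)] by simp
      also have "f (i x) \<otimes> (?v [^] (i x * i y) \<otimes> f (i y)) = inv y \<otimes> f (i x) \<otimes> y \<otimes> f (i y)"
        unfolding fconj[OF xy(2)] using c vc by (simp add: m_assoc)
      finally show ?thesis using xy by (simp add: d_def)
    qed
    ultimately show ?thesis using fB by (auto simp: derivations_def d_def)
  qed
  \<comment> \<open>A value in the powers of \<open>w\<close> would make \<open>e [^] i g\<close>
    central. As \<open>p\<close> does not divide \<open>i g\<close>, then \<open>e\<close> itself
    would be central, although it does not commute with \<open>g\<close>.\<close>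
  moreover have "d g \<notin> range (\<lambda>j::int. w [^] j)" if g: "g \<in> carrier G" "g \<otimes> e \<noteq> e \<otimes> g" for g
  proof
    assume "d g \<in> range (\<lambda>j::int. w [^] j)"
    then obtain j :: int where j: "f (i g) = w [^] j" using g by (auto simp: d_def)
    have wj: "w [^] j \<otimes> w [^] (i g choose 2) \<in> center G"
      using center_pow[OF w_center, of j] center_pow[OF w_center, of "int (i g choose 2)"]
        subgroup.m_closed[OF subgroup_center] by (simp only: int_pow_int)
    have "f (i g) \<otimes> w [^] (i g choose 2) = e [^] i g \<otimes> (?v [^] (i g choose 2) \<otimes> w [^] (i g choose 2))"
      unfolding f_def using ec wc by (simp add: m_assoc)
    also have "\<dots> = e [^] i g" using ec wc by (simp add: nat_pow_inv)
    finally have "e [^] i g \<in> center G" using j wj by simp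
    then have "e [^] int (i g) \<in> center G" by (simp only: int_pow_int)
    moreover have "i g \<noteq> 0"
    proof
      assume "i g = 0"
      then show False using i(2)[OF g(1)] g ec by simp
    qed
    then have "\<not> int p dvd int (i g)" using i(1)[OF g(1)] by (auto dest: dvd_imp_le)
    ultimately have "e \<in> center G" using mem_of_pow_mem[OF subgroup_center _ ec] by blast
    then show False using center_commutes[OF _ g(1)] g(2) by metis
  qed
  ultimately show ?thesis using that by blast
qed

text \<open>\<open>B\<close> is the centralizer of a maximal set \<open>E\<close> of pairwise
  commuting liftable elements. If \<open>B\<close> were not abelian, it would contain a liftable
  element not central in \<open>B\<close>; by maximality that element lies in \<open>E\<close>,
  which \<open>B\<close> centralizes. An element outside \<open>B\<close> fails to commute with some
  \<open>e \<in> E\<close> and is moved by the transvection for \<open>e\<close>.\<close>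

lemma ex_moving_extension_unique: "\<exists>B. moving_extension G p k B"
proof -
  let ?F = "{E. E \<subseteq> {e. liftable w e} \<and> (\<forall>a\<in>E. \<forall>b\<in>E. a \<otimes> b = b \<otimes> a)}"
  have "?F \<subseteq> Pow (carrier G)" by (auto simp: liftable_def)
  then have "finite ?F" using finite_carrier finite_subset by blast
  moreover have "{} \<in> ?F" by simp
  ultimately have "\<exists>E\<in>?F. \<forall>E'\<in>?F. E \<subseteq> E' \<longrightarrow> E = E'" by (intro finite_has_maximal) auto
  then obtain E where E: "E \<in> ?F" "\<forall>E'\<in>?F. E \<subseteq> E' \<longrightarrow> E = E'" by (rule bexE)
  have El: "liftable w e" if "e \<in> E" for e using E(1) that by blast
  have Ec: "E \<subseteq> carrier G" using El by (auto simp: liftable_def)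
  have Eab: "a \<otimes> b = b \<otimes> a" if "a \<in> E" "b \<in> E" for a b using E(1) that by blast
  define B where "B = centralizer G E"
  have sB: "subgroup B G" unfolding B_def using subgroup_centralizer[OF Ec] .
  have ZB: "center G \<subseteq> B" unfolding B_def center_def using centralizer_antimono[OF Ec] .
  have EB: "E \<subseteq> B" unfolding B_def centralizer_def using Ec Eab by auto
  have BE: "b \<otimes> e = e \<otimes> b" if "b \<in> B" "e \<in> E" for b e using that by (simp add: B_def centralizer_def)
  have inE: "u \<in> E" if u: "u \<in> B" "liftable w u" for u
  proof -
    have "insert u E \<in> ?F" using u El Eab BE by auto
    then have "E = insert u E" using E(2) by (metis (no_types, lifting) subset_insertI)
    then show ?thesis by blast
  qed
  have ab: "a \<otimes> b = b \<otimes> a" if ab: "a \<in> B" "b \<in> B" for a b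
  proof (rule ccontr)
    assume ne: "a \<otimes> b \<noteq> b \<otimes> a"
    have "a \<in> carrier G" "b \<in> carrier G" using ab subgroup.mem_carrier[OF sB] by auto
    then have pc: "a [^] p \<in> center G" "b [^] p \<in> center G" using pow_center by auto
    obtain u where u: "u \<in> B" "liftable w u" "u \<otimes> a \<noteq> a \<otimes> u \<or> u \<otimes> b \<noteq> b \<otimes> u"
    proof (cases "b [^] p \<in> range (\<lambda>j::int. (a [^] p) [^] j)")
      case True
      then obtain j :: int where "b [^] p = (a [^] p) [^] j" by blast
      from ex_liftable[OF sB ZB ab ne this] that show ?thesis by blast
    next
      case False
      then obtain j :: int where "a [^] p = (b [^] p) [^] j"
        using center_power_chain[OF w_center w_unique w_pow pc] by blast
      from ex_liftable[OF sB ZB ab(2,1) ne[symmetric] this] that show ?thesis by blast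
    qed
    have "u \<in> E" using inE u by blast
    then show False using BE[of a u] BE[of b u] ab u(3) by metis
  qed
  interpret B: abelian_over_center G p k B
    by (intro abelian_over_center.intro abelian_over_center_axioms.intro frattini_central_group_axioms) (fact sB ZB ab)+
  have "moving_extension G p k B"
  proof (rule moving_extension.intro[OF B.abelian_over_center_axioms], rule moving_extension_axioms.intro)
    fix g assume g: "g \<in> carrier G" "g \<notin> B"
    then obtain e where e: "e \<in> E" "g \<otimes> e \<noteq> e \<otimes> g" unfolding B_def centralizer_def by blast
    have eB: "e \<in> B" using EB e(1) by (rule subsetD)
    have Be: "b \<otimes> e = e \<otimes> b" if "b \<in> B" for b using BE[OF that e(1)] .
    obtain d where d: "d \<in> derivations G B"
      "\<And>g. g \<in> carrier G \<Longrightarrow> g \<otimes> e \<noteq> e \<otimes> g \<Longrightarrow> d g \<notin> range (\<lambda>j::int. w [^] j)"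
      using transvection[OF El[OF e(1)] eB B.abelian_over_center_axioms Be] by blast
    then show "\<exists>z\<in>center G. z \<noteq> \<one> \<and> z [^] p = \<one> \<and> (\<exists>d\<in>derivations G B. d g \<notin> range (\<lambda>j::int. z [^] j))"
      using d(1) d(2)[OF g(1) e(2)] w_center w_pow w_ne by blast
  qed
  then show ?thesis by blast
qed

end

lemma (in frattini_central_group) ex_moving_extension: "\<exists>B. moving_extension G p k B"
proof (cases "\<exists>w\<in>center G. w [^] p = \<one> \<and> w \<noteq> \<one> \<and>
    (\<forall>z\<in>center G. z [^] p = \<one> \<longrightarrow> z \<in> range (\<lambda>j::int. w [^] j))")
  case True
  then obtain w where "w \<in> center G" "w [^] p = \<one>" "w \<noteq> \<one>"
    "\<And>z. z \<in> center G \<Longrightarrow> z [^] p = \<one> \<Longrightarrow> z \<in> range (\<lambda>j::int. w [^] j)" by blast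
  then interpret unique_central_p G p k w by unfold_locales
  show ?thesis by (rule ex_moving_extension_unique)
next
  case False
  have ab: "a \<otimes> b = b \<otimes> a" if "a \<in> center G" "b \<in> center G" for a b
    using center_commutes[OF that(1) center_carrier[OF that(2)]] .
  interpret B: abelian_over_center G p k "center G"
    by (intro abelian_over_center.intro abelian_over_center_axioms.intro frattini_central_group_axioms)
      (fact subgroup_center subset_refl ab)+
  have "moving_extension G p k (center G)"
  proof (rule moving_extension.intro[OF B.abelian_over_center_axioms], rule moving_extension_axioms.intro)
    fix g assume g: "g \<in> carrier G" "g \<notin> center G"
    then obtain h where "h \<in> carrier G" "g \<otimes> h \<noteq> h \<otimes> g" unfolding center_def centralizer_def by blast
    then have h: "h \<in> carrier G" "h \<otimes> g \<noteq> g \<otimes> h" by auto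
    obtain c where c: "c \<in> center G" "h \<otimes> g = g \<otimes> h \<otimes> c" using comm_center[OF g(1) h(1)] by blast
    have cp: "c [^] p = \<one>" using central_commutator_pow[OF g(1) h(1) c] .
    have c1: "c \<noteq> \<one>" using c(2) h g by auto
    \<comment> \<open>The nontrivial commutator \<open>c\<close> of \<open>g\<close> has order
      \<open>p\<close>, so by the case assumption some central \<open>z\<close> of order
      \<open>p\<close> is independent of it. A central automorphism moves \<open>g\<close> by
      \<open>z\<close>, outside the powers of \<open>c\<close>; thus \<open>c\<close> plays the part
      of the \<open>z\<close> in the locale assumption.\<close>
    obtain z where z: "z \<in> center G" "z [^] p = \<one>" "z \<notin> range (\<lambda>j::int. c [^] j)"
      using False c(1) cp c1 by blast
    obtain f where f: "f \<in> hom G (integer_mod_group p)" "\<And>b. b \<in> center G \<Longrightarrow> f b = 0" "f g = 1"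
      using ex_hom_separating[OF subgroup_center subset_refl g] by blast
    have d: "(\<lambda>x\<in>carrier G. z [^] f x) \<in> derivations G (center G)" by (rule B.central_hom_Der[OF f(1,2) z(1,2)])
    have dg: "(\<lambda>x\<in>carrier G. z [^] f x) g = z" using g f(3) center_carrier[OF z(1)] by simp
    have "\<exists>d\<in>derivations G (center G). d g \<notin> range (\<lambda>j::int. c [^] j)"
      by (rule bexI[OF _ d]) (simp only: dg z(3) not_False_eq_True)
    then show "\<exists>z\<in>center G. z \<noteq> \<one> \<and> z [^] p = \<one> \<and>
        (\<exists>d\<in>derivations G (center G). d g \<notin> range (\<lambda>j::int. z [^] j))"
      using c(1) cp c1 by blast
  qed
  then show ?thesis by blast
qed

section \<open>The extension with a prescribed 3-string\<close>

text \<open>The central extension of \<open>G\<close> by Z_p^S with the bilinear cocycle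
  \<open>l s x * r s y\<close> in coordinate \<open>s\<close>. Bilinearity gives the cocycle
  identity, and commutators are read off by antisymmetrizing.\<close>

definition cocycle_extension ::
    "('a, 'b) monoid_scheme \<Rightarrow> 'i set \<Rightarrow> nat \<Rightarrow> ('i \<Rightarrow> 'a \<Rightarrow> int) \<Rightarrow> ('i \<Rightarrow> 'a \<Rightarrow> int) \<Rightarrow> ('a \<times> ('i \<Rightarrow> int)) monoid"
  where "cocycle_extension G S p l r =
     \<lparr>carrier = carrier G \<times> (\<Pi>\<^sub>E s\<in>S. {0..<int p}),
      monoid.mult = (\<lambda>(x, v) (y, w). (x \<otimes>\<^bsub>G\<^esub> y, \<lambda>s\<in>S. (v s + w s + l s x * r s y) mod int p)),
      one = (\<one>\<^bsub>G\<^esub>, \<lambda>s\<in>S. 0)\<rparr>"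

lemma mod_add_mult_mod:
  fixes q :: int
  shows "(x mod q + c + (y mod q) * z) mod q = (x + c + y * z) mod q"
proof -
  have "x mod q + c + (y mod q) * z = (x + c + y * z) + q * - (x div q + (y div q) * z)"
    by (simp add: minus_mult_div_eq_mod[symmetric] algebra_simps)
  then show ?thesis by (simp only: mod_mult_self2)
qed

lemma group_cocycle_extension:
  assumes G: "group G" and p: "p > 0"
    and l: "\<And>s. s \<in> S \<Longrightarrow> l s \<in> hom G (integer_mod_group p)"
    and r: "\<And>s. s \<in> S \<Longrightarrow> r s \<in> hom G (integer_mod_group p)"
  shows "group (cocycle_extension G S p l r)"
proof -
  interpret G: group G by fact
  let ?T = "cocycle_extension G S p l r"
  have lm: "l s (x \<otimes>\<^bsub>G\<^esub> y) = (l s x + l s y) mod int p" if "s \<in> S" "x \<in> carrier G" "y \<in> carrier G" for s x y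
    using hom_mult[OF l[OF that(1)] that(2,3)] by simp
  have rm: "r s (x \<otimes>\<^bsub>G\<^esub> y) = (r s x + r s y) mod int p" if "s \<in> S" "x \<in> carrier G" "y \<in> carrier G" for s x y
    using hom_mult[OF r[OF that(1)] that(2,3)] by simp
  have l1: "l s \<one>\<^bsub>G\<^esub> = 0" if "s \<in> S" for s using hom_one[OF l[OF that] G] by simp
  show ?thesis
  proof (rule groupI)
    fix u v assume "u \<in> carrier ?T" "v \<in> carrier ?T"
    then show "u \<otimes>\<^bsub>?T\<^esub> v \<in> carrier ?T" using p by (auto simp: cocycle_extension_def)
  next
    show "\<one>\<^bsub>?T\<^esub> \<in> carrier ?T" using p by (auto simp: cocycle_extension_def)
  next
    fix t u v assume "t \<in> carrier ?T" "u \<in> carrier ?T" "v \<in> carrier ?T"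
    then obtain x a y b z c where tuv: "t = (x, a)" "u = (y, b)" "v = (z, c)"
      and xyz: "x \<in> carrier G" "y \<in> carrier G" "z \<in> carrier G"
      by (auto simp: cocycle_extension_def)
    have "((a s + b s + l s x * r s y) mod int p + c s + l s (x \<otimes>\<^bsub>G\<^esub> y) * r s z) mod int p =
        (a s + (b s + c s + l s y * r s z) mod int p + l s x * r s (y \<otimes>\<^bsub>G\<^esub> z)) mod int p"
      if s: "s \<in> S" for s
    proof -
      have "((a s + b s + l s x * r s y) mod int p + c s + ((l s x + l s y) mod int p) * r s z) mod int p
          = (a s + b s + l s x * r s y + c s + (l s x + l s y) * r s z) mod int p"
        by (rule mod_add_mult_mod)
      also have "\<dots> = ((b s + c s + l s y * r s z) + a s + (r s y + r s z) * l s x) mod int p"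
        by (simp add: algebra_simps)
      also have "\<dots> = ((b s + c s + l s y * r s z) mod int p + a s + ((r s y + r s z) mod int p) * l s x) mod int p"
        by (rule mod_add_mult_mod[symmetric])
      also have "\<dots> = (a s + (b s + c s + l s y * r s z) mod int p + l s x * ((r s y + r s z) mod int p)) mod int p"
        by (simp only: add.commute mult.commute)
      finally show ?thesis using lm[OF s xyz(1,2)] rm[OF s xyz(2,3)] by simp
    qed
    then show "t \<otimes>\<^bsub>?T\<^esub> u \<otimes>\<^bsub>?T\<^esub> v = t \<otimes>\<^bsub>?T\<^esub> (u \<otimes>\<^bsub>?T\<^esub> v)"
      using xyz unfolding tuv cocycle_extension_def by (auto simp: G.m_assoc intro!: restrict_ext)
  next
    fix t assume "t \<in> carrier ?T"
    then obtain x a where t: "t = (x, a)" "x \<in> carrier G" "a \<in> (\<Pi>\<^sub>E s\<in>S. {0..<int p})"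
      by (auto simp: cocycle_extension_def)
    have "(\<lambda>s\<in>S. ((\<lambda>s\<in>S. 0) s + a s + l s \<one>\<^bsub>G\<^esub> * r s x) mod int p) = a"
    proof (rule extensionalityI[of _ S])
      show "a \<in> extensional S" using t(3) by (simp add: PiE_iff)
      fix s assume "s \<in> S"
      then show "(\<lambda>s\<in>S. ((\<lambda>s\<in>S. 0) s + a s + l s \<one>\<^bsub>G\<^esub> * r s x) mod int p) s = a s"
        using PiE_mem[OF t(3)] l1 by simp
    qed simp
    then show "\<one>\<^bsub>?T\<^esub> \<otimes>\<^bsub>?T\<^esub> t = t" using t by (simp add: cocycle_extension_def)
    let ?b = "\<lambda>s\<in>S. (- a s - l s (inv\<^bsub>G\<^esub> x) * r s x) mod int p"
    have "((- a s - l s (inv\<^bsub>G\<^esub> x) * r s x) mod int p + a s + l s (inv\<^bsub>G\<^esub> x) * r s x) mod int p = 0" for s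
    proof -
      have "((- a s - l s (inv\<^bsub>G\<^esub> x) * r s x) mod int p + (a s + l s (inv\<^bsub>G\<^esub> x) * r s x)) mod int p
        = ((- a s - l s (inv\<^bsub>G\<^esub> x) * r s x) + (a s + l s (inv\<^bsub>G\<^esub> x) * r s x)) mod int p"
        by (rule mod_add_left_eq)
      then show ?thesis by (simp add: add.assoc)
    qed
    then have "(\<lambda>s\<in>S. (?b s + a s + l s (inv\<^bsub>G\<^esub> x) * r s x) mod int p) = (\<lambda>s\<in>S. 0)"
      by (intro restrict_ext) simp
    then have "(inv\<^bsub>G\<^esub> x, ?b) \<otimes>\<^bsub>?T\<^esub> t = \<one>\<^bsub>?T\<^esub>" using t by (simp add: cocycle_extension_def)
    moreover have "(inv\<^bsub>G\<^esub> x, ?b) \<in> carrier ?T" using t p by (simp add: cocycle_extension_def)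
    ultimately show "\<exists>u\<in>carrier ?T. u \<otimes>\<^bsub>?T\<^esub> t = \<one>\<^bsub>?T\<^esub>" by blast
  qed
qed

lemma cocycle_extension_commute_iff:
  assumes "group G"
  shows "(x, v) \<otimes>\<^bsub>cocycle_extension G S p l r\<^esub> (y, w) = (y, w) \<otimes>\<^bsub>cocycle_extension G S p l r\<^esub> (x, v) \<longleftrightarrow>
    x \<otimes>\<^bsub>G\<^esub> y = y \<otimes>\<^bsub>G\<^esub> x \<and> (\<forall>s\<in>S. int p dvd l s x * r s y - l s y * r s x)"
proof -
  have "(v s + w s + l s x * r s y) mod int p = (w s + v s + l s y * r s x) mod int p \<longleftrightarrow>
      int p dvd l s x * r s y - l s y * r s x" for s
    by (simp add: mod_eq_dvd_iff algebra_simps)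
  then show ?thesis unfolding cocycle_extension_def by (auto simp: restrict_def fun_eq_iff)
qed

text \<open>Names of the kernel coordinates, one for each pair of linear functions whose commutator
  is to be free: \<open>On_base i f\<close> pairs coordinate \<open>i\<close> of \<open>X\<close>
  with a form \<open>f\<close> on \<open>G\<close>, \<open>On_dual i j\<close> pairs it with
  coordinate \<open>j\<close> of the same block of \<open>Y\<close>, and \<open>On_self i j\<close>
  pairs coordinates \<open>i\<close> and \<open>j\<close> of \<open>X\<close>.\<close>

datatype 'a form = On_base "nat \<times> nat" "'a \<Rightarrow> int" | On_dual "nat \<times> nat" nat | On_self "nat \<times> nat" "nat \<times> nat"

text \<open>The group \<open>T\<close> is a class 2 extension of \<open>G \<times> X \<times> Y\<close>, where \<open>X\<close> and \<open>Y\<close> consist of \<open>m\<close> blocks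
  \<open>Z\<^sub>p\<^sup>n\<close>. The commutator form pairs \<open>X\<close> freely with \<open>G / center G\<close> and with itself, and each block of \<open>X\<close>
  freely with the corresponding block of \<open>Y\<close>.\<close>

locale string_extension = frattini_central_group +
  fixes m n :: nat
  assumes n_ge_2: "n \<ge> 2" and carrier_in_CD: "carrier G \<in> carrier (CD G)"
begin

abbreviation "Ix \<equiv> {..<m} \<times> {..<n}"

abbreviation "X \<equiv> product_group Ix (\<lambda>_. integer_mod_group p)"

text \<open>The dual space of \<open>G / center G\<close>, kept extensional so that it is a finite
  set.\<close>

definition "linear_forms = {f \<in> carrier G \<rightarrow>\<^sub>E {0..<int p}. f \<in> hom G (integer_mod_group p) \<and> (\<forall>z\<in>center G. f z = 0)}"

definition "forms = (\<lambda>(i, f). On_base i f) ` (Ix \<times> linear_forms) \<union>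
  (\<lambda>(i, j). On_dual i j) ` (Ix \<times> {..<n}) \<union> (\<lambda>(i, j). On_self i j) ` (Ix \<times> Ix)"

abbreviation "base \<equiv> G \<times>\<times> (X \<times>\<times> X)"

fun lpart :: "'a form \<Rightarrow> 'a \<times> (nat \<times> nat \<Rightarrow> int) \<times> (nat \<times> nat \<Rightarrow> int) \<Rightarrow> int" where
  "lpart (On_base i f) (x, a, b) = a i"
| "lpart (On_dual i j) (x, a, b) = a i"
| "lpart (On_self i j) (x, a, b) = a i"

fun rpart :: "'a form \<Rightarrow> 'a \<times> (nat \<times> nat \<Rightarrow> int) \<times> (nat \<times> nat \<Rightarrow> int) \<Rightarrow> int" where
  "rpart (On_base i f) (x, a, b) = f x"
| "rpart (On_dual i j) (x, a, b) = b (fst i, j)"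
| "rpart (On_self i j) (x, a, b) = a j"

abbreviation "T \<equiv> cocycle_extension base forms p lpart rpart"

abbreviation "W \<equiv> \<Pi>\<^sub>E s\<in>forms. {0..<int p}"

lemma finite_linear_forms: "finite linear_forms"
proof (rule finite_subset)
  show "linear_forms \<subseteq> carrier G \<rightarrow>\<^sub>E {0..<int p}" unfolding linear_forms_def by blast
qed (use finite_carrier in \<open>simp add: finite_PiE\<close>)

lemma finite_forms: "finite forms" using finite_linear_forms by (simp add: forms_def)

lemma finite_W: "finite W" using finite_forms by (simp add: finite_PiE)

lemma carrier_Zp [simp]: "carrier (integer_mod_group p) = {0..<int p}"
  using p_gt_1 by (simp add: carrier_integer_mod_group)

lemma carrier_X: "carrier X = (\<Pi>\<^sub>E i\<in>Ix. {0..<int p})"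
  by simp

lemma group_base: "group base"
  by (intro DirProd_group is_group) simp_all

lemma carrier_T: "carrier T = (carrier G \<times> (carrier X \<times> carrier X)) \<times> W"
  by (simp add: cocycle_extension_def)

lemma part_hom:
  assumes "s \<in> forms"
  shows "lpart s \<in> hom base (integer_mod_group p)" "rpart s \<in> hom base (integer_mod_group p)"
proof -
  have Xi: "(\<lambda>(x, a, b). a i) \<in> hom base (integer_mod_group p)" "(\<lambda>(x, a, b). b i) \<in> hom base (integer_mod_group p)"
    if "i \<in> Ix" for i
    using that by (auto simp: hom_def)
  have G: "(\<lambda>(x, a, b). f x) \<in> hom base (integer_mod_group p)" if "f \<in> linear_forms" for f
    using that by (auto simp: hom_def linear_forms_def)
  consider (b) i f where "s = On_base i f" "i \<in> Ix" "f \<in> linear_forms"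
    | (d) i j where "s = On_dual i j" "i \<in> Ix" "(fst i, j) \<in> Ix"
    | (s) i j where "s = On_self i j" "i \<in> Ix" "j \<in> Ix"
    using assms by (auto simp: forms_def)
  then show "lpart s \<in> hom base (integer_mod_group p)" "rpart s \<in> hom base (integer_mod_group p)"
  proof (atomize (full), cases)
    case b
    have "lpart s = (\<lambda>(x, a, b). a i)" "rpart s = (\<lambda>(x, a, b). f x)" using b by auto
    then show "lpart s \<in> hom base (integer_mod_group p) \<and> rpart s \<in> hom base (integer_mod_group p)"
      using Xi G b by simp
  next
    case d
    have "lpart s = (\<lambda>(x, a, b). a i)" "rpart s = (\<lambda>(x, a, b). b (fst i, j))" using d by auto
    then show "lpart s \<in> hom base (integer_mod_group p) \<and> rpart s \<in> hom base (integer_mod_group p)"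
      using Xi d by simp
  next
    case s
    have "lpart s = (\<lambda>(x, a, b). a i)" "rpart s = (\<lambda>(x, a, b). a j)" using s by auto
    then show "lpart s \<in> hom base (integer_mod_group p) \<and> rpart s \<in> hom base (integer_mod_group p)"
      using Xi s by simp
  qed
qed

lemma group_T: "group T"
  using group_cocycle_extension[OF group_base _ part_hom] p_gt_1 by simp

lemma mult_T: "((x, a, b), v) \<otimes>\<^bsub>T\<^esub> ((y, c, d), w) =
    ((x \<otimes> y, \<lambda>i\<in>Ix. (a i + c i) mod int p, \<lambda>i\<in>Ix. (b i + d i) mod int p),
     \<lambda>s\<in>forms. (v s + w s + lpart s (x, a, b) * rpart s (y, c, d)) mod int p)"
  by (simp add: cocycle_extension_def)

lemma finite_T: "finite (carrier T)"
  using finite_carrier finite_W by (simp add: carrier_T carrier_X finite_PiE)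

lemma card_X: "card (carrier X) = p ^ (m * n)"
  by (simp add: carrier_X card_PiE card_cartesian_product)

lemma p_group_T: "p_group p T"
proof -
  have "order T = p ^ (k + (m * n + m * n) + card forms)"
    using order_G finite_forms card_X unfolding order_def carrier_T
    by (simp add: card_cartesian_product card_PiE power_add)
  then show ?thesis using group_T finite_T by (auto simp: p_group_def)
qed

lemma commute_T:
  "((x, a, b), v) \<otimes>\<^bsub>T\<^esub> ((y, c, d), w) = ((y, c, d), w) \<otimes>\<^bsub>T\<^esub> ((x, a, b), v) \<longleftrightarrow>
    (x \<otimes> y = y \<otimes> x \<and>
     (\<forall>i\<in>Ix. \<forall>f\<in>linear_forms. int p dvd a i * f y - c i * f x) \<and>
     (\<forall>i\<in>Ix. \<forall>j<n. int p dvd a i * d (fst i, j) - c i * b (fst i, j)) \<and>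
     (\<forall>i\<in>Ix. \<forall>j\<in>Ix. int p dvd a i * c j - c i * a j))"
proof -
  have "(x, a, b) \<otimes>\<^bsub>base\<^esub> (y, c, d) = (y, c, d) \<otimes>\<^bsub>base\<^esub> (x, a, b) \<longleftrightarrow> x \<otimes> y = y \<otimes> x"
    by (auto simp: add.commute)
  moreover have "(\<forall>s\<in>forms. int p dvd lpart s (x, a, b) * rpart s (y, c, d) - lpart s (y, c, d) * rpart s (x, a, b)) \<longleftrightarrow>
     (\<forall>i\<in>Ix. \<forall>f\<in>linear_forms. int p dvd a i * f y - c i * f x) \<and>
     (\<forall>i\<in>Ix. \<forall>j<n. int p dvd a i * d (fst i, j) - c i * b (fst i, j)) \<and>
     (\<forall>i\<in>Ix. \<forall>j\<in>Ix. int p dvd a i * c j - c i * a j)"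
    unfolding forms_def ball_Un ball_simps(9) by (auto simp: Ball_def)
  ultimately show ?thesis unfolding cocycle_extension_commute_iff[OF group_base] by (simp only:)
qed

section \<open>Subgroups assembled from blocks\<close>

definition blocks :: "nat set \<Rightarrow> (nat \<times> nat \<Rightarrow> int) set" where
  "blocks J = {a \<in> carrier X. \<forall>i<m. \<forall>j<n. i \<notin> J \<longrightarrow> a (i, j) = 0}"

text \<open>Every subgroup of maximal measure in \<open>T\<close> turns out to have this shape. It
  contains the whole kernel \<open>W\<close>, uses the blocks \<open>I\<close> of \<open>X\<close>
  and the blocks \<open>J\<close> of \<open>Y\<close>.\<close>

definition box :: "'a set \<Rightarrow> nat set \<Rightarrow> nat set \<Rightarrow> (('a \<times> (nat \<times> nat \<Rightarrow> int) \<times> (nat \<times> nat \<Rightarrow> int)) \<times> ('a form \<Rightarrow> int)) set" where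
  "box K I J = (K \<times> (blocks I \<times> blocks J)) \<times> W"

lemma zero_blocks: "(\<lambda>i\<in>Ix. 0) \<in> blocks J" using p_gt_1 by (auto simp: blocks_def carrier_X)

lemma blocks_empty: "blocks {} = {\<lambda>i\<in>Ix. 0}"
proof -
  have "a = (\<lambda>i\<in>Ix. 0)" if "a \<in> blocks {}" for a
    using that by (intro extensionalityI[of a Ix]) (auto simp: blocks_def carrier_X PiE_iff)
  then show ?thesis using zero_blocks by blast
qed

lemma blocks_all: "blocks {..<m} = carrier X" by (auto simp: blocks_def)

lemma card_blocks:
  assumes "J \<subseteq> {..<m}" shows "card (blocks J) = p ^ (n * card J)"
proof -
  let ?r = "\<lambda>a. restrict a (J \<times> {..<n})"
  have "bij_betw ?r (blocks J) (\<Pi>\<^sub>E i\<in>J \<times> {..<n}. {0..<int p})"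
  proof (rule bij_betw_byWitness[where f' = "\<lambda>a. \<lambda>i\<in>Ix. if i \<in> J \<times> {..<n} then a i else 0"])
    show "\<forall>a\<in>blocks J. (\<lambda>i\<in>Ix. if i \<in> J \<times> {..<n} then ?r a i else 0) = a"
    proof
      fix a assume "a \<in> blocks J"
      then show "(\<lambda>i\<in>Ix. if i \<in> J \<times> {..<n} then ?r a i else 0) = a"
        by (intro extensionalityI[of _ Ix]) (auto simp: blocks_def carrier_X PiE_iff)
    qed
    show "\<forall>a\<in>\<Pi>\<^sub>E i\<in>J \<times> {..<n}. {0..<int p}. ?r (\<lambda>i\<in>Ix. if i \<in> J \<times> {..<n} then a i else 0) = a"
    proof
      fix a assume "a \<in> (\<Pi>\<^sub>E i\<in>J \<times> {..<n}. {0..<int p})"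
      then show "?r (\<lambda>i\<in>Ix. if i \<in> J \<times> {..<n} then a i else 0) = a"
        using assms by (intro extensionalityI[of _ "J \<times> {..<n}"]) (auto simp: PiE_iff)
    qed
    show "?r ` blocks J \<subseteq> (\<Pi>\<^sub>E i\<in>J \<times> {..<n}. {0..<int p})"
    proof (rule image_subsetI)
      fix a assume "a \<in> blocks J"
      then have a: "a \<in> (\<Pi>\<^sub>E i\<in>Ix. {0..<int p})" unfolding blocks_def carrier_X by blast
      have "J \<times> {..<n} \<subseteq> Ix" using assms by blast
      then show "?r a \<in> (\<Pi>\<^sub>E i\<in>J \<times> {..<n}. {0..<int p})"
        unfolding restrict_PiE_iff by (intro ballI PiE_mem[OF a]) (rule subsetD)
    qed
    show "(\<lambda>a. \<lambda>i\<in>Ix. if i \<in> J \<times> {..<n} then a i else 0) ` (\<Pi>\<^sub>E i\<in>J \<times> {..<n}. {0..<int p}) \<subseteq> blocks J"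
      using p_gt_1 by (auto simp: blocks_def carrier_X PiE_iff)
  qed
  then have "card (blocks J) = card (\<Pi>\<^sub>E i\<in>J \<times> {..<n}. {0..<int p})" by (rule bij_betw_same_card)
  also have "\<dots> = p ^ (n * card J)"
    using assms finite_subset[OF assms] by (simp add: card_PiE card_cartesian_product mult.commute)
  finally show ?thesis .
qed

lemma finite_blocks: "finite (blocks J)"
proof (rule finite_subset)
  show "blocks J \<subseteq> carrier X" by (auto simp: blocks_def)
qed (simp add: carrier_X finite_PiE)

lemma finite_box: "finite K \<Longrightarrow> finite (box K I J)"
  by (simp add: box_def finite_blocks finite_W)

lemma card_box:
  assumes "I \<subseteq> {..<m}" "J \<subseteq> {..<m}"
  shows "card (box K I J) = card K * p ^ (n * (card I + card J)) * card W"
  by (simp add: box_def card_cartesian_product card_blocks[OF assms(1)] card_blocks[OF assms(2)]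
      distrib_left power_add)

lemma box_mono_iff:
  assumes "K \<noteq> {}" "I \<subseteq> {..<m}" "J \<subseteq> {..<m}"
  shows "box K I J \<subseteq> box K' I' J' \<longleftrightarrow> K \<subseteq> K' \<and> I \<subseteq> I' \<and> J \<subseteq> J'"
proof -
  have bl: "blocks I \<subseteq> blocks I' \<longleftrightarrow> I \<subseteq> I'" if I: "I \<subseteq> {..<m}" for I I'
  proof
    assume sub: "blocks I \<subseteq> blocks I'"
    show "I \<subseteq> I'"
    proof (rule ccontr)
      assume "\<not> I \<subseteq> I'"
      then obtain i where i: "i \<in> I" "i \<notin> I'" by blast
      let ?a = "\<lambda>j\<in>Ix. if fst j \<in> I then 1 else 0 :: int"
      have "?a \<in> blocks I" using p_gt_1 by (auto simp: blocks_def carrier_X)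
      then have "?a \<in> blocks I'" using sub by blast
      moreover have "i < m" using i I by blast
      ultimately have "?a (i, 0) = 0" using i(2) n_ge_2 unfolding blocks_def by force
      then show False using i \<open>i < m\<close> n_ge_2 by simp
    qed
  qed (auto simp: blocks_def)
  have ne: "blocks J \<noteq> {}" for J using zero_blocks by blast
  have "W \<noteq> {}" using p_gt_1 by (simp add: PiE_eq_empty_iff)
  then show ?thesis
    unfolding box_def times_subset_iff using assms(1) ne bl[OF assms(2)] bl[OF assms(3)] by auto
qed

lemma subgroup_box:
  assumes K: "subgroup K G" shows "subgroup (box K I J) T"
proof -
  interpret T: group T by (rule group_T)
  have Kc: "K \<subseteq> carrier G" using subgroup.subset[OF K] .
  have add: "(\<lambda>i\<in>Ix. (a i + b i) mod int p) \<in> blocks J" if "a \<in> blocks J" "b \<in> blocks J" for a b J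
    using that p_gt_1 by (auto simp: blocks_def carrier_X)
  have sub: "box K I J \<subseteq> carrier T" unfolding carrier_T box_def using Kc by (auto simp: blocks_def)
  have mult: "u \<otimes>\<^bsub>T\<^esub> v \<in> box K I J" if uv: "u \<in> box K I J" "v \<in> box K I J" for u v
  proof -
    obtain x a b w where u: "u = ((x, a, b), w)" by (metis prod.collapse)
    obtain y c d z where v: "v = ((y, c, d), z)" by (metis prod.collapse)
    have "x \<in> K" "y \<in> K" "a \<in> blocks I" "c \<in> blocks I" "b \<in> blocks J" "d \<in> blocks J"
      using uv unfolding u v box_def by simp_all
    then have "x \<otimes> y \<in> K" "(\<lambda>i\<in>Ix. (a i + c i) mod int p) \<in> blocks I"
      "(\<lambda>i\<in>Ix. (b i + d i) mod int p) \<in> blocks J"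
      using subgroup.m_closed[OF K] add by simp_all
    then show ?thesis unfolding u v mult_T box_def using p_gt_1 by simp
  qed
  have one: "\<one>\<^bsub>T\<^esub> \<in> box K I J"
    using subgroup.one_closed[OF K] zero_blocks p_gt_1 by (simp add: cocycle_extension_def box_def)
  show ?thesis
  proof (rule T.subgroupI[OF sub])
    show "box K I J \<noteq> {}" using one by blast
    fix u assume u: "u \<in> box K I J"
    \<comment> \<open>In a finite group the inverse is a power, so closure under products suffices
      and no formula for inverses in the extension is needed.\<close>
    have pow: "u [^]\<^bsub>T\<^esub> (j::nat) \<in> box K I J" for j by (induction j) (use one mult u in auto)
    have uc: "u \<in> carrier T" using u sub by blast
    have "u [^]\<^bsub>T\<^esub> (order T - 1) \<otimes>\<^bsub>T\<^esub> u = u [^]\<^bsub>T\<^esub> (Suc (order T - 1))" by simp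
    also have "Suc (order T - 1) = order T" using finite_T T.order_gt_0_iff_finite by simp
    also have "u [^]\<^bsub>T\<^esub> order T = \<one>\<^bsub>T\<^esub>" using T.pow_order_eq_1[OF uc] .
    finally have "inv\<^bsub>T\<^esub> u = u [^]\<^bsub>T\<^esub> (order T - 1)"
      by (rule T.inv_equality[OF _ uc T.nat_pow_closed[OF uc]])
    then show "inv\<^bsub>T\<^esub> u \<in> box K I J" using pow by simp
  qed (rule mult)
qed

end

lemma mult_eq_bound_cancel:
  fixes c :: nat
  assumes "a' \<le> a" "b' \<le> b" "a * b \<le> c" "c > 0"
  shows "a' * b' \<le> c" "a' * b' = c \<Longrightarrow> a' = a \<and> b' = b"
proof -
  have 1: "a' * b' \<le> a * b'" "a * b' \<le> a * b" using assms by simp_all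
  then show "a' * b' \<le> c" using assms by linarith
  assume "a' * b' = c"
  then have eq: "a' * b' = a * b'" "a * b' = a * b" "a * b' > 0" using 1 assms by linarith+
  then show "a' = a \<and> b' = b" by simp
qed

lemma prime_dvd_mult_small:
  assumes "prime p" "int p dvd a * b" "a \<noteq> 0" "a \<in> {0..<int p}" "b \<in> {0..<int p}"
  shows "b = 0"
proof (rule ccontr)
  assume "b \<noteq> 0"
  then have "\<not> int p dvd a" "\<not> int p dvd b" using assms by (auto dest: zdvd_imp_le)
  then show False using assms(1,2) prime_dvd_mult_iff[of "int p"] by simp
qed

section \<open>Commuting subgroups of T and the maximal measure\<close>

context string_extension
begin

abbreviation "xpart u \<equiv> fst (snd (fst u))"
abbreviation "ypart u \<equiv> snd (snd (fst u))"
abbreviation "gpart u \<equiv> fst (fst u)"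

lemma mem_box: "u \<in> box K I J \<longleftrightarrow> gpart u \<in> K \<and> xpart u \<in> blocks I \<and> ypart u \<in> blocks J \<and> snd u \<in> W"
  unfolding box_def mem_Times_iff by blast

lemma mem_T: "u \<in> carrier T \<longleftrightarrow> gpart u \<in> carrier G \<and> xpart u \<in> carrier X \<and> ypart u \<in> carrier X \<and> snd u \<in> W"
  unfolding carrier_T mem_Times_iff by blast

lemma commute_T_iff:
  "u \<otimes>\<^bsub>T\<^esub> v = v \<otimes>\<^bsub>T\<^esub> u \<longleftrightarrow> gpart u \<otimes> gpart v = gpart v \<otimes> gpart u \<and>
     (\<forall>i\<in>Ix. \<forall>f\<in>linear_forms. int p dvd xpart u i * f (gpart v) - xpart v i * f (gpart u)) \<and>
     (\<forall>i\<in>Ix. \<forall>j<n. int p dvd xpart u i * ypart v (fst i, j) - xpart v i * ypart u (fst i, j)) \<and>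
     (\<forall>i\<in>Ix. \<forall>j\<in>Ix. int p dvd xpart u i * xpart v j - xpart v i * xpart u j)"
  by (cases u, cases v, cases "fst u", cases "fst v") (use commute_T in simp)

lemma carrier_X_mem: "a \<in> carrier X \<Longrightarrow> i \<in> Ix \<Longrightarrow> a i \<in> {0..<int p}"
  unfolding carrier_X by (rule PiE_mem)

lemma center_if_forms_vanish:
  assumes x: "x \<in> carrier G" and f0: "\<And>f. f \<in> linear_forms \<Longrightarrow> f x = 0"
  shows "x \<in> center G"
proof (rule ccontr)
  assume "x \<notin> center G"
  then obtain f where f: "f \<in> hom G (integer_mod_group p)" "\<And>b. b \<in> center G \<Longrightarrow> f b = 0" "f x = 1"
    using ex_hom_separating[OF subgroup_center subset_refl x] by blast
  have "restrict f (carrier G) \<in> linear_forms"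
  proof -
    have "f y \<in> {0..<int p}" if "y \<in> carrier G" for y
      using hom_in_carrier[OF f(1) that] p_gt_1 by (simp add: carrier_integer_mod_group)
    moreover have "restrict f (carrier G) \<in> hom G (integer_mod_group p)"
      using f(1) by (auto simp: hom_def)
    ultimately show ?thesis using f(2) center_carrier by (simp add: linear_forms_def)
  qed
  then show False using f0[of "restrict f (carrier G)"] f(3) x by simp
qed

lemma linear_formsD:
  assumes "f \<in> linear_forms"
  shows "x \<in> carrier G \<Longrightarrow> f x \<in> {0..<int p}" "z \<in> center G \<Longrightarrow> f z = 0"
  using assms by (auto simp: linear_forms_def)

definition support :: "(('a \<times> (nat \<times> nat \<Rightarrow> int) \<times> (nat \<times> nat \<Rightarrow> int)) \<times> ('a form \<Rightarrow> int)) set \<Rightarrow> nat set" where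
  "support H = {i. i < m \<and> (\<exists>u\<in>H. \<exists>j<n. xpart u (i, j) \<noteq> 0)}"

lemma support_subset: "support H \<subseteq> {..<m}" by (auto simp: support_def)

lemma subset_box_support: "H \<subseteq> carrier T \<Longrightarrow> H \<subseteq> box (carrier G) (support H) {..<m}"
proof
  fix u assume "H \<subseteq> carrier T" "u \<in> H"
  then have "u \<in> carrier T" by blast
  moreover have "xpart u \<in> blocks (support H)"
    using \<open>u \<in> H\<close> \<open>u \<in> carrier T\<close> unfolding blocks_def support_def mem_T by blast
  ultimately show "u \<in> box (carrier G) (support H) {..<m}" unfolding mem_box mem_T blocks_all by blast
qed

text \<open>For \<open>v\<close> without X-part, the commutator with \<open>u\<close> is a product
  of a coordinate of \<open>u\<close> with a form or a Y-coordinate of \<open>v\<close>. A nonzero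
  coordinate of \<open>u\<close> in block \<open>i\<close> thus kills all forms on the first
  component of \<open>v\<close>, which is then central, and also block \<open>i\<close> of its
  Y-part.\<close>

lemma zero_xpart_in_box:
  assumes H: "H \<subseteq> carrier T" "support H \<noteq> {}" and v: "v \<in> carrier T" "xpart v = (\<lambda>i\<in>Ix. 0)"
    and comm: "\<And>u. u \<in> H \<Longrightarrow> u \<otimes>\<^bsub>T\<^esub> v = v \<otimes>\<^bsub>T\<^esub> u"
  shows "v \<in> box (center G) {} ({..<m} - support H)"
proof -
  have v0: "xpart v i = 0" if "i \<in> Ix" for i using v(2) that by simp
  have vanish: "\<forall>f\<in>linear_forms. f (gpart v) = 0" "\<forall>j<n. ypart v (i, j) = 0" if i: "i \<in> support H" for i
  proof -
    obtain u j where u: "u \<in> H" "j < n" "xpart u (i, j) \<noteq> 0" and im: "i < m" using i by (auto simp: support_def)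
    have ij: "(i, j) \<in> Ix" using u im by simp
    have uT: "u \<in> carrier T" using u H by blast
    have ux: "xpart u (i, j) \<in> {0..<int p}" using carrier_X_mem[OF _ ij] uT unfolding mem_T by blast
    note c = comm[OF u(1), unfolded commute_T_iff]
    show "\<forall>f\<in>linear_forms. f (gpart v) = 0"
    proof
      fix f assume f: "f \<in> linear_forms"
      have "int p dvd xpart u (i, j) * f (gpart v) - xpart v (i, j) * f (gpart u)" using c ij f by blast
      then have "int p dvd xpart u (i, j) * f (gpart v)" using v0[OF ij] by simp
      then show "f (gpart v) = 0"
        using prime_dvd_mult_small[OF prime_p _ u(3) ux] linear_formsD(1)[OF f] v(1) unfolding mem_T by blast
    qed
    show "\<forall>j<n. ypart v (i, j) = 0"
    proof (intro allI impI)
      fix l assume l: "l < n"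
      have "int p dvd xpart u (i, j) * ypart v (fst (i, j), l) - xpart v (i, j) * ypart u (fst (i, j), l)"
        using c ij l by blast
      then have d: "int p dvd xpart u (i, j) * ypart v (i, l)" using v0[OF ij] by simp
      have il: "(i, l) \<in> Ix" using im l by simp
      have "ypart v (i, l) \<in> {0..<int p}" using carrier_X_mem[OF _ il] v(1) unfolding mem_T by blast
      then show "ypart v (i, l) = 0" using prime_dvd_mult_small[OF prime_p d u(3) ux] by blast
    qed
  qed
  obtain i where i: "i \<in> support H" using H(2) by blast
  have "gpart v \<in> center G" using center_if_forms_vanish vanish(1)[OF i] v(1) unfolding mem_T by blast
  moreover have "xpart v \<in> blocks {}" unfolding v(2) by (rule zero_blocks)
  moreover have "ypart v \<in> blocks ({..<m} - support H)"
    using vanish(2) v(1) unfolding blocks_def mem_T by blast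
  ultimately show ?thesis using v(1) unfolding mem_box mem_T by blast
qed

lemma support_empty:
  assumes "H \<subseteq> carrier T" "support H = {}" "u \<in> H" shows "xpart u = (\<lambda>i\<in>Ix. 0)"
proof -
  have "u \<in> box (carrier G) (support H) {..<m}" using subset_box_support[OF assms(1)] assms(3) by (rule subsetD)
  then have "xpart u \<in> blocks {}" unfolding assms(2) mem_box by (elim conjE)
  then show ?thesis unfolding blocks_empty by (rule singletonD)
qed

text \<open>If both \<open>H\<close> and a set commuting with it have nonzero \<open>X\<close>-parts, then those of \<open>H\<close> lie on a line.\<close>

lemma card_le_if_both_supports:
  assumes H: "subgroup H T" and D: "D \<subseteq> carrier T" "support D \<noteq> {}"
    and comm: "\<And>u v. u \<in> H \<Longrightarrow> v \<in> D \<Longrightarrow> u \<otimes>\<^bsub>T\<^esub> v = v \<otimes>\<^bsub>T\<^esub> u"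
  shows "card H \<le> p * (card (center G) * p ^ (n * (m - 1)) * card W)"
proof -
  interpret T: group T by (rule group_T)
  have Hs: "H \<subseteq> carrier T" using subgroup.subset[OF H] .
  obtain d i j where d: "d \<in> D" "i < m" "j < n" "xpart d (i, j) \<noteq> 0" using D(2) by (auto simp: support_def)
  have ij: "(i, j) \<in> Ix" using d by simp
  have "d \<in> carrier T" using D(1) d(1) by (rule subsetD)
  then have dx: "xpart d (i, j) \<in> {0..<int p}" using carrier_X_mem[OF _ ij] unfolding mem_T by blast
  \<comment> \<open>The self-pairing makes all 2 by 2 minors of the X-parts of \<open>u\<close> and
    \<open>d\<close> vanish. As \<open>d\<close> is nonzero at this coordinate, an element of
    \<open>H\<close> that vanishes there has no X-part at all; the coordinate itself costs only a
    factor \<open>p\<close>.\<close>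
  let ?f = "\<lambda>u. xpart u (i, j)"
  have f: "?f \<in> hom T (integer_mod_group p)"
  proof (rule homI)
    fix u v assume u: "u \<in> carrier T" and v: "v \<in> carrier T"
    show "?f u \<in> carrier (integer_mod_group p)"
      using carrier_X_mem[OF _ ij] u p_gt_1 unfolding mem_T by (auto simp: carrier_integer_mod_group)
    obtain x a b w y c e z where "u = ((x, a, b), w)" "v = ((y, c, e), z)" by (metis prod.collapse)
    then show "?f (u \<otimes>\<^bsub>T\<^esub> v) = ?f u \<otimes>\<^bsub>integer_mod_group p\<^esub> ?f v" using ij by (simp add: mult_T)
  qed
  have "{u \<in> H. ?f u = 0} \<subseteq> box (center G) {} ({..<m} - support D)"
  proof
    fix u assume "u \<in> {u \<in> H. ?f u = 0}"
    then have u: "u \<in> H" "?f u = 0" by auto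
    have uT: "u \<in> carrier T" using u Hs by blast
    have "xpart u s = 0" if s: "s \<in> Ix" for s
    proof -
      have "int p dvd xpart u (i, j) * xpart d s - xpart d (i, j) * xpart u s"
        using comm[OF u(1) d(1), unfolded commute_T_iff] ij s by blast
      then have "int p dvd xpart d (i, j) * xpart u s" using u(2) by simp
      then show ?thesis
        using prime_dvd_mult_small[OF prime_p _ d(4) dx] carrier_X_mem[OF _ s] uT unfolding mem_T by blast
    qed
    moreover have "xpart u \<in> extensional Ix" using uT unfolding mem_T carrier_X PiE_iff by blast
    ultimately have "xpart u = (\<lambda>i\<in>Ix. 0)" by (intro extensionalityI[of _ Ix]) auto
    then show "u \<in> box (center G) {} ({..<m} - support D)"
      using zero_xpart_in_box[OF D uT] comm[OF u(1)] by metis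
  qed
  then have "card {u \<in> H. ?f u = 0} \<le> card (box (center G) {} ({..<m} - support D))"
    using subgroup.subset[OF subgroup_center] finite_carrier finite_subset by (intro card_mono finite_box) blast+
  also have "\<dots> = card (center G) * p ^ (n * card ({..<m} - support D)) * card W"
    by (subst card_box) auto
  also have "\<dots> \<le> card (center G) * p ^ (n * (m - 1)) * card W"
  proof -
    have "i \<in> support D" using d by (auto simp: support_def)
    then have "{..<m} - support D \<subseteq> {..<m} - {i}" by blast
    then have "card ({..<m} - support D) \<le> card ({..<m} - {i})" by (intro card_mono) auto
    also have "\<dots> = m - 1" using d(2) by simp
    finally have "n * card ({..<m} - support D) \<le> n * (m - 1)" by simp
    then have "p ^ (n * card ({..<m} - support D)) \<le> p ^ (n * (m - 1))" using p_gt_1 by (intro power_increasing) auto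
    then show ?thesis by simp
  qed
  finally have "p * card {u \<in> H. ?f u = 0} \<le> p * (card (center G) * p ^ (n * (m - 1)) * card W)" by simp
  moreover have "card H \<le> p * card {u \<in> H. ?f u = 0}"
    by (rule T.card_le_hom_kernel[OF f _ H finite_subset[OF Hs finite_T]]) (use p_gt_1 in simp)
  ultimately show ?thesis by linarith
qed

lemma cd_max_G: "cd_max G = card (carrier G) * card (center G)"
  using carrier_in_CD by (simp add: carrier_CD cd_measure_def center_def)

text \<open>The maximal measure of \<open>T\<close>, obtained as the product of the orders of two
  commuting boxes: both contain \<open>W\<close>, and together they use 2m blocks.\<close>

definition "cd_T = cd_max G * p ^ (n * (m + m)) * (card W * card W)"

lemma card_W_pos: "card W > 0"
  using finite_forms p_gt_1 by (simp add: card_PiE)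

lemma cd_max_G_pos: "cd_max G > 0"
  using cd_measure_pos[OF finite_carrier subgroup_self] carrier_in_CD by (simp add: carrier_CD)

lemma cd_T_pos: "cd_T > 0"
  using cd_max_G_pos card_W_pos p_gt_1 by (simp add: cd_T_def)

lemma card_box_mult:
  assumes "I \<subseteq> {..<m}" "J \<subseteq> {..<m}" "I' \<subseteq> {..<m}" "J' \<subseteq> {..<m}"
    and "card I + card J + card I' + card J' = m + m"
  shows "card (box K I J) * card (box K' I' J') = (card K * card K') * p ^ (n * (m + m)) * (card W * card W)"
proof -
  have "p ^ (n * (card I + card J)) * p ^ (n * (card I' + card J')) = p ^ (n * (m + m))"
    by (simp only: power_add[symmetric] distrib_left[symmetric] assms(5)[symmetric] add.assoc)
  then show ?thesis by (simp add: card_box[OF assms(1,2)] card_box[OF assms(3,4)] ac_simps)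
qed

lemma card_Diff_atMost: "J \<subseteq> {..<m} \<Longrightarrow> card ({..<m} - J) + card J = m"
  using card_Diff_subset[of J "{..<m}"] card_mono[of "{..<m}" J] finite_subset[of J "{..<m}"] by simp

lemma finite_center: "finite (center G)"
  using subgroup.subset[OF subgroup_center] finite_carrier finite_subset by blast

text \<open>The cases are whether \<open>H\<close> and \<open>D\<close> have nonzero X-parts. If
  neither has, the problem reduces to the measure in \<open>G\<close>. If exactly one has, both
  groups lie in complementary boxes and equality means being those boxes. If both have, the product
  of the orders is too small.\<close>

lemma commuting_bound:
  assumes H: "subgroup H T" and D: "subgroup D T"
    and comm: "\<And>u v. u \<in> H \<Longrightarrow> v \<in> D \<Longrightarrow> u \<otimes>\<^bsub>T\<^esub> v = v \<otimes>\<^bsub>T\<^esub> u"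
  shows "card H * card D \<le> cd_T \<and> (card H * card D = cd_T \<longrightarrow>
    (\<exists>J\<subseteq>{..<m}. H = box (center G) {} J) \<or> (\<exists>K\<in>carrier (CD G). H = box K {} {..<m}) \<or>
    (\<exists>J\<subseteq>{..<m}. H = box (carrier G) J {..<m}))"
proof -
  have Hs: "H \<subseteq> carrier T" and Ds: "D \<subseteq> carrier T" using H D subgroup.subset by auto
  have one_side: "card H * card D \<le> cd_T \<and> (card H * card D = cd_T \<longrightarrow>
      H = box (carrier G) (support H) {..<m} \<and> D = box (center G) {} ({..<m} - support H))"
    if H: "H \<subseteq> carrier T" "support H \<noteq> {}" and D: "D \<subseteq> carrier T" "support D = {}"
      and comm: "\<And>u v. u \<in> H \<Longrightarrow> v \<in> D \<Longrightarrow> u \<otimes>\<^bsub>T\<^esub> v = v \<otimes>\<^bsub>T\<^esub> u" for H D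
  proof -
    let ?A = "box (carrier G) (support H) {..<m}" and ?B = "box (center G) {} ({..<m} - support H)"
    have HA: "H \<subseteq> ?A" using subset_box_support[OF H(1)] .
    have DB: "D \<subseteq> ?B"
      using zero_xpart_in_box[OF H] support_empty[OF D] D(1) comm by blast
    have fin: "finite ?A" "finite ?B" using finite_box finite_carrier finite_center by auto
    have "card ?A * card ?B = cd_T"
      unfolding cd_T_def cd_max_G
      by (rule card_box_mult) (use support_subset[of H] card_Diff_atMost[OF support_subset[of H]] in \<open>auto simp: add.commute[of "card (support H)"]\<close>)
    then have le: "card ?A * card ?B \<le> cd_T" by simp
    note b = mult_eq_bound_cancel[OF card_mono[OF fin(1) HA] card_mono[OF fin(2) DB] le cd_T_pos]
    show ?thesis using b card_subset_eq[OF fin(1) HA] card_subset_eq[OF fin(2) DB] by blast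
  qed
  consider (none) "support H = {}" "support D = {}" | (left) "support H \<noteq> {}" "support D = {}"
    | (right) "support H = {}" "support D \<noteq> {}" | (both) "support H \<noteq> {}" "support D \<noteq> {}" by blast
  then show ?thesis
  proof cases
    case none
    let ?K = "gpart ` H"
    have g: "gpart \<in> hom T G"
    proof (rule homI)
      fix u v assume "u \<in> carrier T" "v \<in> carrier T"
      then show "gpart u \<in> carrier G" unfolding mem_T by blast
      show "gpart (u \<otimes>\<^bsub>T\<^esub> v) = gpart u \<otimes> gpart v" by (cases u, cases v) (auto simp: cocycle_extension_def)
    qed
    have K: "subgroup ?K G"
      using group_hom.subgroup_img_is_subgroup[OF group_hom.intro[OF group_T is_group group_hom_axioms.intro[OF g]] H] .
    let ?A = "box ?K {} {..<m}" and ?B = "box (centralizer G ?K) {} {..<m}"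
    have HA: "H \<subseteq> ?A"
      using subset_box_support[OF Hs] unfolding none mem_box subset_iff by blast
    have DB: "D \<subseteq> ?B"
    proof
      fix v assume v: "v \<in> D"
      then have vb: "v \<in> box (carrier G) {} {..<m}" using subset_box_support[OF Ds] unfolding none by blast
      have "gpart v \<otimes> x = x \<otimes> gpart v" if "x \<in> ?K" for x
        using that comm[OF _ v] unfolding commute_T_iff by (metis (no_types, lifting) imageE)
      then show "v \<in> ?B" using vb unfolding mem_box centralizer_def by blast
    qed
    have fin: "finite ?A" "finite ?B"
      using K finite_carrier finite_subset subgroup.subset[OF K]
      by (intro finite_box, blast, intro finite_box) (simp add: centralizer_def)
    have eq: "card ?A * card ?B = cd_measure G ?K * p ^ (n * (m + m)) * (card W * card W)"
      unfolding cd_measure_def by (rule card_box_mult) auto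
    have leG: "cd_measure G ?K \<le> cd_max G" using cd_measure_le_max[OF finite_carrier K] .
    then have le: "card ?A * card ?B \<le> cd_T" unfolding eq cd_T_def by simp
    note b = mult_eq_bound_cancel[OF card_mono[OF fin(1) HA] card_mono[OF fin(2) DB] le cd_T_pos]
    have "H = ?A \<and> ?K \<in> carrier (CD G)" if e: "card H * card D = cd_T"
    proof -
      have cards: "card H = card ?A" "card D = card ?B" using b(2)[OF e] by auto
      then have "H = ?A" using card_subset_eq[OF fin(1) HA] by blast
      moreover have "cd_measure G ?K * p ^ (n * (m + m)) * (card W * card W) = cd_T" using e cards eq by simp
      then have "cd_measure G ?K = cd_max G" unfolding cd_T_def using p_gt_1 card_W_pos by simp
      ultimately show ?thesis using K by (simp add: carrier_CD)
    qed
    then show ?thesis using b(1) by blast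
  next
    case left
    from one_side[OF Hs left(1) Ds left(2) comm] show ?thesis using support_subset[of H] by blast
  next
    case right
    have "card D * card H \<le> cd_T \<and> (card D * card H = cd_T \<longrightarrow>
      D = box (carrier G) (support D) {..<m} \<and> H = box (center G) {} ({..<m} - support D))"
      by (rule one_side[OF Ds right(2) Hs right(1)]) (metis comm)
    then show ?thesis using mult.commute[of "card H" "card D"] by (metis Diff_subset)
  next
    case both
    let ?e = "p * (card (center G) * p ^ (n * (m - 1)) * card W)"
    have c1: "card H \<le> ?e" using card_le_if_both_supports[OF H Ds both(2) comm] .
    have c2: "card D \<le> ?e" by (rule card_le_if_both_supports[OF D Hs both(1)]) (metis comm)
    have m: "m > 0" using both(1) support_subset[of H] by (metis gr_zeroI lessThan_0 subset_empty)
    have "card (center G) \<le> card (carrier G)"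
      using card_mono[OF finite_carrier subgroup.subset[OF subgroup_center]] .
    then have zz: "card (center G) * card (center G) \<le> cd_max G" unfolding cd_max_G by simp
    \<comment> \<open>Each side lacks a block of \<open>Y\<close>, a total loss of p^(2n), and
      regains at most p^2 from the line of X-parts. With \<open>n \<ge> 2\<close> the loss exceeds
      the gain.\<close>
    have "n * (m + m) = n * (m - 1) + n * (m - 1) + (n + n)"
      using m by (cases m) (simp_all add: algebra_simps)
    then have lt: "p * p * (p ^ (n * (m - 1)) * p ^ (n * (m - 1))) < p ^ (n * (m + m))"
    proof -
      have "p * p * (p ^ (n * (m - 1)) * p ^ (n * (m - 1))) = p ^ (2 + (n * (m - 1) + n * (m - 1)))"
        by (simp add: power_add power2_eq_square)
      also have "\<dots> < p ^ (n * (m + m))"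
        using \<open>n * (m + m) = _\<close> n_ge_2 p_gt_1 by (intro power_strict_increasing) auto
      finally show ?thesis .
    qed
    have "(card (center G) * card (center G)) * (p * p * (p ^ (n * (m - 1)) * p ^ (n * (m - 1))))
        < cd_max G * p ^ (n * (m + m))"
      by (rule order.strict_trans1[OF mult_le_mono1[OF zz] mult_strict_left_mono[OF lt cd_max_G_pos]])
    then have "((card (center G) * card (center G)) * (p * p * (p ^ (n * (m - 1)) * p ^ (n * (m - 1))))) * (card W * card W)
        < cd_T" unfolding cd_T_def using card_W_pos by (intro mult_strict_right_mono) auto
    moreover have "?e * ?e = ((card (center G) * card (center G)) * (p * p * (p ^ (n * (m - 1)) * p ^ (n * (m - 1))))) * (card W * card W)"
      by (simp only: ac_simps)
    ultimately have "?e * ?e < cd_T" by linarith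
    then have "card H * card D < cd_T" using mult_le_mono[OF c1 c2] by linarith
    then show ?thesis by linarith
  qed
qed

lemma commuting_boxes:
  assumes K: "K \<subseteq> carrier G" "K' \<subseteq> centralizer G K"
    and I: "I = {} \<or> (K' \<subseteq> center G \<and> I \<inter> J' = {})" and I': "I' = {}"
    and u: "u \<in> box K I J" and v: "v \<in> box K' I' J'"
  shows "u \<otimes>\<^bsub>T\<^esub> v = v \<otimes>\<^bsub>T\<^esub> u"
proof -
  have uv: "gpart u \<in> K" "xpart u \<in> blocks I" "gpart v \<in> K'" "xpart v \<in> blocks {}" "ypart v \<in> blocks J'"
    using u v unfolding I' mem_box by auto
  have v0: "xpart v i = 0" if "i \<in> Ix" for i using uv(4) that by (simp add: blocks_empty)
  have u0: "xpart u i = 0 \<or> (K' \<subseteq> center G \<and> fst i \<in> I \<and> I \<inter> J' = {})" if i: "i \<in> Ix" for i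
  proof (cases "fst i \<in> I")
    case True
    then show ?thesis using I by blast
  next
    case False
    then show ?thesis using uv(2) i by (cases i) (auto simp: blocks_def)
  qed
  have a: "xpart u i * f (gpart v) = 0" if i: "i \<in> Ix" and f: "f \<in> linear_forms" for i f
    using u0[OF i] linear_formsD(2)[OF f] uv(3) by auto
  have b: "xpart u i * ypart v (fst i, j) = 0" if i: "i \<in> Ix" and j: "j < n" for i j
    using u0[OF i]
  proof
    assume "K' \<subseteq> center G \<and> fst i \<in> I \<and> I \<inter> J' = {}"
    then have "fst i \<notin> J'" by blast
    moreover have "fst i < m" using i by auto
    ultimately have "ypart v (fst i, j) = 0" using uv(5) j unfolding blocks_def by blast
    then show ?thesis by simp
  qed simp
  have "gpart v \<otimes> gpart u = gpart u \<otimes> gpart v" using uv(1,3) K(2) unfolding centralizer_def by blast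
  then have g: "gpart u \<otimes> gpart v = gpart v \<otimes> gpart u" by (rule sym)
  show ?thesis unfolding commute_T_iff
    by (intro conjI ballI allI impI g) (simp_all only: a b v0 mult_zero_left mult_zero_right diff_zero dvd_0_right)
qed

text \<open>The partner box need only lie inside the centralizer; equality of measures follows later
  from the upper bound.\<close>

lemma cd_measure_box_ge:
  assumes K: "subgroup K G" and I: "I \<subseteq> {..<m}" "J \<subseteq> {..<m}" "I' \<subseteq> {..<m}" "J' \<subseteq> {..<m}" "card I + card J + card I' + card J' = m + m"
    and K': "K' \<subseteq> carrier G" and KK: "card K * card K' = cd_max G"
    and comm: "\<And>u v. u \<in> box K I J \<Longrightarrow> v \<in> box K' I' J' \<Longrightarrow> u \<otimes>\<^bsub>T\<^esub> v = v \<otimes>\<^bsub>T\<^esub> u"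
  shows "cd_measure T (box K I J) \<ge> cd_T"
proof -
  have sub: "box K' I' J' \<subseteq> centralizer T (box K I J)"
  proof
    fix v assume v: "v \<in> box K' I' J'"
    have "v \<in> carrier T" using v K' unfolding mem_box mem_T blocks_def by blast
    then show "v \<in> centralizer T (box K I J)" unfolding centralizer_def
      by (intro CollectI conjI ballI comm[OF _ v, symmetric])
  qed
  have "finite (centralizer T (box K I J))" using finite_T by (simp add: centralizer_def)
  then have "card (box K' I' J') \<le> card (centralizer T (box K I J))" using sub by (rule card_mono)
  then have "card (box K I J) * card (box K' I' J') \<le> cd_measure T (box K I J)"
    unfolding cd_measure_def by (rule mult_le_mono2)
  then show ?thesis using card_box_mult[OF I] KK unfolding cd_T_def by simp
qed

text \<open>The partners are \<open>box (carrier G) ({..<m} - J) {..<m}\<close> for the first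
  family, \<open>box (centralizer G K) {} {..<m}\<close> for the second and
  \<open>box (center G) {} ({..<m} - J)\<close> for the third; so the centralizer interchanges the
  two diamonds.\<close>

lemma box_measures:
  "J \<subseteq> {..<m} \<Longrightarrow> cd_measure T (box (center G) {} J) \<ge> cd_T"
  "K \<in> carrier (CD G) \<Longrightarrow> cd_measure T (box K {} {..<m}) \<ge> cd_T"
  "J \<subseteq> {..<m} \<Longrightarrow> cd_measure T (box (carrier G) J {..<m}) \<ge> cd_T"
proof -
  have Zs: "center G \<subseteq> carrier G" using subgroup.subset[OF subgroup_center] .
  have Zc: "center G \<subseteq> centralizer G (carrier G)" by (simp add: center_def)
  show "cd_measure T (box (carrier G) J {..<m}) \<ge> cd_T" if J: "J \<subseteq> {..<m}"
  proof (rule cd_measure_box_ge[OF subgroup_self J _ _ _ _ Zs, of _ "{}" "{..<m} - J"])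
    show "card J + card {..<m} + card {} + card ({..<m} - J) = m + m" using card_Diff_atMost[OF J] by simp
    show "u \<otimes>\<^bsub>T\<^esub> v = v \<otimes>\<^bsub>T\<^esub> u" if "u \<in> box (carrier G) J {..<m}" "v \<in> box (center G) {} ({..<m} - J)" for u v
      using commuting_boxes[OF subset_refl Zc _ refl that] by blast
  qed (simp_all add: cd_max_G)
  show "cd_measure T (box (center G) {} J) \<ge> cd_T" if J: "J \<subseteq> {..<m}"
  proof (rule cd_measure_box_ge[OF subgroup_center _ J, of _ "{..<m} - J" "{..<m}" "carrier G"])
    show "card {} + card J + card ({..<m} - J) + card {..<m} = m + m" using card_Diff_atMost[OF J] by simp
    show "u \<otimes>\<^bsub>T\<^esub> v = v \<otimes>\<^bsub>T\<^esub> u" if "u \<in> box (center G) {} J" "v \<in> box (carrier G) ({..<m} - J) {..<m}" for u v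
      using commuting_boxes[OF subset_refl Zc _ refl that(2,1)] by (metis Diff_disjoint inf_commute order_refl)
  qed (simp_all add: cd_max_G)
  show "cd_measure T (box K {} {..<m}) \<ge> cd_T" if K: "K \<in> carrier (CD G)"
  proof -
    have K': "subgroup K G" "card K * card (centralizer G K) = cd_max G"
      using K by (auto simp: carrier_CD cd_measure_def)
    have Kc: "K \<subseteq> carrier G" using subgroup.subset[OF K'(1)] .
    show ?thesis
    proof (rule cd_measure_box_ge[OF K'(1) _ _ _ _ _ _ K'(2), of "{}" "{..<m}" "{}" "{..<m}"])
      show "u \<otimes>\<^bsub>T\<^esub> v = v \<otimes>\<^bsub>T\<^esub> u" if "u \<in> box K {} {..<m}" "v \<in> box (centralizer G K) {} {..<m}" for u v
        using commuting_boxes[OF Kc subset_refl _ refl that] by blast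
    qed (auto simp: centralizer_def)
  qed
qed

text \<open>The three families are the components of the string. Neighbouring ones share
  \<open>box (center G) {} {..<m}\<close> and \<open>box (carrier G) {} {..<m}\<close>.\<close>

lemma carrier_CD_T:
  "carrier (CD T) = (\<lambda>J. box (center G) {} J) ` Pow {..<m} \<union> (\<lambda>K. box K {} {..<m}) ` carrier (CD G) \<union>
     (\<lambda>J. box (carrier G) J {..<m}) ` Pow {..<m}" (is "_ = ?R")
proof -
  interpret T: group T by (rule group_T)
  have bound: "cd_measure T H \<le> cd_T \<and> (cd_measure T H = cd_T \<longrightarrow> H \<in> ?R)" if H: "subgroup H T" for H
  proof -
    have D: "subgroup (centralizer T H) T" using T.subgroup_centralizer subgroup.subset[OF H] by blast
    have "u \<otimes>\<^bsub>T\<^esub> v = v \<otimes>\<^bsub>T\<^esub> u" if "u \<in> H" "v \<in> centralizer T H" for u v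
    proof -
      have "v \<otimes>\<^bsub>T\<^esub> u = u \<otimes>\<^bsub>T\<^esub> v" using that unfolding centralizer_def by blast
      then show ?thesis by (rule sym)
    qed
    from commuting_bound[OF H D this] show ?thesis unfolding cd_measure_def by blast
  qed
  have sub: "subgroup H T \<and> cd_measure T H = cd_T" if "H \<in> ?R" for H
  proof -
    have "subgroup H T \<and> cd_measure T H \<ge> cd_T"
      using that subgroup_box[OF subgroup_center] subgroup_box[OF subgroup_self] box_measures subgroup_box
      unfolding carrier_CD by blast
    then show ?thesis using bound[of H] by (meson le_antisym)
  qed
  have G: "box (carrier G) {} {..<m} \<in> ?R" by blast
  have max: "cd_max T = cd_T"
    using T.cd_max_eqI[OF finite_T, of cd_T "box (carrier G) {} {..<m}"] bound sub[OF G] by blast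
  show ?thesis
  proof (rule equalityI; rule subsetI)
    fix H assume "H \<in> carrier (CD T)"
    then have "subgroup H T" "cd_measure T H = cd_T" unfolding T.carrier_CD max by blast+
    then show "H \<in> ?R" using bound[of H] by blast
  next
    fix H assume "H \<in> ?R"
    then show "H \<in> carrier (CD T)" unfolding T.carrier_CD max mem_Collect_eq by (rule sub)
  qed
qed

text \<open>As \<open>carrier G\<close> has maximal measure, so does \<open>center G\<close>, with
  the two factors exchanged. For the minimality, \<open>K \<inter> center G\<close> also has maximal
  measure, but its order and that of its centralizer are bounded by the orders of
  \<open>center G\<close> and \<open>G\<close>, so both bounds are attained.\<close>

lemma center_least_CD: "K \<in> carrier (CD G) \<Longrightarrow> center G \<subseteq> K" "center G \<in> carrier (CD G)"
proof -
  have Zs: "center G \<subseteq> carrier G" using subgroup.subset[OF subgroup_center] .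
  have "carrier G \<subseteq> centralizer G (center G)"
    using subset_double_centralizer[of "carrier G"] by (simp add: center_def)
  then have "centralizer G (center G) = carrier G" by (auto simp: centralizer_def)
  then have "cd_measure G (center G) = cd_max G" by (simp add: cd_measure_def cd_max_G)
  then show Z: "center G \<in> carrier (CD G)" using subgroup_center by (simp add: carrier_CD)
  assume "K \<in> carrier (CD G)"
  then have "K \<inter> center G \<in> carrier (CD G)" using CD_join_meet(2)[OF finite_carrier _ Z] by blast
  then have m: "card (K \<inter> center G) * card (centralizer G (K \<inter> center G)) = cd_max G"
    by (simp add: carrier_CD cd_measure_def)
  have le1: "card (K \<inter> center G) \<le> card (center G)" using finite_center by (intro card_mono) auto
  have le2: "card (centralizer G (K \<inter> center G)) \<le> card (carrier G)"
    using finite_carrier by (intro card_mono) (auto simp: centralizer_def)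
  have "card (K \<inter> center G) = card (center G)"
    using mult_eq_bound_cancel(2)[OF le1 le2 _ cd_max_G_pos] m by (simp add: cd_max_G mult.commute)
  then have "K \<inter> center G = center G" using finite_center by (intro card_subset_eq) auto
  then show "center G \<subseteq> K" by blast
qed

section \<open>Gluing the three components\<close>

lemma bottom_eq:
  assumes "x \<in> carrier L" "\<And>y. y \<in> carrier L \<Longrightarrow> x \<sqsubseteq>\<^bsub>L\<^esub> y"
    and antisym: "\<And>y. y \<in> carrier L \<Longrightarrow> y \<sqsubseteq>\<^bsub>L\<^esub> x \<Longrightarrow> y = x"
  shows "\<bottom>\<^bsub>L\<^esub> = x"
  unfolding bottom_def
proof (rule some_equality)
  show "least L x (carrier L)" using assms by (auto simp: least_def)
  fix y assume "least L y (carrier L)"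
  then show "y = x" using assms by (auto simp: least_def)
qed

lemma bottom_cube: "\<bottom>\<^bsub>cube l\<^esub> = {}"
  by (rule bottom_eq) (auto simp: cube_def)

text \<open>\<open>L\<close> is an arbitrary order isomorphic copy of \<open>CD G\<close>, since the
  final statement prescribes the type of the center component.\<close>

lemma order_iso_three_string_T:
  fixes L :: "'c gorder"
  assumes h: "order_iso L (CD G) h"
  shows "\<exists>g. order_iso (three_string (cube m) L (cube m)) (CD T) g"
proof -
  have him: "h ` carrier L = carrier (CD G)" and hinj: "inj_on h (carrier L)"
    and hle: "\<And>x y. x \<in> carrier L \<Longrightarrow> y \<in> carrier L \<Longrightarrow> x \<sqsubseteq>\<^bsub>L\<^esub> y \<longleftrightarrow> h x \<subseteq> h y"
    using h by (auto simp: order_iso_def bij_betw_def CD_def)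
  obtain b where b: "b \<in> carrier L" "h b = center G" using center_least_CD(2) him by (metis imageE)
  have bot: "\<bottom>\<^bsub>L\<^esub> = b"
  proof (rule bottom_eq[OF b(1)])
    fix y assume y: "y \<in> carrier L"
    then have "h y \<in> carrier (CD G)" using him by blast
    then have Zy: "center G \<subseteq> h y" by (rule center_least_CD(1))
    then show "b \<sqsubseteq>\<^bsub>L\<^esub> y" using hle[OF b(1) y] b(2) by simp
    assume "y \<sqsubseteq>\<^bsub>L\<^esub> b"
    then have "h y = h b" using hle[OF y b(1)] Zy b(2) by auto
    then show "y = b" using hinj y b(1) by (meson inj_onD)
  qed
  define g where "g = (\<lambda>x. case x of Inl (Inl J) \<Rightarrow> box (center G) {} J
    | Inl (Inr S) \<Rightarrow> box (h S) {} {..<m} | Inr J \<Rightarrow> box (carrier G) J {..<m})"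
  have g: "g (Inl (Inl J)) = box (center G) {} J" "g (Inl (Inr S)) = box (h S) {} {..<m}"
    "g (Inr J) = box (carrier G) J {..<m}" for J S by (simp_all add: g_def)
  let ?TS = "three_string (cube m) L (cube m)"
  have car: "carrier ?TS = Inl ` (Inl ` Pow {..<m} \<union> Inr ` (carrier L - {b})) \<union> Inr ` (Pow {..<m} - {{}})"
    by (simp add: three_string_def adjoin_def bottom_cube bot) (simp add: cube_def)
  have le: "(Inl (Inl I) \<sqsubseteq>\<^bsub>?TS\<^esub> Inl (Inl J)) = (I \<subseteq> J)" "Inl (Inl I) \<sqsubseteq>\<^bsub>?TS\<^esub> Inl (Inr S)"
    "Inl (Inl I) \<sqsubseteq>\<^bsub>?TS\<^esub> Inr J" "\<not> Inl (Inr S) \<sqsubseteq>\<^bsub>?TS\<^esub> Inl (Inl J)"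
    "(Inl (Inr S) \<sqsubseteq>\<^bsub>?TS\<^esub> Inl (Inr R)) = (S \<sqsubseteq>\<^bsub>L\<^esub> R)" "Inl (Inr S) \<sqsubseteq>\<^bsub>?TS\<^esub> Inr J"
    "\<not> Inr I \<sqsubseteq>\<^bsub>?TS\<^esub> Inl (Inl J)" "\<not> Inr I \<sqsubseteq>\<^bsub>?TS\<^esub> Inl (Inr S)" "(Inr I \<sqsubseteq>\<^bsub>?TS\<^esub> Inr J) = (I \<subseteq> J)"
    for I J :: "nat set" and S R :: 'c
    by (simp_all add: three_string_def adjoin_def cube_def)
  have Zs: "center G \<subseteq> carrier G" using subgroup.subset[OF subgroup_center] .
  have Zne: "center G \<noteq> {}" using subgroup.one_closed[OF subgroup_center] by blast
  have Gne: "carrier G \<noteq> {}" by blast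
  have hK: "center G \<subseteq> h S" "h S \<subseteq> carrier G" "h S \<noteq> {}" if "S \<in> carrier L" for S
  proof -
    have "h S \<in> carrier (CD G)" using that him by blast
    then show Z: "center G \<subseteq> h S" and "h S \<subseteq> carrier G"
      using center_least_CD(1) by (auto simp: carrier_CD dest: subgroup.subset)
    show "h S \<noteq> {}" using Z Zne by blast
  qed
  have hne: "\<not> h S \<subseteq> center G" if "S \<in> carrier L - {b}" for S
    using that hK(1)[of S] hinj b by (metis DiffE inj_onD insertI1 subset_antisym)
  note bm = box_mono_iff[OF Zne empty_subsetI] box_mono_iff[OF Gne _ subset_refl]
  have reflect: "x \<sqsubseteq>\<^bsub>?TS\<^esub> y \<longleftrightarrow> g x \<subseteq> g y" if x: "x \<in> carrier ?TS" and y: "y \<in> carrier ?TS" for x y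
  proof -
    consider (a) I where "x = Inl (Inl I)" "I \<subseteq> {..<m}" | (b) S where "x = Inl (Inr S)" "S \<in> carrier L - {b}"
      | (c) I where "x = Inr I" "I \<subseteq> {..<m}" "I \<noteq> {}" using x unfolding car by blast
    then show ?thesis
    proof cases
      case a
      consider (a') J where "y = Inl (Inl J)" "J \<subseteq> {..<m}" | (b') S where "y = Inl (Inr S)" "S \<in> carrier L - {b}"
        | (c') J where "y = Inr J" "J \<subseteq> {..<m}" "J \<noteq> {}" using y unfolding car by blast
      then show ?thesis by cases (use a le hK Zs in \<open>auto simp: g bm\<close>)
    next
      case b
      note hb = box_mono_iff[OF hK(3) empty_subsetI subset_refl, of S]
      consider (a') J where "y = Inl (Inl J)" "J \<subseteq> {..<m}" | (b') R where "y = Inl (Inr R)" "R \<in> carrier L - {b}"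
        | (c') J where "y = Inr J" "J \<subseteq> {..<m}" "J \<noteq> {}" using y unfolding car by blast
      then show ?thesis by cases (use b le hK hne hle in \<open>auto simp: g hb\<close>)
    next
      case c
      consider (a') J where "y = Inl (Inl J)" "J \<subseteq> {..<m}" | (b') R where "y = Inl (Inr R)" "R \<in> carrier L - {b}"
        | (c') J where "y = Inr J" "J \<subseteq> {..<m}" "J \<noteq> {}" using y unfolding car by blast
      then show ?thesis by cases (use c le in \<open>auto simp: g bm\<close>)
    qed
  qed
  have antisym: "x = y" if x: "x \<in> carrier ?TS" and y: "y \<in> carrier ?TS"
    and xy: "x \<sqsubseteq>\<^bsub>?TS\<^esub> y" "y \<sqsubseteq>\<^bsub>?TS\<^esub> x" for x y
  proof -
    have L: "S = R" if "S \<in> carrier L" "R \<in> carrier L" "S \<sqsubseteq>\<^bsub>L\<^esub> R" "R \<sqsubseteq>\<^bsub>L\<^esub> S" for S R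
      using that hle hinj by (metis inj_onD subset_antisym)
    show ?thesis using x y xy unfolding car by (auto simp: le dest: L)
  qed
  have "inj_on g (carrier ?TS)" using reflect antisym by (intro inj_onI) (metis subset_refl)
  moreover have "g ` carrier ?TS = carrier (CD T)"
  proof
    have "h S \<in> carrier (CD G)" if "S \<in> carrier L" for S using imageI[OF that, of h] unfolding him .
    then show "g ` carrier ?TS \<subseteq> carrier (CD T)" unfolding car carrier_CD_T by (auto simp: g)
    have midh: "box (h S) {} {..<m} \<in> g ` carrier ?TS" if "S \<in> carrier L" for S
    proof (cases "S = b")
      \<comment> \<open>The bottom of \<open>L\<close> is absent from the string; its box is the
        image of the top of the lower cube.\<close>
      case True
      have "Inl (Inl {..<m}) \<in> carrier ?TS" unfolding car by blast
      then have "g (Inl (Inl {..<m})) \<in> g ` carrier ?TS" by (rule imageI)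
      then show ?thesis using True b(2) by (simp add: g)
    next
      case False
      then have "Inl (Inr S) \<in> carrier ?TS" using that unfolding car by blast
      then have "g (Inl (Inr S)) \<in> g ` carrier ?TS" by (rule imageI)
      then show ?thesis by (simp add: g)
    qed
    have mid: "box K {} {..<m} \<in> g ` carrier ?TS" if K: "K \<in> carrier (CD G)" for K
    proof -
      obtain S where "S \<in> carrier L" "K = h S" using K unfolding him[symmetric] by (rule imageE)
      then show ?thesis using midh by (simp only:)
    qed
    have low: "box (center G) {} J \<in> g ` carrier ?TS" if "J \<subseteq> {..<m}" for J
    proof -
      have "Inl (Inl J) \<in> carrier ?TS" using that unfolding car by blast
      then have "g (Inl (Inl J)) \<in> g ` carrier ?TS" by (rule imageI)
      then show ?thesis by (simp add: g)
    qed
    have high: "box (carrier G) J {..<m} \<in> g ` carrier ?TS" if "J \<subseteq> {..<m}" for J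
    proof (cases "J = {}")
      \<comment> \<open>The empty set is dropped from the upper cube; its box is the one that the
        center component assigns to \<open>carrier G\<close>.\<close>
      case True
      then show ?thesis using mid[OF carrier_in_CD] by simp
    next
      case False
      then have "Inr J \<in> carrier ?TS" using that unfolding car by blast
      then have "g (Inr J) \<in> g ` carrier ?TS" by (rule imageI)
      then show ?thesis by (simp add: g)
    qed
    show "carrier (CD T) \<subseteq> g ` carrier ?TS" unfolding carrier_CD_T using low mid high by blast
  qed
  ultimately have "order_iso ?TS (CD T) g"
    unfolding order_iso_def bij_betw_def using reflect by (simp add: CD_def)
  then show ?thesis by blast
qed

end

section \<open>Assembling the group and its lattice\<close>

theorem theorem2p1:
  fixes N :: "('a, 'b) monoid_scheme" and p m n :: nat
  assumes "prime p"
    and "p_group p N"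
    and "carrier N \<in> carrier (CD N)"
    and "frattini N \<subseteq> center N"
    and "m \<ge> 1" and "n \<ge> 2"
  shows "\<exists>(P :: nat monoid) f. p_group p P \<and> normal_embedding f N P \<and>
           (\<exists>(L1 :: nat set gorder) (L2 :: nat set gorder) (L3 :: nat set gorder).
              lattice_isomorphic (CD P) (three_string L1 L2 L3) \<and>
              diamond m L1 \<and> lattice_isomorphic L2 (CD N) \<and> diamond m L3)"
proof -
  obtain k where k: "frattini_central_group N p k" using frattini_central_groupI[OF assms(1,2,4)] by blast
  interpret N: frattini_central_group N p k by fact
  obtain B where "moving_extension N p k B" using N.ex_moving_extension by blast
  then interpret Q: moving_extension N p k B .
  interpret T: string_extension N p k m n
    by (rule string_extension.intro[OF k], rule string_extension_axioms.intro) (fact assms)+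
  let ?TQ = "T.T \<times>\<times> Q.Q"
  have gTQ: "group ?TQ" using DirProd_group[OF T.group_T Q.group_Q] .
  have finTQ: "finite (carrier ?TQ)" using T.finite_T Q.finite_Q by simp
  have CD_TQ: "order_iso (CD T.T) (CD ?TQ) (\<lambda>H. H \<times> (B \<times> Q.Der))"
    using order_iso_CD_DirProd[OF T.group_T T.finite_T Q.group_Q Q.finite_Q Q.CD_Q] .
  obtain P :: "nat monoid" and h where P: "group P" and h: "h \<in> iso ?TQ P"
    using ex_iso_nat_monoid[OF gTQ finTQ] by blast
  interpret P: group P by fact
  have CD_P: "order_iso (CD ?TQ) (CD P) (image h)" using order_iso_CD_iso[OF gTQ P h finTQ] .
  have bijh: "bij_betw h (carrier ?TQ) (carrier P)" using h by (simp add: iso_def)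
  have finP: "finite (carrier P)" using bij_betw_finite[OF bijh] finTQ by blast
  have "p_group p P"
  proof -
    obtain i j where "order T.T = p ^ i" "order Q.Q = p ^ j"
      using T.p_group_T Q.p_group_Q by (auto simp: p_group_def)
    then have "order ?TQ = p ^ (i + j)"
      by (simp add: order_def card_cartesian_product power_add)
    then have "order P = p ^ (i + j)" using bij_betw_same_card[OF bijh] by (simp add: order_def)
    then show ?thesis using P finP by (auto simp: p_group_def)
  qed
  moreover have "\<exists>f. normal_embedding f N P"
  proof -
    define e :: "'a \<Rightarrow> 'a \<times> ('a \<Rightarrow> 'a)" where "e = (\<lambda>x. (x, \<lambda>a\<in>carrier N. \<one>\<^bsub>N\<^esub>))"
    have e: "e \<in> hom N Q.Q" "inj_on e (carrier N)" "e ` carrier N \<lhd> Q.Q"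
      using Q.normal_embedding_Q unfolding normal_embedding_def mon_def e_def by auto
    \<comment> \<open>\<open>N\<close> goes into the second factor only, where its image is
      normal.\<close>
    define f where "f = (\<lambda>x. (\<one>\<^bsub>T.T\<^esub>, e x))"
    interpret T': group T.T by (rule T.group_T)
    have hom1: "f \<in> hom N ?TQ" using e(1) by (auto simp: f_def hom_def)
    have inj1: "inj_on f (carrier N)" using e(2) by (auto simp: f_def inj_on_def)
    have im: "f ` carrier N = {\<one>\<^bsub>T.T\<^esub>} \<times> (e ` carrier N)" by (auto simp: f_def)
    have nor: "f ` carrier N \<lhd> ?TQ"
      unfolding im by (rule T'.DirProd_normal[OF Q.group_Q T'.one_is_normal e(3)])
    have hhom: "h \<in> hom ?TQ P" and hinj: "inj_on h (carrier ?TQ)" using h by (auto simp: iso_def bij_betw_def)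
    have "h \<circ> f \<in> hom N P" using hom_compose[OF hom1 hhom] .
    moreover have "f ` carrier N \<subseteq> carrier ?TQ" by (intro image_subsetI hom_in_carrier[OF hom1])
    then have "inj_on (h \<circ> f) (carrier N)" using comp_inj_on[OF inj1 inj_on_subset[OF hinj]] by blast
    moreover have "h ` f ` carrier N \<lhd> P" using iso_normal_subgroup[OF h gTQ P nor] .
    ultimately have "normal_embedding (h \<circ> f) N P" by (simp add: normal_embedding_def mon_def image_comp)
    then show ?thesis by blast
  qed
  moreover have "\<exists>(L1 :: nat set gorder) (L2 :: nat set gorder) (L3 :: nat set gorder).
      lattice_isomorphic (CD P) (three_string L1 L2 L3) \<and>
      diamond m L1 \<and> lattice_isomorphic L2 (CD N) \<and> diamond m L3"
  proof -
    obtain q :: "'a \<Rightarrow> nat" where q: "inj_on q (carrier N)"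
      using finite_imp_inj_to_nat_seg[OF N.finite_carrier] by metis
    \<comment> \<open>A copy of \<open>CD N\<close> whose elements are sets of natural numbers, as
      the type of the center component demands.\<close>
    define L :: "nat set gorder" where "L = \<lparr>carrier = image q ` carrier (CD N), eq = (=), le = (\<subseteq>)\<rparr>"
    have sub: "H \<subseteq> carrier N" if "H \<in> carrier (CD N)" for H
      using that by (auto simp: N.carrier_CD dest: subgroup.subset)
    have qi: "q ` H \<subseteq> q ` K \<longleftrightarrow> H \<subseteq> K" if "H \<subseteq> carrier N" "K \<subseteq> carrier N" for H K
      using that q by (metis image_mono inv_into_image_cancel)
    have "inj_on (image q) (carrier (CD N))"
      using sub qi by (intro inj_onI) (metis subset_antisym subset_refl)
    then have L: "order_iso (CD N) L (image q)"
      unfolding order_iso_def bij_betw_def using sub qi by (simp add: L_def CD_def)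
    have "lattice_isomorphic (CD N) L"
      using order_iso_lattice_isomorphic[OF L N.lattice_CD[OF N.finite_carrier]] by (simp add: L_def)
    then have lat: "lattice L" unfolding lattice_isomorphic_def join_pres_def by blast
    note Linv = order_iso_inv[OF L]
    have LN: "lattice_isomorphic L (CD N)"
      using order_iso_lattice_isomorphic[OF Linv lat] by (simp add: CD_def)
    obtain g where g: "order_iso (three_string (cube m) L (cube m)) (CD T.T) g"
      using T.order_iso_three_string_T[OF Linv] by blast
    \<comment> \<open>The isomorphism is reversed because \<open>CD P\<close> is already known to be
      a lattice; that the string is one is then transported from it.\<close>
    note order_iso_inv[OF order_iso_trans[OF order_iso_trans[OF g CD_TQ] CD_P]]
    then have "lattice_isomorphic (CD P) (three_string (cube m) L (cube m))"
      using P.lattice_CD[OF finP] by (rule order_iso_lattice_isomorphic) (simp add: three_string_def adjoin_def)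
    moreover have "order_iso (cube m) (cube m) id" by (simp add: order_iso_def)
    then have "diamond m (cube m)"
      unfolding diamond_def using lattice_cube by (rule order_iso_lattice_isomorphic) (simp add: cube_def)
    ultimately show ?thesis using LN by blast
  qed
  ultimately show ?thesis by blast
qed

end
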